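(* Let $p>1$, $\epsilon>0$, and set $C_\epsilon=\Big(1-\big(\tfrac{1}{1+\epsilon}\big)^{\frac{1}{p-1}}\Big)^{1-p}$. Suppose that $\xi$ and $f$ satisfy Hypothesis (H) (stated in the context) with exponent $p$, constants $L,L'\ge0$ and parameter $\beta$, where $$\beta>1+\frac{C_\epsilon}{1+\epsilon}+pL'+(p-1)\big((L+1)^p(1+\epsilon)\big)^{\frac{1}{p-1}} .$$ Let $(Y,Z)\in L^p_\beta$ be the solution in $L^p_\beta$ of $$Y_t+\int_t^T\!\!\int_K Z(s,x)\,\mu(ds,dx)=\xi+\int_t^T\!\!\int_K f(s,x,Y_{s-},Z_s(\cdot))\,\nu(ds,dx),\qquad t\in[0,T],$$ and, for each integer $m\ge1$, let $(Y^m,Z^m)\in L^p_\beta$ be the solution in $L^p_\beta$ of $$Y^m_t+\int_t^T\!\!\int_K Z^m(s,x)\,\mu(ds,dx)=\xi\,1_{\{T<S_m\}}+\int_t^T\!\!\int_K f(s,x,Y^m_s,Z^m_s(\cdot))\,1_{\{s\le S_m\}}\,\nu(ds,dx),\qquad t\in[0,T],$$ with $Y^m_s=0$ and $Z^m_s=0$ for $S_m<s\le T$. Then there exists a constant $C$, independent of $m$, such that for every $m\ge1$ $$\mathbb E\int_0^T\!\!\int_K\big(|Y_s-Y^m_s|^p+|Z(s,x)-Z^m(s,x)|^p\big)e^{\beta A_s}\,\nu(ds,dx)\le C\,\mathbb E\Big[|\xi|^pe^{\beta A_T}1_{\{S_m<T\}}+\int_{S_m\wedge T}^{T}\!\int_K|f(s,x,0,0)|^pe^{\beta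 A_s}\,\nu(ds,dx)\Big].$$
   Context: Setting. $T\in(0,\infty)$, $(\Omega,\mathcal F,\mathbb P)$ is a complete probability space, $(K,\mathcal K)$ is a Lusin space. $(S_n,X_n)_{n\ge1}$ is a non-explosive marked point process: $S_n$ takes values in $(0,T]\cup\{\infty\}$, $X_n$ takes values in $K$, $S_0=0$, $S_1>0$ a.s., $S_n\le S_{n+1}$ everywhere, $S_n<S_{n+1}$ if $S_n\le T$, and $\Omega=\bigcup_n\{S_n>T\}$; $X_n=\Delta$ when $S_n=\infty$, for a distinguished point $\Delta\in K$. Set $\mu(dt,dx)=\sum_{n\ge1:\,S_n\le T}\delta_{(S_n,X_n)}(dt,dx)$ (sum of Dirac masses). $(\mathcal F_t)_{t\ge0}$ is the smallest filtration for which each $S_n$ is a stopping time and $X_n$ is $\mathcal F_{S_n}$-measurable. $\mathcal P$ is the predictable $\sigma$-field on $\Omega\times[0,T]$; for a measurable space $(G,\mathcal G)$, a function on $\Omega\times[0,T]\times G$ is called predictable if it is $\mathcal P\otimes\mathcal G$-measurable. $\nu$ is the predictable compensator of $\mu$ relative to $(\mathcal F_t)$; it disintegrates as $\nu(\omega,dt,dx)=dA_t(\omega)\,\phi_{\omega,t}(dx)$, where $A$ is the predictable increasing càdlàg process with $A_0=0$ compensating $N_t=\mu([0,t]\times K)$, and $\phi$ is a transition probability from $(\Omega\times[0,T],\mathcal P)$ into $(K,\mathcal K)$. Standing assumption: $A$ is continuous (equivalently, the $S_n$ are totally inaccessible). Integrals $\int_t^T$ are over $(t,T]$. $\mathcal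 B(K)$ is the set of Borel functions on $K$; for $Z$ on $\Omega\times[0,T]\times K$, $Z_{\omega,t}(x)=Z(\omega,t,x)$, abbreviated $Z_t$ or $Z_t(\cdot)$. A solution of such an equation is a pair $(Y,Z)$ with $Y$ real-valued, adapted and càdlàg, $Z$ a real predictable function on $\Omega\times[0,T]\times K$ with $\int_0^T\int_K|Z(s,x)|\,\nu(ds,dx)<\infty$ a.s., such that the equation holds for all $t\in[0,T]$ outside a $\mathbb P$-null set. Under the stated assumptions both equations have a unique solution in $L^p_\beta$. $L^p_\beta$ ($\beta>0$) is the Banach space of equivalence classes of pairs $(Y,Z)$ on $[0,T]$ with $Y$ progressive, $Z$ predictable and $\mathbb E\int_0^T\int_K(|Y_s|^p+|Z(s,x)|^p)e^{\beta A_s}\,\nu(ds,dx)<\infty$, pairs being identified when they agree almost everywhere with respect to $\mathbb P(d\omega)\,\nu(\omega,dt,dx)$. Hypothesis (H) (with $p>1$, $\beta>0$, $L,L'\ge0$): 1. $\xi:\Omega\to\mathbb R$ is $\mathcal F_T$-measurable and $\mathbb E[e^{\beta A_T}|\xi|^p]<\infty$. 2. $f$ is a real-valued function on $\Omega\times[0,T]\times K\times\mathbb R\times\mathcal B(K)$ such that: (i) for any predictable function $Z$ on $\Omega\times[0,T]\times K$ the map $(\omega,t,x,y)\mapsto f(\omega,t,x,y,Z_{\omega,t}(\cdot))$ is predictable; (ii) for all $\omega,t,x$, $y,y'\in\mathbb R$, $\zeta,\zeta'\in\mathcal B(K)$: $|f(\omega,t,x,y',\zeta)-f(\omega,t,x,y,\zeta)|\le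 L'|y'-y|$ and $\int_K|f(\omega,t,x,y,\zeta)-f(\omega,t,x,y,\zeta')|\,\phi_{\omega,t}(dx)\le L\big(\int_K|\zeta'(v)-\zeta(v)|^p\,\phi_{\omega,t}(dv)\big)^{1/p}$; (iii) $\mathbb E\int_0^T\int_K e^{\beta A_t}|f(t,x,0,0)|^p\,\nu(dt,dx)<\infty$. *)

theory Defs
  imports "HOL-Probability.Probability"
begin

text \<open>A Hausdorff space is Lusin if it carries a finer Polish topology, i.e. if it is the image of a
  Polish space under a continuous bijection.\<close>

class lusin_space = t2_space +
  assumes finer_polish_topology:
    "\<exists>P :: 'a topology. topspace P = UNIV \<and> completely_metrizable_space P \<and> second_countable P \<and>
       (\<forall>U. open U \<longrightarrow> openin P U)"

instance polish_space \<subseteq> lusin_space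
proof
  obtain B :: "'a set set" where B: "countable B" "topological_basis B"
    using ex_countable_basis by blast
  have "second_countable (euclidean :: 'a topology)"
    unfolding second_countable_def
  proof (intro exI[of _ B] conjI allI impI ballI)
    show "countable B" by (fact B(1))
    show "openin euclidean V" if "V \<in> B" for V
      using topological_basis_open[OF B(2) that] by simp
    show "\<exists>V\<in>B. x \<in> V \<and> V \<subseteq> U" if "openin euclidean U \<and> x \<in> U" for U x
    proof -
      have "open U" "x \<in> U" using that by simp_all
      then show ?thesis using topological_basisE[OF B(2)] by metis
    qed
  qed
  then show "\<exists>P :: 'a topology. topspace P = UNIV \<and> completely_metrizable_space P \<and>
      second_countable P \<and> (\<forall>U. open U \<longrightarrow> openin P U)"
    using completely_metrizable_space_euclidean[where 'a = 'a] by (intro exI[of _ euclidean]) simp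
qed

text \<open>Filtrations are indexed by \<open>ennreal\<close>, so that the library notions of stopping time and of the
  \<open>\<sigma>\<close>-algebra \<open>F\<^sub>S\<close> apply to the extended-valued times \<open>S n\<close>. The extra index \<open>\<infinity>\<close> does not influence
  the smallest filtration at finite times.\<close>

definition carries_mpp ::
  "'w set \<Rightarrow> (nat \<Rightarrow> 'w \<Rightarrow> ennreal) \<Rightarrow> (nat \<Rightarrow> 'w \<Rightarrow> 'k::topological_space) \<Rightarrow> (ennreal \<Rightarrow> 'w measure) \<Rightarrow> bool"
  where "carries_mpp \<Omega> S X F \<longleftrightarrow> filtration \<Omega> F \<and>
    (\<forall>n\<ge>1. stopping_time F (S n) \<and> X n \<in> filtration.pre_sigma \<Omega> F (S n) \<rightarrow>\<^sub>M borel)"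

definition generated_filtration ::
  "'w set \<Rightarrow> (nat \<Rightarrow> 'w \<Rightarrow> ennreal) \<Rightarrow> (nat \<Rightarrow> 'w \<Rightarrow> 'k::topological_space) \<Rightarrow> (ennreal \<Rightarrow> 'w measure) \<Rightarrow> bool"
  where "generated_filtration \<Omega> S X F \<longleftrightarrow> carries_mpp \<Omega> S X F \<and>
    (\<forall>G. carries_mpp \<Omega> S X G \<longrightarrow> (\<forall>t. sets (F t) \<subseteq> sets (G t)))"

text \<open>The image of the counting measure is the sum of the Dirac masses at \<open>(S n \<omega>, X n \<omega>)\<close>.\<close>

definition jump_measure ::
  "real \<Rightarrow> (nat \<Rightarrow> 'w \<Rightarrow> ennreal) \<Rightarrow> (nat \<Rightarrow> 'w \<Rightarrow> 'k::topological_space) \<Rightarrow> 'w \<Rightarrow> (real \<times> 'k) measure"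
  where "jump_measure T S X \<omega> =
    distr (count_space {n. 1 \<le> n \<and> S n \<omega> \<le> ennreal T}) (borel \<Otimes>\<^sub>M borel)
      (\<lambda>n. (enn2real (S n \<omega>), X n \<omega>))"

definition predictable_algebra :: "'w set \<Rightarrow> real \<Rightarrow> (ennreal \<Rightarrow> 'w measure) \<Rightarrow> ('w \<times> real) measure"
  where "predictable_algebra \<Omega> T F = sigma (\<Omega> \<times> {0..T})
    ({B \<times> {0} | B. B \<in> sets (F 0)} \<union>
     {B \<times> {s<..t} | B s t. 0 \<le> s \<and> s \<le> t \<and> t \<le> T \<and> B \<in> sets (F (ennreal s))})"

definition predictable ::
  "'w set \<Rightarrow> real \<Rightarrow> (ennreal \<Rightarrow> 'w measure) \<Rightarrow> ('w \<Rightarrow> real \<Rightarrow> 'k::topological_space \<Rightarrow> real) \<Rightarrow> bool"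
  where "predictable \<Omega> T F Z \<longleftrightarrow>
    (\<lambda>((\<omega>, t), x). Z \<omega> t x) \<in> borel_measurable (predictable_algebra \<Omega> T F \<Otimes>\<^sub>M borel)"

definition adapted_process :: "real \<Rightarrow> (ennreal \<Rightarrow> 'w measure) \<Rightarrow> ('w \<Rightarrow> real \<Rightarrow> real) \<Rightarrow> bool"
  where "adapted_process T F Y \<longleftrightarrow>
    (\<forall>t\<in>{0..T}. (\<lambda>\<omega>. Y \<omega> t) \<in> borel_measurable (F (ennreal t)))"

definition progressive :: "real \<Rightarrow> (ennreal \<Rightarrow> 'w measure) \<Rightarrow> ('w \<Rightarrow> real \<Rightarrow> real) \<Rightarrow> bool"
  where "progressive T F Y \<longleftrightarrow> (\<forall>t\<in>{0..T}.
    (\<lambda>(\<omega>, s). Y \<omega> s) \<in> borel_measurable (F (ennreal t) \<Otimes>\<^sub>M restrict_space borel {0..t}))"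

definition cadlag :: "real \<Rightarrow> (real \<Rightarrow> real) \<Rightarrow> bool"
  where "cadlag T y \<longleftrightarrow> (\<forall>t\<in>{0..<T}. (y \<longlongrightarrow> y t) (at_right t)) \<and>
    (\<forall>t\<in>{0<..T}. \<exists>l. (y \<longlongrightarrow> l) (at_left t))"

definition predictable_random_measure ::
  "'w set \<Rightarrow> real \<Rightarrow> (ennreal \<Rightarrow> 'w measure) \<Rightarrow> ('w \<Rightarrow> (real \<times> 'k::topological_space) measure) \<Rightarrow> bool"
  where "predictable_random_measure \<Omega> T F \<nu> \<longleftrightarrow>
    (\<forall>\<omega>\<in>\<Omega>. sets (\<nu> \<omega>) = sets (borel \<Otimes>\<^sub>M borel)) \<and>
    (\<forall>H :: ('w \<times> real) \<times> 'k \<Rightarrow> ennreal.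
       H \<in> borel_measurable (predictable_algebra \<Omega> T F \<Otimes>\<^sub>M borel) \<longrightarrow>
       (\<lambda>(\<omega>, t). \<integral>\<^sup>+z\<in>{0<..t} \<times> UNIV. H ((\<omega>, fst z), snd z) \<partial>\<nu> \<omega>)
         \<in> borel_measurable (predictable_algebra \<Omega> T F))"

definition predictable_compensator ::
  "'w measure \<Rightarrow> real \<Rightarrow> (ennreal \<Rightarrow> 'w measure) \<Rightarrow> ('w \<Rightarrow> (real \<times> 'k::topological_space) measure) \<Rightarrow>
   ('w \<Rightarrow> (real \<times> 'k) measure) \<Rightarrow> bool"
  where "predictable_compensator M T F \<mu> \<nu> \<longleftrightarrow>
    predictable_random_measure (space M) T F \<nu> \<and>
    (\<forall>H :: ('w \<times> real) \<times> 'k \<Rightarrow> ennreal.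
       H \<in> borel_measurable (predictable_algebra (space M) T F \<Otimes>\<^sub>M borel) \<longrightarrow>
       (\<integral>\<^sup>+\<omega>. (\<integral>\<^sup>+z\<in>{0<..T} \<times> UNIV. H ((\<omega>, fst z), snd z) \<partial>\<mu> \<omega>) \<partial>M) =
       (\<integral>\<^sup>+\<omega>. (\<integral>\<^sup>+z\<in>{0<..T} \<times> UNIV. H ((\<omega>, fst z), snd z) \<partial>\<nu> \<omega>) \<partial>M))"

text \<open>The path \<open>a\<close> on \<open>{0..T}\<close> is extended by constants, so the measure is carried by \<open>{0<..T}\<close>.\<close>

definition stieltjes :: "real \<Rightarrow> (real \<Rightarrow> real) \<Rightarrow> real measure"
  where "stieltjes T a = interval_measure (\<lambda>t. a (max 0 (min T t)))"

text \<open>The compensator is determined only up to a null set, so the path properties of \<open>A\<close> and the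
  disintegration \<open>\<nu>(\<omega>, dt, dx) = dA\<^sub>t(\<omega>) \<phi>(\<omega>, t, dx)\<close> are required almost surely. That \<open>A\<close>
  compensates \<open>N\<^sub>t = \<mu>([0,t] \<times> K)\<close> is the defining identity of \<open>\<nu>\<close> for integrands \<open>H\<close> not depending
  on the mark.\<close>

locale marked_point_process = prob_space M + complete_measure M
  for M :: "'w measure" +
  fixes T :: real
    and S :: "nat \<Rightarrow> 'w \<Rightarrow> ennreal"
    and X :: "nat \<Rightarrow> 'w \<Rightarrow> 'k::lusin_space"
    and \<Delta> :: 'k
    and F :: "ennreal \<Rightarrow> 'w measure"
    and \<nu> :: "'w \<Rightarrow> (real \<times> 'k) measure"
    and A :: "'w \<Rightarrow> real \<Rightarrow> real"
    and \<phi> :: "'w \<Rightarrow> real \<Rightarrow> 'k measure"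
  assumes T_pos: "0 < T"
    and S_measurable: "\<And>n. n \<ge> 1 \<Longrightarrow> S n \<in> borel_measurable M"
    and X_measurable: "\<And>n. n \<ge> 1 \<Longrightarrow> X n \<in> borel_measurable M"
    and S_range: "\<And>n \<omega>. n \<ge> 1 \<Longrightarrow> \<omega> \<in> space M \<Longrightarrow> S n \<omega> \<in> ennreal ` {0<..T} \<union> {\<infinity>}"
    and S_0: "\<And>\<omega>. \<omega> \<in> space M \<Longrightarrow> S 0 \<omega> = 0"
    and S_1_pos: "AE \<omega> in M. 0 < S 1 \<omega>"
    and S_mono: "\<And>n \<omega>. \<omega> \<in> space M \<Longrightarrow> S n \<omega> \<le> S (Suc n) \<omega>"
    and S_strict: "\<And>n \<omega>. \<omega> \<in> space M \<Longrightarrow> S n \<omega> \<le> ennreal T \<Longrightarrow> S n \<omega> < S (Suc n) \<omega>"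
    and non_explosive: "space M = (\<Union>n. {\<omega> \<in> space M. ennreal T < S n \<omega>})"
    and X_infinity: "\<And>n \<omega>. n \<ge> 1 \<Longrightarrow> \<omega> \<in> space M \<Longrightarrow> S n \<omega> = \<infinity> \<Longrightarrow> X n \<omega> = \<Delta>"
    and F_generated: "generated_filtration (space M) S X F"
    and \<nu>_compensator: "predictable_compensator M T F (jump_measure T S X) \<nu>"
    and A_predictable: "(\<lambda>(\<omega>, t). A \<omega> t) \<in> borel_measurable (predictable_algebra (space M) T F)"
    and A_0: "AE \<omega> in M. A \<omega> 0 = 0"
    and A_increasing: "AE \<omega> in M. mono_on {0..T} (A \<omega>)"
    and A_continuous: "AE \<omega> in M. continuous_on {0..T} (A \<omega>)"
    and \<phi>_transition: "(\<lambda>(\<omega>, t). \<phi> \<omega> t) \<in> predictable_algebra (space M) T F \<rightarrow>\<^sub>M prob_algebra borel"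
    and \<nu>_disintegration: "AE \<omega> in M. \<forall>B\<in>sets (borel \<Otimes>\<^sub>M borel).
        emeasure (\<nu> \<omega>) B =
          (\<integral>\<^sup>+t\<in>{0<..T}. emeasure (\<phi> \<omega> t) {x. (t, x) \<in> B} \<partial>stieltjes T (A \<omega>))"

text \<open>The set of representatives of elements of \<open>L\<^sup>p\<^sub>\<beta>\<close>; the identification of pairs that agree
  \<open>P(d\<omega>)\<nu>(\<omega>, dt, dx)\<close>-almost everywhere is not carried out.\<close>

definition Lp_beta ::
  "'w measure \<Rightarrow> real \<Rightarrow> (ennreal \<Rightarrow> 'w measure) \<Rightarrow> ('w \<Rightarrow> (real \<times> 'k::topological_space) measure) \<Rightarrow>
   ('w \<Rightarrow> real \<Rightarrow> real) \<Rightarrow> real \<Rightarrow> real \<Rightarrow> (('w \<Rightarrow> real \<Rightarrow> real) \<times> ('w \<Rightarrow> real \<Rightarrow> 'k \<Rightarrow> real)) set"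
  where "Lp_beta M T F \<nu> A p \<beta> = {(Y, Z). progressive T F Y \<and> predictable (space M) T F Z \<and>
    (\<integral>\<^sup>+\<omega>. (\<integral>\<^sup>+z\<in>{0<..T} \<times> UNIV.
        ennreal ((\<bar>Y \<omega> (fst z)\<bar> powr p + \<bar>Z \<omega> (fst z) (snd z)\<bar> powr p) * exp (\<beta> * A \<omega> (fst z)))
      \<partial>\<nu> \<omega>) \<partial>M) < \<infinity>}"

text \<open>\<open>f \<omega> t x y \<zeta>\<close> is only constrained for Borel functions \<open>\<zeta>\<close>. In the second Lipschitz condition
  nothing is required when the right-hand integral is infinite.\<close>

definition hypothesis_H ::
  "'w measure \<Rightarrow> real \<Rightarrow> (ennreal \<Rightarrow> 'w measure) \<Rightarrow> ('w \<Rightarrow> (real \<times> 'k::topological_space) measure) \<Rightarrow>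
   ('w \<Rightarrow> real \<Rightarrow> real) \<Rightarrow> ('w \<Rightarrow> real \<Rightarrow> 'k measure) \<Rightarrow> real \<Rightarrow> real \<Rightarrow> real \<Rightarrow> real \<Rightarrow> ('w \<Rightarrow> real) \<Rightarrow>
   ('w \<Rightarrow> real \<Rightarrow> 'k \<Rightarrow> real \<Rightarrow> ('k \<Rightarrow> real) \<Rightarrow> real) \<Rightarrow> bool"
  where "hypothesis_H M T F \<nu> A \<phi> p \<beta> L L' \<xi> f \<longleftrightarrow>
    1 < p \<and> 0 < \<beta> \<and> 0 \<le> L \<and> 0 \<le> L' \<and>
    \<xi> \<in> borel_measurable (F (ennreal T)) \<and>
    (\<integral>\<^sup>+\<omega>. ennreal (exp (\<beta> * A \<omega> T) * \<bar>\<xi> \<omega>\<bar> powr p) \<partial>M) < \<infinity> \<and>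
    (\<forall>Z. predictable (space M) T F Z \<longrightarrow>
       (\<lambda>((\<omega>, t), (x, y)). f \<omega> t x y (Z \<omega> t))
         \<in> borel_measurable (predictable_algebra (space M) T F \<Otimes>\<^sub>M (borel \<Otimes>\<^sub>M borel))) \<and>
    (\<forall>\<omega>\<in>space M. \<forall>t\<in>{0..T}. \<forall>x y y'. \<forall>\<zeta>\<in>borel_measurable borel.
       \<bar>f \<omega> t x y' \<zeta> - f \<omega> t x y \<zeta>\<bar> \<le> L' * \<bar>y' - y\<bar>) \<and>
    (\<forall>\<omega>\<in>space M. \<forall>t\<in>{0..T}. \<forall>y. \<forall>\<zeta>\<in>borel_measurable borel. \<forall>\<zeta>'\<in>borel_measurable borel.
       integrable (\<phi> \<omega> t) (\<lambda>v. \<bar>\<zeta>' v - \<zeta> v\<bar> powr p) \<longrightarrow>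
       (\<integral>\<^sup>+x. ennreal \<bar>f \<omega> t x y \<zeta> - f \<omega> t x y \<zeta>'\<bar> \<partial>\<phi> \<omega> t)
         \<le> ennreal (L * (\<integral>v. \<bar>\<zeta>' v - \<zeta> v\<bar> powr p \<partial>\<phi> \<omega> t) powr (1 / p))) \<and>
    (\<integral>\<^sup>+\<omega>. (\<integral>\<^sup>+z\<in>{0<..T} \<times> UNIV.
        ennreal (exp (\<beta> * A \<omega> (fst z)) * \<bar>f \<omega> (fst z) (snd z) 0 (\<lambda>_. 0)\<bar> powr p)
      \<partial>\<nu> \<omega>) \<partial>M) < \<infinity>"

text \<open>Solution of \<open>Y\<^sub>t + \<integral>\<^sub>(\<^sub>t\<^sub>,\<^sub>T\<^sub>] Z d\<mu> = \<xi> + \<integral>\<^sub>(\<^sub>t\<^sub>,\<^sub>T\<^sub>] g d\<nu>\<close>, where \<open>g\<close> is the generator with \<open>(Y, Z)\<close>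
  already inserted. Bochner integrals of non-integrable functions are 0 by convention, whence the
  explicit integrability of \<open>g\<close>; the \<open>\<mu>\<close>-integral is a finite sum.\<close>

definition bsde_solution ::
  "'w measure \<Rightarrow> real \<Rightarrow> (ennreal \<Rightarrow> 'w measure) \<Rightarrow> ('w \<Rightarrow> (real \<times> 'k::topological_space) measure) \<Rightarrow>
   ('w \<Rightarrow> (real \<times> 'k) measure) \<Rightarrow> ('w \<Rightarrow> real) \<Rightarrow> ('w \<Rightarrow> real \<Rightarrow> 'k \<Rightarrow> real) \<Rightarrow>
   ('w \<Rightarrow> real \<Rightarrow> real) \<Rightarrow> ('w \<Rightarrow> real \<Rightarrow> 'k \<Rightarrow> real) \<Rightarrow> bool"
  where "bsde_solution M T F \<mu> \<nu> \<xi> g Y Z \<longleftrightarrow>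
    adapted_process T F Y \<and> (AE \<omega> in M. cadlag T (Y \<omega>)) \<and> predictable (space M) T F Z \<and>
    (AE \<omega> in M. (\<integral>\<^sup>+z\<in>{0<..T} \<times> UNIV. ennreal \<bar>Z \<omega> (fst z) (snd z)\<bar> \<partial>\<nu> \<omega>) < \<infinity>) \<and>
    (AE \<omega> in M. set_integrable (\<nu> \<omega>) ({0<..T} \<times> UNIV) (\<lambda>(s, x). g \<omega> s x)) \<and>
    (AE \<omega> in M. \<forall>t\<in>{0..T}.
       Y \<omega> t + set_lebesgue_integral (\<mu> \<omega>) ({t<..T} \<times> UNIV) (\<lambda>(s, x). Z \<omega> s x) =
       \<xi> \<omega> + set_lebesgue_integral (\<nu> \<omega>) ({t<..T} \<times> UNIV) (\<lambda>(s, x). g \<omega> s x))"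

definition left_limit :: "(real \<Rightarrow> real) \<Rightarrow> real \<Rightarrow> real"
  where "left_limit y t = Lim (at_left t) y"

definition C_eps :: "real \<Rightarrow> real \<Rightarrow> real"
  where "C_eps p \<epsilon> = (1 - (1 / (1 + \<epsilon>)) powr (1 / (p - 1))) powr (1 - p)"

end

theory Submission
  imports Defs
begin

text \<open>The difference \<open>y = Y - Y\<^sup>m\<close>, \<open>z = Z - Z\<^sup>m\<close> of the two solutions solves an equation of the same type,
\<open>dy = z d\<mu> - g d\<nu>\<close>, where \<open>g\<close> is the difference of the two drivers. On almost every path \<open>A\<close> is
continuous and \<open>\<mu>\<close> has finitely many atoms, so \<open>\<bar>y\<bar>\<^sup>p exp (\<beta> A)\<close> obeys an ordinary chain rule between
the jumps and changes by \<open>(\<bar>y\<^sub>- + z\<bar>\<^sup>p - \<bar>y\<^sub>-\<bar>\<^sup>p) exp (\<beta> A)\<close> at a jump. Dropping the nonnegative term at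
time 0 this gives, along paths,

\<open>\<beta> \<integral> \<bar>y\<bar>\<^sup>p e d\<nu> + \<integral> \<bar>y\<^sub>- + z\<bar>\<^sup>p e d\<mu> \<le> \<bar>y\<^sub>T\<bar>\<^sup>p e\<^sub>T + \<integral> \<bar>y\<^sub>-\<bar>\<^sup>p e d\<mu> + p \<integral> \<bar>y\<bar>\<^sup>p\<^sup>-\<^sup>1 \<bar>g\<bar> e d\<nu>\<close>,  \<open>e = exp (\<beta> A)\<close>.

All terms are nonnegative, so expectations may be taken at once, and since the integrands are
predictable the expected \<open>\<mu>\<close>-integrals equal the expected \<open>\<nu>\<close>-integrals. Two inequalities close the
estimate. First, \<open>\<bar>z\<bar>\<^sup>p \<le> (1 + \<epsilon>) \<bar>y + z\<bar>\<^sup>p + C\<^sub>\<epsilon> \<bar>y\<bar>\<^sup>p\<close> by convexity, so the left side controls \<open>z\<close> at the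
cost of \<open>C\<^sub>\<epsilon> / (1 + \<epsilon>)\<close> times the \<open>y\<close>-term. Second, the Lipschitz conditions and Young's inequality bound
the driver term by \<open>k1 \<bar>y\<bar>\<^sup>p + k2 \<bar>z\<bar>\<^sup>p\<close> with \<open>k2 < 1 / (1 + \<epsilon>)\<close>, plus a multiple of \<open>\<bar>f(\<cdot>, 0, 0)\<bar>\<^sup>p\<close>
restricted to times after \<open>S\<^sub>m\<close>: up to \<open>S\<^sub>m\<close> both equations have the same driver, and after it
\<open>(Y\<^sup>m, Z\<^sup>m)\<close> vanishes. The lower bound on \<open>\<beta>\<close> leaves a positive coefficient in front of the \<open>y\<close>-term,
and finiteness of the norms in \<open>L\<^sup>p\<^sub>\<beta>\<close> allows the \<open>y\<close>- and \<open>z\<close>-terms to be absorbed on the left. The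
three steps are \<open>lp_energy_inequality\<close>, \<open>driver_bound\<close> and \<open>absorb_estimate\<close>.

The terminal difference is \<open>\<xi>\<close> on \<open>{S\<^sub>m \<le> T}\<close>. The event \<open>{S\<^sub>m = T}\<close> is null because \<open>\<nu>\<close> does not charge
the fixed time \<open>T\<close> and hence, in expectation, neither does \<open>\<mu>\<close>.

Only \<open>Y\<^sub>-\<close> is predictable, not \<open>Y\<close>. Therefore the argument runs with a version of \<open>Y\<^sub>-\<close>, built as a limit
of step processes, that is measurable everywhere and agrees with \<open>Y\<close> off the jumps, hence \<open>\<nu>\<close>-almost
everywhere (\<open>left_version_predictable\<close>, \<open>AE_nu_left_version\<close>).\<close>

section \<open>Inequalities for powers\<close>

text \<open>Convexity of the power function at \<open>l (a / l) + (1 - l) (b / (1 - l))\<close>.\<close>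

lemma powr_add_le_weighted:
  fixes a b p l :: real
  assumes "p \<ge> 1" "0 < l" "l < 1" "a \<ge> 0" "b \<ge> 0"
  shows "(a + b) powr p \<le> l powr (1 - p) * a powr p + (1 - l) powr (1 - p) * b powr p"
proof -
  have one_le: "1 \<le> c powr (1 - p)" if "0 < c" "c < 1" for c :: real
  proof -
    have "c powr 0 \<le> c powr (1 - p)" using assms(1) that by (intro powr_mono') auto
    then show ?thesis using that by simp
  qed
  consider "a = 0" | "b = 0" | "a > 0" "b > 0" using assms by fastforce
  then show ?thesis
  proof cases
    case 1
    then show ?thesis using one_le[of "1 - l"] assms by (simp add: mult_le_cancel_right1)
  next
    case 2
    then show ?thesis using one_le[of l] assms by (simp add: mult_le_cancel_right1)
  next
    case 3
    have "((1 - l) *\<^sub>R (b / (1 - l)) + l *\<^sub>R (a / l)) powr p \<le> (1 - l) * (b / (1 - l)) powr p + l * (a / l) powr p"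
      by (rule convex_onD[OF powr_convex[OF assms(1)]]) (use assms 3 in auto)
    moreover have "l * (a / l) powr p = l powr (1 - p) * a powr p" "(1 - l) * (b / (1 - l)) powr p = (1 - l) powr (1 - p) * b powr p"
      using assms 3 by (auto simp: powr_divide powr_diff field_simps)
    ultimately show ?thesis using assms by (simp add: add_ac)
  qed
qed

text \<open>The weight \<open>l = (1 / (1 + \<epsilon>))\<^bsup>1 / (p - 1)\<^esup>\<close> is the one that makes the coefficient \<open>l powr (1 - p)\<close> of the
first term equal to \<open>1 + \<epsilon>\<close>; \<open>C_eps\<close> is then the coefficient of the second.\<close>

lemma abs_powr_le_C_eps:
  fixes y z p \<epsilon> :: real
  assumes "p > 1" "\<epsilon> > 0"
  shows "\<bar>z\<bar> powr p \<le> (1 + \<epsilon>) * \<bar>y + z\<bar> powr p + C_eps p \<epsilon> * \<bar>y\<bar> powr p"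
proof -
  define l where "l = (1 / (1 + \<epsilon>)) powr (1 / (p - 1))"
  have l0: "l > 0" using assms by (simp add: l_def)
  have l1: "l < 1" unfolding l_def using powr_less_mono2[of "1/(p-1)" "1/(1+\<epsilon>)" 1] assms by (simp add: field_simps)
  have "l powr (1 - p) = (1 / (1 + \<epsilon>)) powr (1 / (p - 1) * (1 - p))"
    unfolding l_def by (rule powr_powr)
  also have "1 / (p - 1) * (1 - p) = -1" using assms by (simp add: field_simps)
  also have "(1 / (1 + \<epsilon>)) powr -1 = 1 + \<epsilon>" using assms by (simp add: powr_minus)
  finally have l: "l powr (1 - p) = 1 + \<epsilon>" .
  have "\<bar>z\<bar> powr p \<le> (\<bar>y + z\<bar> + \<bar>y\<bar>) powr p" using assms by (intro powr_mono2) auto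
  also have "\<dots> \<le> l powr (1 - p) * \<bar>y + z\<bar> powr p + (1 - l) powr (1 - p) * \<bar>y\<bar> powr p"
    using assms l0 l1 by (intro powr_add_le_weighted) auto
  finally show ?thesis by (simp add: l C_eps_def l_def[symmetric])
qed

lemma Young_powr:
  fixes u b p \<delta> :: real
  assumes "p > 1" "\<delta> > 0" "u \<ge> 0" "b \<ge> 0"
  shows "p * u powr (p - 1) * b \<le> (p - 1) * \<delta> * u powr p + \<delta> powr (1 - p) * b powr p"
proof -
  define r where "r = p / (p - 1)"
  have r: "r > 1" "1 / r + 1 / p = 1" using assms by (auto simp: r_def field_simps)
  have "(\<delta> powr ((p - 1) / p) * u powr (p - 1)) * (\<delta> powr ((1 - p) / p) * b)
    \<le> (\<delta> powr ((p - 1) / p) * u powr (p - 1)) powr r / r + (\<delta> powr ((1 - p) / p) * b) powr p / p"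
    by (rule Youngs_inequality[OF r(1) assms(1) r(2)]) (use assms in auto)
  moreover have "\<delta> powr ((p - 1) / p) * \<delta> powr ((1 - p) / p) = 1"
    using assms by (simp add: powr_add[symmetric] add_divide_distrib[symmetric])
  then have "(\<delta> powr ((p - 1) / p) * u powr (p - 1)) * (\<delta> powr ((1 - p) / p) * b) = u powr (p - 1) * b"
    by (metis (no_types, opaque_lifting) mult.assoc mult.commute mult_1)
  moreover have "(\<delta> powr ((p - 1) / p) * u powr (p - 1)) powr r = \<delta> * u powr p"
    using assms by (simp add: powr_mult powr_powr r_def)
  moreover have "(\<delta> powr ((1 - p) / p) * b) powr p = \<delta> powr (1 - p) * b powr p"
    using assms by (simp add: powr_mult powr_powr)
  ultimately have "u powr (p - 1) * b \<le> \<delta> * u powr p / r + \<delta> powr (1 - p) * b powr p / p" by simp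
  then have "p * (u powr (p - 1) * b) \<le> p * (\<delta> * u powr p / r + \<delta> powr (1 - p) * b powr p / p)"
    using assms by (intro mult_left_mono) auto
  also have "\<dots> = (p - 1) * \<delta> * u powr p + \<delta> powr (1 - p) * b powr p"
    using assms by (simp add: r_def field_simps)
  finally show ?thesis by (simp add: mult.assoc)
qed

lemma abs_diff_powr_le:
  fixes a b p :: real
  assumes "p \<ge> 0"
  shows "\<bar>a - b\<bar> powr p \<le> 2 powr p * (\<bar>a\<bar> powr p + \<bar>b\<bar> powr p)"
proof -
  have "\<bar>a - b\<bar> powr p \<le> (2 * max \<bar>a\<bar> \<bar>b\<bar>) powr p"
    using assms by (intro powr_mono2) auto
  also have "\<dots> = 2 powr p * max \<bar>a\<bar> \<bar>b\<bar> powr p" by (simp add: powr_mult)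
  also have "\<dots> \<le> 2 powr p * (\<bar>a\<bar> powr p + \<bar>b\<bar> powr p)"
    by (intro mult_left_mono) (auto simp: max_def)
  finally show ?thesis .
qed

text \<open>The bookkeeping at the end of the energy method: \<open>a\<close>, \<open>b\<close>, \<open>c\<close> stand for the norms of \<open>y\<close>, \<open>z\<close> and
\<open>y + z\<close>, and \<open>x\<close>, \<open>d\<close> for the data. Finiteness of \<open>a\<close> and \<open>b\<close> is what permits the subtraction.\<close>

lemma absorb_estimate:
  fixes a b c d x :: ennreal and \<beta> \<epsilon> k1 k2 k3 C' :: real
  assumes fin: "a < \<infinity>" "b < \<infinity>"
    and energy: "ennreal \<beta> * a + c \<le> x + a + (ennreal k1 * a + ennreal k2 * b + ennreal k3 * d)"
    and split: "b \<le> ennreal (1 + \<epsilon>) * c + ennreal C' * a"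
    and pos: "\<beta> \<ge> 0" "\<epsilon> > 0" "k1 \<ge> 0" "k2 \<ge> 0" "k3 \<ge> 0" "C' \<ge> 0"
    and gap: "\<beta> - 1 - k1 - C' / (1 + \<epsilon>) > 0" "1 / (1 + \<epsilon>) - k2 > 0"
  defines "g \<equiv> min (\<beta> - 1 - k1 - C' / (1 + \<epsilon>)) (1 / (1 + \<epsilon>) - k2)"
  shows "a + b \<le> ennreal (max 1 k3 / g) * (x + d)"
proof -
  have g0: "g > 0" using gap by (simp add: g_def)
  show ?thesis
  proof (cases "x + d = \<infinity>")
    case True
    then show ?thesis using g0 by (auto simp: ennreal_mult_top max_def)
  next
    case False
    then have "x \<noteq> \<infinity>" "d \<noteq> \<infinity>" by auto
    then obtain x' d' where x: "x = ennreal x'" "x' \<ge> 0" and d: "d = ennreal d'" "d' \<ge> 0"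
      by (metis ennreal_cases infinity_ennreal_def)
    obtain a' b' where a: "a = ennreal a'" "a' \<ge> 0" and b: "b = ennreal b'" "b' \<ge> 0"
      using fin by (metis ennreal_cases infinity_ennreal_def less_irrefl)
    have rhs: "x + a + (ennreal k1 * a + ennreal k2 * b + ennreal k3 * d) = ennreal (x' + a' + (k1 * a' + k2 * b' + k3 * d'))"
      using x a b d pos by (simp add: ennreal_mult)
    then have "c \<noteq> \<infinity>" using energy by (auto simp: top_unique)
    then obtain c' where c: "c = ennreal c'" "c' \<ge> 0" by (metis ennreal_cases infinity_ennreal_def)
    have "ennreal (\<beta> * a' + c') \<le> ennreal (x' + a' + (k1 * a' + k2 * b' + k3 * d'))"
      using energy unfolding rhs using a c pos by (simp add: ennreal_mult)
    then have 1: "\<beta> * a' + c' \<le> x' + a' + (k1 * a' + k2 * b' + k3 * d')"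
      using x a b d pos by (subst (asm) ennreal_le_iff) auto
    have "ennreal b' \<le> ennreal ((1 + \<epsilon>) * c' + C' * a')"
      using split a b c pos by (simp add: ennreal_mult)
    then have "b' \<le> (1 + \<epsilon>) * c' + C' * a'"
      using a c pos by (subst (asm) ennreal_le_iff) auto
    then have 2: "b' / (1 + \<epsilon>) \<le> c' + C' / (1 + \<epsilon>) * a'"
      using divide_right_mono[of b' "(1 + \<epsilon>) * c' + C' * a'" "1 + \<epsilon>"] pos by (simp add: add_divide_distrib)
    have "g * (a' + b') \<le> (\<beta> - 1 - k1 - C' / (1 + \<epsilon>)) * a' + (1 / (1 + \<epsilon>) - k2) * b'"
      unfolding distrib_left using a b by (intro add_mono mult_right_mono) (auto simp: g_def)
    also have "\<dots> \<le> x' + k3 * d'" using 1 2 by (simp add: algebra_simps)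
    also have "\<dots> \<le> max 1 k3 * x' + max 1 k3 * d'"
      using x d by (intro add_mono mult_right_mono) (auto simp: mult_le_cancel_right1)
    finally have "a' + b' \<le> max 1 k3 / g * (x' + d')"
      using g0 by (simp add: field_simps)
    then have "ennreal (a' + b') \<le> ennreal (max 1 k3 / g * (x' + d'))" by (rule ennreal_leI)
    also have "\<dots> = ennreal (max 1 k3 / g) * ennreal (x' + d')" using g0 x d by (intro ennreal_mult) auto
    finally show ?thesis using a b x d by simp
  qed
qed

section \<open>A chain rule for integrals against a measure without atoms in time\<close>

lemma set_integral_Ioc_split:
  fixes g :: "real \<times> 'k::topological_space \<Rightarrow> 'a::euclidean_space"
  assumes N: "sets N = sets (borel \<Otimes>\<^sub>M borel)"
    and "r \<le> s" "s \<le> t"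
    and g: "set_integrable N ({r<..t} \<times> UNIV) g"
  shows "set_integrable N ({r<..s} \<times> UNIV) g"
    and "set_integrable N ({s<..t} \<times> UNIV) g"
    and "set_lebesgue_integral N ({r<..t} \<times> UNIV) g =
         set_lebesgue_integral N ({r<..s} \<times> UNIV) g + set_lebesgue_integral N ({s<..t} \<times> UNIV) g"
proof -
  have m: "{a<..b::real} \<times> (UNIV :: 'k set) \<in> sets N" for a b
    unfolding N by (intro pair_measureI) auto
  show 1: "set_integrable N ({r<..s} \<times> UNIV) g"
    by (rule set_integrable_subset[OF g m]) (use assms in auto)
  show 2: "set_integrable N ({s<..t} \<times> UNIV) g"
    by (rule set_integrable_subset[OF g m]) (use assms in auto)
  have "{r<..t} \<times> (UNIV :: 'k set) = ({r<..s} \<times> UNIV) \<union> ({s<..t} \<times> UNIV)"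
    using assms by auto
  then show "set_lebesgue_integral N ({r<..t} \<times> UNIV) g =
         set_lebesgue_integral N ({r<..s} \<times> UNIV) g + set_lebesgue_integral N ({s<..t} \<times> UNIV) g"
    using set_integral_Un[OF _ 1 2] by (auto simp: disjoint_iff)
qed

lemma continuous_set_integral_Ioc:
  fixes g :: "real \<times> 'k::topological_space \<Rightarrow> 'a::euclidean_space"
  assumes N: "sets N = sets (borel \<Otimes>\<^sub>M borel)"
    and no_atoms: "\<And>r. r \<in> {s<..t} \<Longrightarrow> emeasure N ({r} \<times> UNIV) = 0"
    and g: "set_integrable N ({s<..t} \<times> UNIV) g"
  shows "continuous_on {s..t} (\<lambda>r. set_lebesgue_integral N ({s<..r} \<times> UNIV) g)"
  unfolding continuous_on_sequentially comp_def
proof (intro ballI allI impI)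
  fix r q assume r: "r \<in> {s..t}" and q: "(\<forall>n. q n \<in> {s..t}) \<and> q \<longlonglongrightarrow> r"
  let ?G = "\<lambda>z. indicator ({s<..t} \<times> UNIV) z *\<^sub>R g z"
  have m: "{a<..b::real} \<times> (UNIV :: 'k set) \<in> sets N" for a b
    unfolding N by (intro pair_measureI) auto
  have sm: "{r} \<times> (UNIV :: 'k set) \<in> sets N"
    unfolding N by (intro pair_measureI) auto
  have e: "set_lebesgue_integral N ({s<..b} \<times> UNIV) g = (\<integral>z. indicator ({s<..b} \<times> UNIV) z *\<^sub>R ?G z \<partial>N)"
    if "b \<in> {s..t}" for b
    unfolding set_lebesgue_integral_def using that
    by (intro Bochner_Integration.integral_cong) (auto simp: indicator_def)
  have "(\<lambda>n. \<integral>z. indicator ({s<..q n} \<times> UNIV) z *\<^sub>R ?G z \<partial>N)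
      \<longlonglongrightarrow> (\<integral>z. indicator ({s<..r} \<times> UNIV) z *\<^sub>R ?G z \<partial>N)"
  proof (rule integral_dominated_convergence)
    have gm: "?G \<in> borel_measurable N" using g unfolding set_integrable_def by auto
    show "(\<lambda>z. indicator ({s<..r} \<times> UNIV) z *\<^sub>R ?G z) \<in> borel_measurable N"
      using gm m by measurable
    show "(\<lambda>z. indicator ({s<..q n} \<times> UNIV) z *\<^sub>R ?G z) \<in> borel_measurable N" for n
      using gm m by measurable
    show "integrable N (\<lambda>z. norm (?G z))"
      using g unfolding set_integrable_def by (rule integrable_norm)
    show "AE z in N. norm (indicator ({s<..q n} \<times> UNIV) z *\<^sub>R ?G z) \<le> norm (?G z)" for n
      by (auto simp: indicator_def)
    have conv: "(\<lambda>n. indicator ({s<..q n} \<times> UNIV) z *\<^sub>R ?G z)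
        \<longlonglongrightarrow> indicator ({s<..r} \<times> UNIV) z *\<^sub>R ?G z" if "fst z \<noteq> r" for z
    proof (rule tendsto_eventually)
      have "\<forall>\<^sub>F n in sequentially. (q n < fst z) = (r < fst z)"
      proof (cases "r < fst z")
        case True
        then show ?thesis using q order_tendstoD(2)[of q r] by (auto elim: eventually_mono)
      next
        case False
        with that have "fst z < r" by auto
        then have "\<forall>\<^sub>F n in sequentially. fst z < q n" using q order_tendstoD(1)[of q r] by auto
        then show ?thesis by eventually_elim (use False in auto)
      qed
      then show "\<forall>\<^sub>F n in sequentially. indicator ({s<..q n} \<times> UNIV) z *\<^sub>R ?G z
          = indicator ({s<..r} \<times> UNIV) z *\<^sub>R ?G z"
        by eventually_elim (auto simp: indicator_def not_less[symmetric])
    qed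
    show "AE z in N. (\<lambda>n. indicator ({s<..q n} \<times> UNIV) z *\<^sub>R ?G z)
        \<longlonglongrightarrow> indicator ({s<..r} \<times> UNIV) z *\<^sub>R ?G z"
    proof (cases "r \<in> {s<..t}")
      case True
      have "AE z in N. z \<notin> {r} \<times> UNIV"
        by (rule AE_not_in) (use no_atoms[OF True] sm in \<open>auto simp: null_sets_def\<close>)
      then show ?thesis by eventually_elim (rule conv, auto)
    next
      case False
      then have "r = s" using r by auto
      then have "?G z = 0 \<or> fst z \<noteq> r" for z by (auto simp: indicator_def)
      moreover have "(\<lambda>n. indicator ({s<..q n} \<times> UNIV) z *\<^sub>R ?G z)
        \<longlonglongrightarrow> indicator ({s<..r} \<times> UNIV) z *\<^sub>R ?G z" if "?G z = 0" for z
        unfolding that by simp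
      ultimately show ?thesis using conv by (intro AE_I2) blast
    qed
  qed
  then show "(\<lambda>n. set_lebesgue_integral N ({s<..q n} \<times> UNIV) g) \<longlonglongrightarrow> set_lebesgue_integral N ({s<..r} \<times> UNIV) g"
    using r q by (simp add: e)
qed

text \<open>On a short time interval the increment of \<open>G \<circ> x\<close> is, by the mean value theorem, the integral of
\<open>D v \<bullet> g\<close> for one point \<open>v\<close> near the path. Replacing \<open>D v\<close> by \<open>D (x s)\<close> costs at most \<open>e\<close> times the
integral of \<open>norm g\<close>, an error bound that adds up over adjacent intervals. The absence of atoms
enters through the continuity of \<open>x\<close>.\<close>

lemma chain_rule_set_integral:
  fixes x :: "real \<Rightarrow> 'a::euclidean_space" and g :: "real \<times> 'k::topological_space \<Rightarrow> 'a"
  assumes N: "sets N = sets (borel \<Otimes>\<^sub>M borel)" and "s \<le> t"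
    and g: "set_integrable N ({s<..t} \<times> UNIV) g"
    and no_atoms: "\<And>r. r \<in> {s<..t} \<Longrightarrow> emeasure N ({r} \<times> UNIV) = 0"
    and x: "\<And>r. r \<in> {s..t} \<Longrightarrow> x r = x s + set_lebesgue_integral N ({s<..r} \<times> UNIV) g"
    and G: "\<And>v. (G has_derivative (\<lambda>h. D v \<bullet> h)) (at v)" and D: "continuous_on UNIV D"
  shows "set_integrable N ({s<..t} \<times> UNIV) (\<lambda>z. D (x (fst z)) \<bullet> g z)"
    and "G (x t) - G (x s) = set_lebesgue_integral N ({s<..t} \<times> UNIV) (\<lambda>z. D (x (fst z)) \<bullet> g z)"
proof -
  let ?I = "\<lambda>a b h. set_lebesgue_integral N ({a<..b} \<times> UNIV) h"
  have m: "{a<..b::real} \<times> (UNIV :: 'k set) \<in> sets N" for a b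
    unfolding N by (intro pair_measureI) auto
  have cx: "continuous_on {s..t} x"
  proof (rule continuous_on_eq)
    show "continuous_on {s..t} (\<lambda>r. x s + set_lebesgue_integral N ({s<..r} \<times> UNIV) g)"
      by (intro continuous_intros continuous_set_integral_Ioc[OF N no_atoms g])
  qed (rule x[symmetric])
  have cDx: "continuous_on {s..t} (\<lambda>r. D (x r))"
    using continuous_on_compose2[OF D cx] by auto
  obtain B where B: "\<And>r. r \<in> {s..t} \<Longrightarrow> norm (D (x r)) \<le> B"
  proof -
    have "bounded ((\<lambda>r. D (x r)) ` {s..t})"
      by (intro compact_imp_bounded compact_continuous_image cDx) auto
    then obtain a where "\<forall>q\<in>(\<lambda>r. D (x r)) ` {s..t}. norm q \<le> a" unfolding bounded_iff by blast
    then show ?thesis by (intro that[of a]) blast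
  qed
  have gm: "(\<lambda>z. indicator ({s<..t} \<times> UNIV) z *\<^sub>R g z) \<in> borel_measurable N"
    using g unfolding set_integrable_def by auto
  have Dm: "(\<lambda>z. indicator {s..t} (fst z) *\<^sub>R D (x (fst z))) \<in> borel_measurable N"
  proof -
    have "(\<lambda>r. indicator {s..t} r *\<^sub>R D (x r)) \<in> borel_measurable borel"
      by (rule borel_measurable_continuous_on_indicator[OF _ cDx]) auto
    moreover have "fst \<in> N \<rightarrow>\<^sub>M borel" unfolding measurable_cong_sets[OF N refl] by simp
    ultimately show ?thesis by (rule measurable_compose_rev)
  qed
  show int: "set_integrable N ({s<..t} \<times> UNIV) (\<lambda>z. D (x (fst z)) \<bullet> g z)"
    unfolding set_integrable_def
  proof (rule Bochner_Integration.integrable_bound)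
    show "integrable N (\<lambda>z. B *\<^sub>R (indicator ({s<..t} \<times> UNIV) z *\<^sub>R g z))"
      using g unfolding set_integrable_def by (rule integrable_scaleR_right)
    have "(\<lambda>z. (indicator {s..t} (fst z) *\<^sub>R D (x (fst z))) \<bullet> (indicator ({s<..t} \<times> UNIV) z *\<^sub>R g z)) \<in> borel_measurable N"
      using Dm gm by measurable
    also have "(\<lambda>z. (indicator {s..t} (fst z) *\<^sub>R D (x (fst z))) \<bullet> (indicator ({s<..t} \<times> UNIV) z *\<^sub>R g z)) =
      (\<lambda>z. indicator ({s<..t} \<times> UNIV) z *\<^sub>R (D (x (fst z)) \<bullet> g z))"
      by (auto simp: indicator_def fun_eq_iff)
    finally show "(\<lambda>z. indicator ({s<..t} \<times> UNIV) z *\<^sub>R (D (x (fst z)) \<bullet> g z)) \<in> borel_measurable N" .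
    show "AE z in N. norm (indicator ({s<..t} \<times> UNIV) z *\<^sub>R (D (x (fst z)) \<bullet> g z))
        \<le> norm (B *\<^sub>R (indicator ({s<..t} \<times> UNIV) z *\<^sub>R g z))"
    proof (intro AE_I2)
      fix z
      show "norm (indicator ({s<..t} \<times> UNIV) z *\<^sub>R (D (x (fst z)) \<bullet> g z))
        \<le> norm (B *\<^sub>R (indicator ({s<..t} \<times> UNIV) z *\<^sub>R g z))"
      proof (cases "fst z \<in> {s<..t}")
        case True
        then have "\<bar>D (x (fst z)) \<bullet> g z\<bar> \<le> norm (D (x (fst z))) * norm (g z)"
          using Cauchy_Schwarz_ineq2 by blast
        also have "\<dots> \<le> \<bar>B\<bar> * norm (g z)"
          using B[of "fst z"] True by (intro mult_right_mono) auto
        finally show ?thesis by (auto simp: indicator_def)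
      next
        case False
        then show ?thesis by (auto simp: indicator_def)
      qed
    qed
  qed
  define h where "h z = D (x (fst z)) \<bullet> g z" for z
  have gn: "set_integrable N ({s<..t} \<times> UNIV) (\<lambda>z. norm (g z))"
    using g by (rule set_integrable_norm)
  have sub: "set_integrable N ({a<..b} \<times> UNIV) k"
    if "set_integrable N ({s<..t} \<times> UNIV) k" "s \<le> a" "b \<le> t" for a b and k :: "_ \<Rightarrow> 'b::euclidean_space"
    by (rule set_integrable_subset[OF that(1) m]) (use that in auto)
  have est: "\<bar>G (x t) - G (x s) - ?I s t h\<bar> \<le> e * ?I s t (\<lambda>z. norm (g z))" if e: "e > 0" for e
  proof -
    let ?P = "\<lambda>a b. s \<le> a \<and> a \<le> b \<and> b \<le> t \<longrightarrow> \<bar>G (x b) - G (x a) - ?I a b h\<bar> \<le> e * ?I a b (\<lambda>z. norm (g z))"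
    \<comment> \<open>Local estimates propagate to the whole interval because the error bound is additive.\<close>
    have "?P s t"
      using \<open>s \<le> t\<close>
    proof (rule Bolzano[where P = ?P])
      fix a b c assume P: "?P a b" "?P b c" "a \<le> b" "b \<le> c"
      show "?P a c"
      proof
        assume c: "s \<le> a \<and> a \<le> c \<and> c \<le> t"
        have 1: "?I a c h = ?I a b h + ?I b c h"
          by (rule set_integral_Ioc_split[OF N]) (use P c sub[OF int[folded h_def]] in auto)
        have 2: "?I a c (\<lambda>z. norm (g z)) = ?I a b (\<lambda>z. norm (g z)) + ?I b c (\<lambda>z. norm (g z))"
          by (rule set_integral_Ioc_split[OF N]) (use P c sub[OF gn] in auto)
        have "\<bar>G (x b) - G (x a) - ?I a b h\<bar> \<le> e * ?I a b (\<lambda>z. norm (g z))"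
          "\<bar>G (x c) - G (x b) - ?I b c h\<bar> \<le> e * ?I b c (\<lambda>z. norm (g z))"
          using P c by auto
        then show "\<bar>G (x c) - G (x a) - ?I a c h\<bar> \<le> e * ?I a c (\<lambda>z. norm (g z))"
          unfolding 1 2 distrib_left by linarith
      qed
    next
      fix r assume r: "s \<le> r" "r \<le> t"
      obtain d where d: "d > 0" "\<And>u. dist u (x r) < d \<Longrightarrow> dist (D u) (D (x r)) < e / 2"
        using D half_gt_zero[OF e] unfolding continuous_on_iff by blast
      obtain \<eta> where \<eta>: "\<eta> > 0" "\<And>q. q \<in> {s..t} \<Longrightarrow> dist q r < \<eta> \<Longrightarrow> dist (x q) (x r) < d"
      proof -
        have "r \<in> {s..t}" using r by auto
        then show ?thesis using cx d(1) that unfolding continuous_on_iff by blast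
      qed
      show "\<exists>d>0. \<forall>a b. a \<le> r \<and> r \<le> b \<and> b - a < d \<longrightarrow> ?P a b"
      proof (intro exI[of _ \<eta>] conjI allI impI \<eta>(1))
        fix a b assume ab: "a \<le> r \<and> r \<le> b \<and> b - a < \<eta>" and st: "s \<le> a \<and> a \<le> b \<and> b \<le> t"
        have near: "x q \<in> ball (x r) d" if "q \<in> {a..b}" for q
          using \<eta>(2)[of q] that ab st by (auto simp: dist_real_def dist_commute)
        \<comment> \<open>Balls are convex, so the intermediate point stays near the path.\<close>
        let ?seg = "\<lambda>\<theta>::real. x a + \<theta> *\<^sub>R (x b - x a)"
        have seg_deriv: "((\<lambda>\<theta>. G (?seg \<theta>)) has_derivative (\<lambda>h. D (?seg \<theta>) \<bullet> (h *\<^sub>R (x b - x a))))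
            (at \<theta> within {0..1})" for \<theta>
          by (rule has_derivative_compose[OF _ G]) (auto intro!: derivative_eq_intros)
        have "\<exists>\<theta>\<in>{0..1}. G (?seg 1) - G (?seg 0) = (\<lambda>\<theta>. \<lambda>h. D (?seg \<theta>) \<bullet> (h *\<^sub>R (x b - x a))) \<theta> (1 - 0)"
          by (rule mvt_very_simple) (simp, rule seg_deriv)
        then obtain \<theta> where \<theta>: "\<theta> \<in> {0..1}" "G (x b) - G (x a) = D (?seg \<theta>) \<bullet> (x b - x a)"
          by auto
        define p where "p = ?seg \<theta>"
        have "p = (1 - \<theta>) *\<^sub>R x a + \<theta> *\<^sub>R x b" by (simp add: p_def algebra_simps)
        then have p: "p \<in> ball (x r) d"
          using convexD[OF convex_ball near[of a] near[of b], of "1 - \<theta>" \<theta>] \<theta>(1) st by auto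
        have xab: "x b - x a = ?I a b g"
          using x[of a] x[of b] st set_integral_Ioc_split(3)[OF N, of s a b g] sub[OF g, of s b] by auto
        note ga = sub[OF g, of a b] and gna = sub[OF gn, of a b] and ha = sub[OF int[folded h_def], of a b]
        have Dg: "set_integrable N ({a<..b} \<times> UNIV) (\<lambda>z. D p \<bullet> g z)"
        proof -
          have "integrable N (\<lambda>z. D p \<bullet> (indicator ({a<..b} \<times> UNIV) z *\<^sub>R g z))"
            using ga st unfolding set_integrable_def by (intro integrable_inner_right) auto
          then show ?thesis unfolding set_integrable_def by simp
        qed
        have "D p \<bullet> (x b - x a) = ?I a b (\<lambda>z. D p \<bullet> g z)"
        proof -
          have "D p \<bullet> ?I a b g = (\<integral>z. D p \<bullet> (indicator ({a<..b} \<times> UNIV) z *\<^sub>R g z) \<partial>N)"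
            unfolding set_lebesgue_integral_def
            using ga st by (intro integral_inner_right[symmetric]) (auto simp: set_integrable_def)
          then show ?thesis unfolding xab set_lebesgue_integral_def by simp
        qed
        then have "G (x b) - G (x a) - ?I a b h = ?I a b (\<lambda>z. D p \<bullet> g z - h z)"
          using \<theta>(2) set_integral_diff(2)[OF Dg ha] st by (simp add: p_def)
        also have "\<bar>\<dots>\<bar> \<le> ?I a b (\<lambda>z. \<bar>D p \<bullet> g z - h z\<bar>)"
          using set_integral_diff(1)[OF Dg ha] st set_integral_norm_bound[of N "{a<..b} \<times> UNIV" "\<lambda>z. D p \<bullet> g z - h z"] by auto
        also have "\<dots> \<le> ?I a b (\<lambda>z. e * norm (g z))"
        proof (rule set_integral_mono)
          show "set_integrable N ({a<..b} \<times> UNIV) (\<lambda>z. \<bar>D p \<bullet> g z - h z\<bar>)"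
            using set_integral_diff(1)[OF Dg ha] st by (intro set_integrable_abs) auto
          show "set_integrable N ({a<..b} \<times> UNIV) (\<lambda>z. e * norm (g z))"
            using gna st by auto
          fix z :: "real \<times> 'k" assume "z \<in> {a<..b} \<times> UNIV"
          then have xz: "x (fst z) \<in> ball (x r) d" using near by auto
          have "dist (D p) (D (x r)) < e / 2" "dist (D (x (fst z))) (D (x r)) < e / 2"
            using d(2)[of p] d(2)[of "x (fst z)"] p xz by (auto simp: dist_commute)
          then have "dist (D p) (D (x (fst z))) < e" using dist_triangle_half_r[of "D (x r)"] by (metis dist_commute)
          then have n: "norm (D p - D (x (fst z))) \<le> e" by (simp add: dist_norm)
          have "\<bar>D p \<bullet> g z - h z\<bar> = \<bar>(D p - D (x (fst z))) \<bullet> g z\<bar>" by (simp add: h_def inner_diff_left)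
          also have "\<dots> \<le> norm (D p - D (x (fst z))) * norm (g z)" by (rule Cauchy_Schwarz_ineq2)
          also have "\<dots> \<le> e * norm (g z)" using n by (rule mult_right_mono) auto
          finally show "\<bar>D p \<bullet> g z - h z\<bar> \<le> e * norm (g z)" .
        qed
        finally show "\<bar>G (x b) - G (x a) - ?I a b h\<bar> \<le> e * ?I a b (\<lambda>z. norm (g z))" by simp
      qed
    qed
    then show ?thesis using \<open>s \<le> t\<close> by auto
  qed
  have "\<bar>G (x t) - G (x s) - ?I s t h\<bar> \<le> 0"
  proof (rule field_le_epsilon)
    fix e :: real assume e: "e > 0"
    define C where "C = ?I s t (\<lambda>z. norm (g z))"
    have C: "C \<ge> 0" unfolding C_def set_lebesgue_integral_def by (intro integral_nonneg_AE) auto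
    have "\<bar>G (x t) - G (x s) - ?I s t h\<bar> \<le> e / (C + 1) * C"
      using est[of "e / (C + 1)"] e C by (auto simp: C_def)
    also have "\<dots> \<le> e" using e C by (simp add: field_simps)
    finally show "\<bar>G (x t) - G (x s) - ?I s t h\<bar> \<le> 0 + e" by simp
  qed
  then show "G (x t) - G (x s) = ?I s t (\<lambda>z. D (x (fst z)) \<bullet> g z)" by (simp add: h_def[abs_def])
qed

text \<open>Here \<open>xl\<close> is the left-continuous version of the path that starts at \<open>x0\<close>, moves by the integral of \<open>g\<close>
and jumps by \<open>w j\<close> at time \<open>\<tau> j\<close>. Using \<open>xl\<close> in both the integral and the jump terms makes the induction
on the number of jumps exact: up to and including the last jump time, \<open>xl\<close> does not see the last jump.\<close>

lemma jump_chain_rule: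
  fixes g :: "real \<times> 'k::topological_space \<Rightarrow> 'a::euclidean_space" and w :: "nat \<Rightarrow> 'a" and x0 :: 'a
  assumes N: "sets N = sets (borel \<Otimes>\<^sub>M borel)"
    and no_atoms: "\<And>r. r \<in> {0<..T} \<Longrightarrow> emeasure N ({r} \<times> UNIV) = 0"
    and g: "set_integrable N ({0<..T} \<times> UNIV) g"
    and G: "\<And>v. (G has_derivative (\<lambda>h. D v \<bullet> h)) (at v)" and D: "continuous_on UNIV D"
    and J: "finite J" "strict_mono_on J \<tau>" "\<tau> ` J \<subseteq> {0<..T}" "0 \<le> T"
  defines "xl \<equiv> \<lambda>t. x0 + set_lebesgue_integral N ({0<..t} \<times> UNIV) g + (\<Sum>j\<in>{j\<in>J. \<tau> j < t}. w j)"
  defines "xT \<equiv> x0 + set_lebesgue_integral N ({0<..T} \<times> UNIV) g + (\<Sum>j\<in>J. w j)"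
  shows "set_integrable N ({0<..T} \<times> UNIV) (\<lambda>z. D (xl (fst z)) \<bullet> g z) \<and>
    G xT - G x0 = set_lebesgue_integral N ({0<..T} \<times> UNIV) (\<lambda>z. D (xl (fst z)) \<bullet> g z) +
      (\<Sum>j\<in>J. G (xl (\<tau> j) + w j) - G (xl (\<tau> j)))"
  using J(1) no_atoms g J(2-) unfolding xl_def xT_def
proof (induction J arbitrary: T rule: finite_linorder_max_induct)
  case empty
  let ?x = "\<lambda>t. x0 + set_lebesgue_integral N ({0<..t} \<times> UNIV) g"
  have x: "?x r = ?x 0 + set_lebesgue_integral N ({0<..r} \<times> UNIV) g" for r
    by (simp add: set_lebesgue_integral_def)
  have "?x 0 = x0" by (simp add: set_lebesgue_integral_def)
  then show ?case
    using chain_rule_set_integral[where x = ?x, OF N \<open>0 \<le> T\<close> empty(2) empty(1) x G D] by auto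
next
  case (insert b J)
  let ?I = "\<lambda>a b h. set_lebesgue_integral N ({a<..b} \<times> UNIV) h"
  let ?l = "\<lambda>J t. x0 + ?I 0 t g + (\<Sum>j\<in>{j\<in>J. \<tau> j < t}. w j)"
  have b: "\<tau> b \<in> {0<..T}" using insert.prems by auto
  have lt: "\<tau> j < \<tau> b" if "j \<in> J" for j
    using insert.prems(3) insert.hyps(2) that by (auto simp: strict_mono_on_def)
  have bJ: "b \<notin> J" using insert.hyps(2) by auto
  have gb: "set_integrable N ({0<..\<tau> b} \<times> UNIV) g" "set_integrable N ({\<tau> b<..T} \<times> UNIV) g"
    using set_integral_Ioc_split(1,2)[OF N _ _ insert.prems(2), of "\<tau> b"] b by auto
  define xJ where "xJ t = x0 + ?I 0 t g + (\<Sum>j\<in>{j\<in>J. \<tau> j < t}. w j)" for t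
  define xl where "xl t = x0 + ?I 0 t g + (\<Sum>j\<in>{j\<in>insert b J. \<tau> j < t}. w j)" for t
  \<comment> \<open>The path after the last jump; it has no jumps, so the continuous chain rule applies to it.\<close>
  define x where "x t = xJ (\<tau> b) + w b + ?I (\<tau> b) t g" for t
  have IH: "set_integrable N ({0<..\<tau> b} \<times> UNIV) (\<lambda>z. D (xJ (fst z)) \<bullet> g z) \<and>
    G (x0 + ?I 0 (\<tau> b) g + (\<Sum>j\<in>J. w j)) - G x0 = ?I 0 (\<tau> b) (\<lambda>z. D (xJ (fst z)) \<bullet> g z) +
      (\<Sum>j\<in>J. G (xJ (\<tau> j) + w j) - G (xJ (\<tau> j)))"
    unfolding xJ_def
  proof (rule insert.IH)
    show "emeasure N ({r} \<times> UNIV) = 0" if "r \<in> {0<..\<tau> b}" for r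
      using insert.prems(1)[of r] that b by auto
    show "strict_mono_on J \<tau>" using insert.prems(3) by (auto simp: strict_mono_on_def)
    show "\<tau> ` J \<subseteq> {0<..\<tau> b}" using insert.prems(4) lt by fastforce
  qed (use gb b in auto)
  have early: "xl t = xJ t" if "t \<le> \<tau> b" for t
  proof -
    have "{j \<in> insert b J. \<tau> j < t} = {j \<in> J. \<tau> j < t}" using that by auto
    then show ?thesis by (simp only: xl_def xJ_def)
  qed
  have Jb: "{j \<in> J. \<tau> j < \<tau> b} = J" using lt by auto
  have xJb: "xJ (\<tau> b) = x0 + ?I 0 (\<tau> b) g + (\<Sum>j\<in>J. w j)"
    unfolding xJ_def Jb by simp
  have xb: "x (\<tau> b) = xJ (\<tau> b) + w b" by (simp add: x_def set_lebesgue_integral_def)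
  have x: "x r = x (\<tau> b) + ?I (\<tau> b) r g" for r
    unfolding xb by (simp add: x_def)
  have na: "emeasure N ({r} \<times> UNIV) = 0" if "r \<in> {\<tau> b<..T}" for r
    using insert.prems(1)[of r] that b by auto
  have bT: "\<tau> b \<le> T" using b by auto
  note cr = chain_rule_set_integral[where x = x, OF N bT gb(2) na x G D]
  have late: "x0 + ?I 0 t g + (\<Sum>j\<in>insert b J. w j) = x t" if "\<tau> b \<le> t" "t \<le> T" for t
  proof -
    have "set_integrable N ({0<..t} \<times> UNIV) g"
      using set_integral_Ioc_split(1)[OF N _ _ insert.prems(2), of t] b that by auto
    then have "?I 0 t g = ?I 0 (\<tau> b) g + ?I (\<tau> b) t g"
      using set_integral_Ioc_split(3)[OF N, of 0 "\<tau> b" t g] b that by auto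
    then show ?thesis unfolding x_def xJb
      using insert.hyps(1) bJ by (simp add: add_ac)
  qed
  have xeq: "xl t = x t" if "\<tau> b < t" "t \<le> T" for t
  proof -
    have "{j \<in> insert b J. \<tau> j < t} = insert b J" using that lt by force
    then show ?thesis using late[of t] that by (simp only: xl_def less_imp_le)
  qed
  have i1: "set_integrable N ({0<..\<tau> b} \<times> UNIV) (\<lambda>z. D (xl (fst z)) \<bullet> g z)"
    using IH[THEN conjunct1] by (subst set_integrable_cong[OF refl refl]) (auto simp: early)
  have i2: "set_integrable N ({\<tau> b<..T} \<times> UNIV) (\<lambda>z. D (xl (fst z)) \<bullet> g z)"
    using cr(1) by (subst set_integrable_cong[OF refl refl]) (auto simp: xeq)
  have e1: "?I 0 (\<tau> b) (\<lambda>z. D (xl (fst z)) \<bullet> g z) = ?I 0 (\<tau> b) (\<lambda>z. D (xJ (fst z)) \<bullet> g z)"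
    unfolding set_lebesgue_integral_def
    by (intro Bochner_Integration.integral_cong refl) (auto simp: indicator_def early)
  have e2: "?I (\<tau> b) T (\<lambda>z. D (xl (fst z)) \<bullet> g z) = ?I (\<tau> b) T (\<lambda>z. D (x (fst z)) \<bullet> g z)"
    unfolding set_lebesgue_integral_def
    by (intro Bochner_Integration.integral_cong refl) (auto simp: indicator_def xeq)
  have union: "{0<..T} \<times> (UNIV :: 'k set) = {0<..\<tau> b} \<times> UNIV \<union> {\<tau> b<..T} \<times> UNIV"
    using b by auto
  have m: "{a<..b::real} \<times> (UNIV :: 'k set) \<in> sets N" for a b
    unfolding N by (intro pair_measureI) auto
  have i: "set_integrable N ({0<..T} \<times> UNIV) (\<lambda>z. D (xl (fst z)) \<bullet> g z)"
    unfolding union by (rule set_integrable_Un[OF i1 i2 m m])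
  have e: "?I 0 T (\<lambda>z. D (xl (fst z)) \<bullet> g z) =
    ?I 0 (\<tau> b) (\<lambda>z. D (xJ (fst z)) \<bullet> g z) + ?I (\<tau> b) T (\<lambda>z. D (x (fst z)) \<bullet> g z)"
    using set_integral_Ioc_split(3)[OF N _ _ i, of "\<tau> b"] b unfolding e1 e2 by auto
  have s: "(\<Sum>j\<in>insert b J. G (xl (\<tau> j) + w j) - G (xl (\<tau> j))) =
    (\<Sum>j\<in>J. G (xJ (\<tau> j) + w j) - G (xJ (\<tau> j))) + (G (xJ (\<tau> b) + w b) - G (xJ (\<tau> b)))"
  proof -
    have "(\<Sum>j\<in>J. G (xl (\<tau> j) + w j) - G (xl (\<tau> j))) = (\<Sum>j\<in>J. G (xJ (\<tau> j) + w j) - G (xJ (\<tau> j)))"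
      by (rule sum.cong[OF refl]) (auto simp: early lt less_imp_le)
    then show ?thesis using insert.hyps(1) bJ by (simp add: early)
  qed
  have "G (x T) - G x0 = (G (x T) - G (x (\<tau> b))) + (G (xJ (\<tau> b) + w b) - G (xJ (\<tau> b))) + (G (xJ (\<tau> b)) - G x0)"
    unfolding xb by simp
  also have "\<dots> = ?I 0 T (\<lambda>z. D (xl (fst z)) \<bullet> g z) + (\<Sum>j\<in>insert b J. G (xl (\<tau> j) + w j) - G (xl (\<tau> j)))"
    unfolding s e using cr(2) IH[THEN conjunct2] unfolding xJb[symmetric] by simp
  finally have "G (x0 + ?I 0 T g + (\<Sum>j\<in>insert b J. w j)) - G x0 = \<dots>"
    using late[of T] bT by simp
  with i show ?case unfolding xl_def by blast
qed

lemma has_real_derivative_abs_powr: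
  fixes x p :: real assumes p: "p > 1"
  shows "((\<lambda>x. \<bar>x\<bar> powr p) has_real_derivative p * \<bar>x\<bar> powr (p - 1) * sgn x) (at x)"
proof (cases "x = 0")
  case False
  then show ?thesis
  proof -
    have "(abs has_real_derivative sgn x) (at x)"
      unfolding has_field_derivative_def using has_derivative_norm[OF False]
      by (simp add: real_norm_def[abs_def] mult.commute[of _ "sgn x"])
    from DERIV_powr[OF this _ DERIV_const[of p]] False show ?thesis
      by (simp add: powr_diff field_simps)
  qed
next
  case True
  have "((\<lambda>h. \<bar>h\<bar> powr p / h) \<longlongrightarrow> 0) (at 0)"
  proof (rule tendsto_rabs_zero_cancel)
    have "((\<lambda>h::real. \<bar>h\<bar> powr (p - 1)) \<longlongrightarrow> 0) (at 0)"
      using p by (intro tendsto_zero_powrI[where b="p-1"] tendsto_rabs_zero tendsto_ident_at tendsto_const) auto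
    moreover have "\<bar>h\<bar> powr (p - 1) = \<bar>\<bar>h\<bar> powr p / h\<bar>" for h :: real
      by (cases "h = 0") (auto simp: powr_diff)
    ultimately show "((\<lambda>h. \<bar>\<bar>h\<bar> powr p / h\<bar>) \<longlongrightarrow> 0) (at 0)" by simp
  qed
  then show ?thesis using True p by (simp add: DERIV_def)
qed

lemma continuous_abs_powr_sgn:
  fixes q :: real assumes q: "q > 0"
  shows "continuous_on UNIV (\<lambda>x. \<bar>x\<bar> powr q * sgn x)"
proof -
  have "isCont (\<lambda>x. \<bar>x\<bar> powr q * sgn x) a" for a :: real
  proof (cases "a = 0")
    case True
    have "((\<lambda>x. \<bar>x\<bar> powr q * sgn x) \<longlongrightarrow> 0) (at 0)"
    proof (rule tendsto_rabs_zero_cancel)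
      have "((\<lambda>h::real. \<bar>h\<bar> powr q) \<longlongrightarrow> 0) (at 0)"
        using q by (intro tendsto_zero_powrI[where b=q] tendsto_rabs_zero tendsto_ident_at tendsto_const) auto
      moreover have "\<bar>h\<bar> powr q = \<bar>\<bar>h\<bar> powr q * sgn h\<bar>" for h :: real
        by (cases "h = 0") (auto simp: abs_mult)
      ultimately show "((\<lambda>h. \<bar>\<bar>h\<bar> powr q * sgn h\<bar>) \<longlongrightarrow> 0) (at 0)" by simp
    qed
    then show ?thesis using True by (simp add: isCont_def)
  next
    case False
    then show ?thesis by (auto intro!: continuous_intros)
  qed
  then show ?thesis by (simp add: continuous_on_eq_continuous_at)
qed

text \<open>The chain rule for \<open>G (y, a) = \<bar>y\<bar>\<^sup>p exp (\<beta> a)\<close> along the pair of paths \<open>(v, a)\<close>; the second component is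
itself the integral of \<open>1\<close>. The estimate is stated with nonnegative integrals so that expectations can be
taken without integrability questions.\<close>

lemma lp_energy_inequality:
  fixes g :: "real \<times> 'k::topological_space \<Rightarrow> real" and w :: "nat \<Rightarrow> real" and y0 \<beta> p :: real
  assumes N: "sets N = sets (borel \<Otimes>\<^sub>M borel)"
    and no_atoms: "\<And>r. r \<in> {0<..T} \<Longrightarrow> emeasure N ({r} \<times> UNIV) = 0"
    and a: "\<And>t. t \<in> {0..T} \<Longrightarrow> emeasure N ({0<..t} \<times> UNIV) = ennreal (a t - a 0)"
      "\<And>t. t \<in> {0..T} \<Longrightarrow> a 0 \<le> a t"
    and g: "set_integrable N ({0<..T} \<times> UNIV) g"
    and J: "finite J" "strict_mono_on J \<tau>" "\<tau> ` J \<subseteq> {0<..T}" "0 \<le> T"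
    and p: "p > 1" and \<beta>: "\<beta> \<ge> 0"
    and v: "\<And>t. t \<in> {0<..T} \<Longrightarrow>
      v t = y0 - set_lebesgue_integral N ({0<..t} \<times> UNIV) g + (\<Sum>j\<in>{j\<in>J. \<tau> j < t}. w j)"
    and yT: "yT = y0 - set_lebesgue_integral N ({0<..T} \<times> UNIV) g + (\<Sum>j\<in>J. w j)"
  shows "ennreal \<beta> * (\<integral>\<^sup>+z\<in>{0<..T} \<times> UNIV. ennreal (\<bar>v (fst z)\<bar> powr p * exp (\<beta> * a (fst z))) \<partial>N) +
      (\<Sum>j\<in>J. ennreal (\<bar>v (\<tau> j) + w j\<bar> powr p * exp (\<beta> * a (\<tau> j))))
    \<le> ennreal (\<bar>yT\<bar> powr p * exp (\<beta> * a T)) +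
      (\<Sum>j\<in>J. ennreal (\<bar>v (\<tau> j)\<bar> powr p * exp (\<beta> * a (\<tau> j)))) +
      (\<integral>\<^sup>+z\<in>{0<..T} \<times> UNIV.
        ennreal (p * \<bar>v (fst z)\<bar> powr (p - 1) * \<bar>g z\<bar> * exp (\<beta> * a (fst z))) \<partial>N)"
proof -
  let ?A = "{0<..T} \<times> (UNIV :: 'k set)"
  let ?I = "\<lambda>t h. set_lebesgue_integral N ({0<..t} \<times> UNIV) h"
  define G :: "real \<times> real \<Rightarrow> real" where "G u = \<bar>fst u\<bar> powr p * exp (\<beta> * snd u)" for u
  define D :: "real \<times> real \<Rightarrow> real \<times> real" where
    "D u = (p * \<bar>fst u\<bar> powr (p - 1) * sgn (fst u) * exp (\<beta> * snd u), \<beta> * (\<bar>fst u\<bar> powr p * exp (\<beta> * snd u)))" for u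
  define h :: "real \<times> 'k \<Rightarrow> real \<times> real" where "h z = (- g z, 1)" for z
  have m: "{0<..b::real} \<times> (UNIV :: 'k set) \<in> sets N" for b
    unfolding N by (intro pair_measureI) auto
  have one: "set_integrable N ({0<..t} \<times> UNIV) (\<lambda>_. 1::real)" if "t \<in> {0..T}" for t
    using a(1)[OF that] m[of t] unfolding set_integrable_def by simp
  have one_int: "?I t (\<lambda>_. 1::real) = a t - a 0" if "t \<in> {0..T}" for t
    using a[OF that] m[of t] unfolding set_lebesgue_integral_def by (simp add: measure_def)
  have h_int: "set_integrable N ({0<..t} \<times> UNIV) h" and h_eq: "?I t h = (- ?I t g, a t - a 0)"
    if t: "t \<in> {0..T}" for t
  proof -
    have gt: "set_integrable N ({0<..t} \<times> UNIV) g"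
      by (rule set_integrable_subset[OF g m]) (use t in auto)
    have hh: "(\<lambda>z. indicator ({0<..t} \<times> UNIV) z *\<^sub>R h z) =
      (\<lambda>z. (indicator ({0<..t} \<times> UNIV) z *\<^sub>R g z) *\<^sub>R (-1, 0) + (indicator ({0<..t} \<times> UNIV) z *\<^sub>R (1::real)) *\<^sub>R (0, 1))"
      by (auto simp: h_def fun_eq_iff)
    note i = gt[unfolded set_integrable_def] one[OF t, unfolded set_integrable_def]
    show "set_integrable N ({0<..t} \<times> UNIV) h"
      unfolding set_integrable_def hh
      by (intro Bochner_Integration.integrable_add integrable_scaleR_left i)
    have "?I t h = ?I t g *\<^sub>R (-1, 0) + ?I t (\<lambda>_. 1::real) *\<^sub>R (0, 1)"
      unfolding set_lebesgue_integral_def hh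
    proof (subst Bochner_Integration.integral_add)
      show "integrable N (\<lambda>z. (indicator ({0<..t} \<times> UNIV) z *\<^sub>R g z) *\<^sub>R (-1, 0::real))"
        "integrable N (\<lambda>z. (indicator ({0<..t} \<times> UNIV) z *\<^sub>R (1::real)) *\<^sub>R (0::real, 1))"
        by (rule integrable_scaleR_left, rule i)+
      show "(LINT z|N. (indicator ({0<..t} \<times> UNIV) z *\<^sub>R g z) *\<^sub>R (-1, 0::real)) +
          (LINT z|N. (indicator ({0<..t} \<times> UNIV) z *\<^sub>R (1::real)) *\<^sub>R (0::real, 1)) =
        (LINT z|N. indicator ({0<..t} \<times> UNIV) z *\<^sub>R g z) *\<^sub>R (-1, 0) +
          (LINT z|N. indicator ({0<..t} \<times> UNIV) z *\<^sub>R (1::real)) *\<^sub>R (0, 1)"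
        using i by (simp only: integral_scaleR_left)
    qed
    then show "?I t h = (- ?I t g, a t - a 0)" using one_int[OF t] by simp
  qed
  have Gd: "(G has_derivative (\<lambda>k. D u \<bullet> k)) (at u)" for u
  proof -
    have 1: "((\<lambda>u::real\<times>real. \<bar>fst u\<bar> powr p) has_derivative
        (\<lambda>k. fst k * (p * \<bar>fst u\<bar> powr (p - 1) * sgn (fst u)))) (at u)"
      using has_derivative_compose[OF has_derivative_fst[OF has_derivative_ident[of "at u"]]
        has_real_derivative_abs_powr[OF p, of "fst u", unfolded has_field_derivative_def]]
      by (simp add: mult.commute)
    have 2: "((\<lambda>u::real\<times>real. exp (\<beta> * snd u)) has_derivative (\<lambda>k. exp (\<beta> * snd u) * (\<beta> * snd k))) (at u)"
      by (auto intro!: derivative_eq_intros)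
    show ?thesis unfolding G_def D_def
      by (rule has_derivative_eq_rhs[OF has_derivative_mult[OF 1 2]]) (auto simp: fun_eq_iff algebra_simps inner_prod_def)
  qed
  have Dc: "continuous_on UNIV D"
  proof -
    have "continuous_on UNIV (\<lambda>u::real\<times>real. \<bar>fst u\<bar> powr (p - 1) * sgn (fst u))"
      using continuous_on_compose2[OF continuous_abs_powr_sgn[of "p - 1"] continuous_on_fst[OF continuous_on_id]] p by auto
    moreover have e: "continuous_on UNIV (\<lambda>u::real\<times>real. exp (\<beta> * snd u))"
      by (intro continuous_intros)
    ultimately have "continuous_on UNIV (\<lambda>u::real\<times>real. p * (\<bar>fst u\<bar> powr (p - 1) * sgn (fst u)) * exp (\<beta> * snd u))"
      by (intro continuous_on_mult[OF continuous_on_mult[OF continuous_on_const] e])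
    moreover have "continuous_on UNIV (\<lambda>u::real\<times>real. \<bar>fst u\<bar> powr p)"
      using p by (intro continuous_on_powr' continuous_intros) auto
    then have "continuous_on UNIV (\<lambda>u::real\<times>real. \<beta> * (\<bar>fst u\<bar> powr p * exp (\<beta> * snd u)))"
      by (intro continuous_on_mult[OF continuous_on_const continuous_on_mult] e)
    ultimately show ?thesis unfolding D_def mult.assoc by (intro continuous_on_Pair) (simp_all add: mult.assoc)
  qed
  have T: "T \<in> {0..T}" using J(4) by simp
  define xl where "xl t = (y0, a 0) + ?I t h + (\<Sum>j\<in>{j\<in>J. \<tau> j < t}. (w j, 0))" for t
  have sp: "(\<Sum>j\<in>J'. (w j, 0::real)) = (\<Sum>j\<in>J'. w j, 0)" for J'
    by (induction J' rule: infinite_finite_induct) (auto simp: zero_prod_def)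
  have xl: "xl t = (v t, a t)" if "t \<in> {0<..T}" for t
    using h_eq[of t] v[OF that] that by (simp add: xl_def sp)
  have xT: "(y0, a 0) + ?I T h + (\<Sum>j\<in>J. (w j, 0)) = (yT, a T)"
    using h_eq[OF T] yT by (simp add: sp)
  have core: "set_integrable N ?A (\<lambda>z. D (xl (fst z)) \<bullet> h z)"
    "G (yT, a T) - G (y0, a 0) = ?I T (\<lambda>z. D (xl (fst z)) \<bullet> h z) +
      (\<Sum>j\<in>J. G (xl (\<tau> j) + (w j, 0)) - G (xl (\<tau> j)))"
    using jump_chain_rule[OF N no_atoms h_int[OF T] Gd Dc J, of "(y0, a 0)" "\<lambda>j. (w j, 0)"]
    unfolding xl_def[symmetric] xT by auto
  define b where "b z = \<bar>v (fst z)\<bar> powr p * exp (\<beta> * a (fst z))" for z :: "real \<times> 'k"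
  define q where "q z = p * \<bar>v (fst z)\<bar> powr (p - 1) * \<bar>g z\<bar> * exp (\<beta> * a (fst z))" for z
  define k where "k z = D (xl (fst z)) \<bullet> h z" for z
  have b0: "b z \<ge> 0" and q0: "q z \<ge> 0" for z unfolding b_def q_def using p by auto
  have le: "\<beta> * b z \<le> k z + q z" if "z \<in> ?A" for z
  proof -
    have "xl (fst z) = (v (fst z), a (fst z))" using xl that by auto
    then have "k z = - (p * \<bar>v (fst z)\<bar> powr (p - 1) * exp (\<beta> * a (fst z))) * (sgn (v (fst z)) * g z) + \<beta> * b z"
      by (simp add: k_def D_def h_def b_def inner_prod_def algebra_simps)
    moreover have "sgn (v (fst z)) * g z \<le> \<bar>g z\<bar>" by (auto simp: sgn_if)
    then have "(p * \<bar>v (fst z)\<bar> powr (p - 1) * exp (\<beta> * a (fst z))) * (sgn (v (fst z)) * g z) \<le> q z"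
      unfolding q_def using p mult_left_mono[of "sgn (v (fst z)) * g z" "\<bar>g z\<bar>" "p * \<bar>v (fst z)\<bar> powr (p - 1) * exp (\<beta> * a (fst z))"]
      by (auto simp: mult_ac)
    ultimately show ?thesis by simp
  qed
  have jumps: "G (xl (\<tau> j) + (w j, 0)) = \<bar>v (\<tau> j) + w j\<bar> powr p * exp (\<beta> * a (\<tau> j))"
    "G (xl (\<tau> j)) = \<bar>v (\<tau> j)\<bar> powr p * exp (\<beta> * a (\<tau> j))" if "j \<in> J" for j
    using xl[of "\<tau> j"] J(3) that by (auto simp: G_def)
  define s1 where "s1 = (\<Sum>j\<in>J. \<bar>v (\<tau> j) + w j\<bar> powr p * exp (\<beta> * a (\<tau> j)))"
  define s2 where "s2 = (\<Sum>j\<in>J. \<bar>v (\<tau> j)\<bar> powr p * exp (\<beta> * a (\<tau> j)))"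
  have balance: "?I T k + s1 \<le> \<bar>yT\<bar> powr p * exp (\<beta> * a T) + s2"
  proof -
    \<comment> \<open>Dropping the value at time 0 turns the identity into an inequality.\<close>
    have "G (y0, a 0) \<ge> 0" by (simp add: G_def)
    moreover have "(\<Sum>j\<in>J. G (xl (\<tau> j) + (w j, 0)) - G (xl (\<tau> j))) = s1 - s2"
      using jumps by (simp add: s1_def s2_def sum_subtractf)
    moreover have "G (yT, a T) = \<bar>yT\<bar> powr p * exp (\<beta> * a T)" by (simp add: G_def)
    ultimately show ?thesis using core(2) unfolding k_def[abs_def, symmetric] by simp
  qed
  have vm: "(\<lambda>z. indicator ?A z * v (fst z)) \<in> borel_measurable N"
  proof -
    have "continuous_on {0..T} (\<lambda>r. ?I r g)"
      by (rule continuous_set_integral_Ioc[OF N no_atoms g])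
    from borel_measurable_continuous_on_indicator[OF _ this]
    have "(\<lambda>t. indicator {0<..T} t * (y0 - indicator {0..T} t *\<^sub>R ?I t g + (\<Sum>j\<in>J. indicator {\<tau> j<..} t * w j))) \<in> borel_measurable borel"
      by measurable
    also have "(\<lambda>t. indicator {0<..T} t * (y0 - indicator {0..T} t *\<^sub>R ?I t g + (\<Sum>j\<in>J. indicator {\<tau> j<..} t * w j)))
      = (\<lambda>t. indicator {0<..T} t * v t)"
    proof
      fix t
      have "(\<Sum>j\<in>J. indicator {\<tau> j<..} t * w j) = (\<Sum>j\<in>{j\<in>J. \<tau> j < t}. w j)"
        by (subst sum.inter_filter[OF J(1)]) (auto intro!: sum.cong simp: indicator_def)
      then show "indicator {0<..T} t * (y0 - indicator {0..T} t *\<^sub>R ?I t g + (\<Sum>j\<in>J. indicator {\<tau> j<..} t * w j)) = indicator {0<..T} t * v t"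
        using v[of t] by (auto simp: indicator_def)
    qed
    finally have "(\<lambda>t. indicator {0<..T} t * v t) \<in> borel_measurable borel" .
    moreover have "fst \<in> N \<rightarrow>\<^sub>M borel" unfolding measurable_cong_sets[OF N refl] by simp
    ultimately have "(\<lambda>z. indicator {0<..T} (fst z) * v (fst z)) \<in> borel_measurable N" by (rule measurable_compose_rev)
    also have "(\<lambda>z. indicator {0<..T} (fst z) * v (fst z)) = (\<lambda>z. indicator ?A z * v (fst z))"
      by (auto simp: indicator_def fun_eq_iff)
    finally show ?thesis .
  qed
  have am: "(\<lambda>z. indicator ?A z * a (fst z)) \<in> borel_measurable N"
  proof -
    have "continuous_on {0..T} (\<lambda>r. ?I r (\<lambda>_. 1::real))"
      by (rule continuous_set_integral_Ioc[OF N no_atoms one[OF T]])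
    from borel_measurable_continuous_on_indicator[OF _ this]
    have "(\<lambda>t. indicator {0<..T} t * (indicator {0..T} t *\<^sub>R ?I t (\<lambda>_. 1) + a 0)) \<in> borel_measurable borel"
      by measurable
    moreover have "fst \<in> N \<rightarrow>\<^sub>M borel" unfolding measurable_cong_sets[OF N refl] by simp
    ultimately have "(\<lambda>z. indicator {0<..T} (fst z) * (indicator {0..T} (fst z) *\<^sub>R ?I (fst z) (\<lambda>_. 1) + a 0)) \<in> borel_measurable N"
      by (rule measurable_compose_rev)
    also have "(\<lambda>z. indicator {0<..T} (fst z) * (indicator {0..T} (fst z) *\<^sub>R ?I (fst z) (\<lambda>_. 1) + a 0)) = (\<lambda>z. indicator ?A z * a (fst z))"
      using one_int by (auto simp: indicator_def fun_eq_iff)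
    finally show ?thesis .
  qed
  have gm: "(\<lambda>z. indicator ?A z * g z) \<in> borel_measurable N"
    using g unfolding set_integrable_def by auto
  have qm: "(\<lambda>z. indicator ?A z * q z) \<in> borel_measurable N"
  proof -
    have "(\<lambda>z. indicator ?A z * (p * \<bar>indicator ?A z * v (fst z)\<bar> powr (p - 1) * \<bar>indicator ?A z * g z\<bar> *
       exp (\<beta> * (indicator ?A z * a (fst z))))) \<in> borel_measurable N"
      using vm am gm m[of T] by measurable
    also have "(\<lambda>z. indicator ?A z * (p * \<bar>indicator ?A z * v (fst z)\<bar> powr (p - 1) * \<bar>indicator ?A z * g z\<bar> *
       exp (\<beta> * (indicator ?A z * a (fst z))))) = (\<lambda>z. indicator ?A z * q z)"
      by (auto simp: q_def indicator_def fun_eq_iff)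
    finally show ?thesis .
  qed
  have main: "ennreal \<beta> * (\<integral>\<^sup>+z\<in>?A. ennreal (b z) \<partial>N) + ennreal s1
    \<le> ennreal (\<bar>yT\<bar> powr p * exp (\<beta> * a T)) + ennreal s2 + (\<integral>\<^sup>+z\<in>?A. ennreal (q z) \<partial>N)"
  proof (cases "(\<integral>\<^sup>+z\<in>?A. ennreal (q z) \<partial>N) = \<infinity>")
    case False
    have qi: "set_integrable N ?A q"
      unfolding set_integrable_def
    proof (rule integrableI_bounded)
      show "(\<lambda>z. indicator ?A z *\<^sub>R q z) \<in> borel_measurable N" using qm by simp
      have "(\<integral>\<^sup>+ z. ennreal (norm (indicator ?A z *\<^sub>R q z)) \<partial>N) = (\<integral>\<^sup>+z\<in>?A. ennreal (q z) \<partial>N)"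
        using q0 by (intro nn_integral_cong) (auto simp: indicator_def)
      then show "(\<integral>\<^sup>+ z. ennreal (norm (indicator ?A z *\<^sub>R q z)) \<partial>N) < \<infinity>" using False by (simp add: less_top)
    qed
    have qe: "(\<integral>\<^sup>+z\<in>?A. ennreal (q z) \<partial>N) = ennreal (?I T q)"
    proof -
      have "(\<integral>\<^sup>+z\<in>?A. ennreal (q z) \<partial>N) = (\<integral>\<^sup>+z. ennreal (indicator ?A z *\<^sub>R q z) \<partial>N)"
        by (intro nn_integral_cong) (auto simp: indicator_def)
      also have "\<dots> = ennreal (?I T q)" unfolding set_lebesgue_integral_def
        using qi q0 unfolding set_integrable_def by (intro nn_integral_eq_integral) auto
      finally show ?thesis .
    qed
    have kq: "set_integrable N ?A (\<lambda>z. k z + q z)" "?I T (\<lambda>z. k z + q z) = ?I T k + ?I T q"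
      using set_integral_add[OF core(1)[folded k_def] qi] by auto
    have kq0: "k z + q z \<ge> 0" if "z \<in> ?A" for z
      using le[OF that] b0[of z] \<beta> by (smt (verit) mult_nonneg_nonneg)
    have "ennreal \<beta> * (\<integral>\<^sup>+z\<in>?A. ennreal (b z) \<partial>N) \<le> (\<integral>\<^sup>+z. ennreal (indicator ?A z *\<^sub>R (k z + q z)) \<partial>N)"
    proof (cases "\<beta> = 0")
      case False
      then have "ennreal \<beta> * (\<integral>\<^sup>+z\<in>?A. ennreal (b z) \<partial>N) = (\<integral>\<^sup>+z. ennreal \<beta> * (ennreal (b z) * indicator ?A z) \<partial>N)"
      proof (subst nn_integral_cmult)
        have "(\<lambda>z. indicator ?A z * (\<bar>indicator ?A z * v (fst z)\<bar> powr p * exp (\<beta> * (indicator ?A z * a (fst z))))) \<in> borel_measurable N"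
          using vm am m[of T] by measurable
        then have "(\<lambda>z. ennreal (indicator ?A z * (\<bar>indicator ?A z * v (fst z)\<bar> powr p * exp (\<beta> * (indicator ?A z * a (fst z)))))) \<in> borel_measurable N"
          by measurable
        also have "(\<lambda>z. ennreal (indicator ?A z * (\<bar>indicator ?A z * v (fst z)\<bar> powr p * exp (\<beta> * (indicator ?A z * a (fst z)))))) = (\<lambda>z. ennreal (b z) * indicator ?A z)"
          by (auto simp: b_def indicator_def fun_eq_iff)
        finally show "(\<lambda>z. ennreal (b z) * indicator ?A z) \<in> borel_measurable N" .
      qed simp
      also have "\<dots> \<le> (\<integral>\<^sup>+z. ennreal (indicator ?A z *\<^sub>R (k z + q z)) \<partial>N)"
        using le b0 \<beta> by (intro nn_integral_mono) (auto simp: indicator_def ennreal_mult[symmetric] intro!: ennreal_leI)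
      finally show ?thesis .
    qed simp
    also have "\<dots> = ennreal (?I T k + ?I T q)"
      unfolding kq(2)[symmetric] using kq0 kq(1) unfolding set_lebesgue_integral_def set_integrable_def
      by (intro nn_integral_eq_integral) (auto simp: indicator_def)
    finally have "ennreal \<beta> * (\<integral>\<^sup>+z\<in>?A. ennreal (b z) \<partial>N) + ennreal s1 \<le> ennreal (?I T k + ?I T q) + ennreal s1"
      by (rule add_right_mono)
    also have "\<dots> = ennreal (?I T k + ?I T q + s1)"
    proof (rule ennreal_plus[symmetric])
      have "0 \<le> ?I T (\<lambda>z. k z + q z)" unfolding set_lebesgue_integral_def using kq0
        by (intro integral_nonneg_AE AE_I2) (auto simp: indicator_def)
      then show "0 \<le> ?I T k + ?I T q" unfolding kq(2) .
      show "0 \<le> s1" unfolding s1_def by (intro sum_nonneg) auto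
    qed
    also have "\<dots> \<le> ennreal (\<bar>yT\<bar> powr p * exp (\<beta> * a T) + s2 + ?I T q)"
      using balance by (intro ennreal_leI) simp
    also have "\<dots> = ennreal (\<bar>yT\<bar> powr p * exp (\<beta> * a T)) + ennreal s2 + ennreal (?I T q)"
    proof -
      have "0 \<le> s2" unfolding s2_def by (intro sum_nonneg) auto
      moreover have "0 \<le> ?I T q" unfolding set_lebesgue_integral_def using q0
        by (intro integral_nonneg_AE AE_I2) (auto simp: indicator_def)
      ultimately show ?thesis by simp
    qed
    finally show ?thesis unfolding qe .
  qed simp
  have es: "ennreal s1 = (\<Sum>j\<in>J. ennreal (\<bar>v (\<tau> j) + w j\<bar> powr p * exp (\<beta> * a (\<tau> j))))"
    "ennreal s2 = (\<Sum>j\<in>J. ennreal (\<bar>v (\<tau> j)\<bar> powr p * exp (\<beta> * a (\<tau> j))))"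
    unfolding s1_def s2_def by (auto intro!: sum_ennreal[symmetric])
  show ?thesis using main unfolding es b_def q_def .
qed

section \<open>Left limits\<close>

text \<open>The value of \<open>y\<close> at the left end of the cell of the partition of \<open>{0<..T}\<close> into \<open>Suc n\<close> equal cells that
contains \<open>t\<close>. For an adapted process this is a sum of elementary predictable processes.\<close>

definition left_step :: "real \<Rightarrow> nat \<Rightarrow> (real \<Rightarrow> real) \<Rightarrow> real \<Rightarrow> real" where
  "left_step T n y t = (\<Sum>k<Suc n. y (T * real k / real (Suc n)) *
     indicator {T * real k / real (Suc n) <.. T * real (Suc k) / real (Suc n)} t)"

text \<open>A total substitute for the left limit, chosen so that it depends measurably on the path even where the
left limit does not exist.\<close>

definition left_version :: "real \<Rightarrow> (real \<Rightarrow> real) \<Rightarrow> real \<Rightarrow> real" where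
  "left_version T y t = lim (\<lambda>n. left_step T n y t)"

lemma left_version_eq:
  assumes T: "T > 0" and t: "t \<in> {0<..T}" and l: "(y \<longlongrightarrow> l) (at_left t)"
  shows "left_version T y t = l"
proof -
  define k where "k n = nat (\<lceil>t * real (Suc n) / T\<rceil> - 1)" for n
  define r where "r n = T * real (k n) / real (Suc n)" for n
  have k: "real (k n) < t * real (Suc n) / T" "t * real (Suc n) / T \<le> real (Suc (k n))" "k n < Suc n" for n
  proof -
    have pos: "0 < t * real (Suc n) / T" using t T by auto
    then have "1 \<le> \<lceil>t * real (Suc n) / T\<rceil>" by (simp add: one_le_ceiling)
    then have kr: "real (k n) = of_int \<lceil>t * real (Suc n) / T\<rceil> - 1" unfolding k_def by simp
    show 1: "real (k n) < t * real (Suc n) / T" unfolding kr by linarith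
    show "t * real (Suc n) / T \<le> real (Suc (k n))" using kr by simp
    have "t * real (Suc n) / T \<le> real (Suc n)" using t T mult_right_mono[of t T "real (Suc n)"] by (simp add: pos_divide_le_eq mult.commute)
    then show "k n < Suc n" using 1 by linarith
  qed
  have r: "r n < t" "t \<le> r n + T * inverse (real (Suc n))" for n
  proof -
    have "T * real (k n) < t * real (Suc n)" "t * real (Suc n) \<le> T * real (Suc (k n))"
      using k(1,2)[of n] T by (simp_all only: less_divide_eq divide_le_eq mult.commute if_True)
    then have "T * real (k n) / real (Suc n) < t" "t \<le> T * real (Suc (k n)) / real (Suc n)"
      by (simp_all only: pos_divide_less_eq pos_le_divide_eq of_nat_0_less_iff zero_less_Suc)
    then show "r n < t" "t \<le> r n + T * inverse (real (Suc n))"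
      by (simp_all add: r_def divide_inverse algebra_simps)
  qed
  have "left_step T n y t = y (r n)" for n
  proof -
    have ind: "indicator {T * real j / real (Suc n) <.. T * real (Suc j) / real (Suc n)} t = (if j = k n then 1 else (0::real))" for j
    proof -
      have "t \<in> {T * real j / real (Suc n) <.. T * real (Suc j) / real (Suc n)} \<longleftrightarrow>
        real j < t * real (Suc n) / T \<and> t * real (Suc n) / T \<le> real (Suc j)"
        using T by (auto simp: field_simps)
      also have "\<dots> \<longleftrightarrow> j = k n"
      proof
        assume "real j < t * real (Suc n) / T \<and> t * real (Suc n) / T \<le> real (Suc j)"
        then have "real j < real (Suc (k n))" "real (k n) < real (Suc j)" using k(1,2)[of n] by linarith+
        then show "j = k n" by simp
      qed (use k(1,2)[of n] in auto)
      finally show ?thesis by (simp only: indicator_def of_bool_def)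
    qed
    show ?thesis unfolding left_step_def ind using k(3)[of n] by (simp add: r_def if_distrib[of "\<lambda>c. _ * c"] cong: if_cong)
  qed
  moreover have "(\<lambda>n. y (r n)) \<longlonglongrightarrow> l"
  proof (rule filterlim_compose[OF l])
    have "r \<longlonglongrightarrow> t"
    proof (rule tendsto_sandwich)
      show "(\<lambda>n. t - T * inverse (real (Suc n))) \<longlonglongrightarrow> t"
        using tendsto_diff[OF tendsto_const tendsto_mult[OF tendsto_const LIMSEQ_inverse_real_of_nat], of t T] by simp
      show "\<forall>\<^sub>F n in sequentially. t - T * inverse (real (Suc n)) \<le> r n" using r(2) by (simp add: algebra_simps)
      show "\<forall>\<^sub>F n in sequentially. r n \<le> t" using r(1) by (simp add: less_imp_le)
    qed simp
    then show "filterlim r (at_left t) sequentially"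
      using r(1) by (simp add: filterlim_at less_imp_neq)
  qed
  ultimately have "(\<lambda>n. left_step T n y t) \<longlonglongrightarrow> l" by simp
  then show ?thesis unfolding left_version_def by (rule limI)
qed

text \<open>Reads the backward equation forwards from time 0; \<open>\<tau> j\<close> and \<open>z j\<close> are the jump times and the values of the
control at the marks.\<close>

lemma bsde_path:
  fixes g :: "real \<times> 'k::topological_space \<Rightarrow> real" and z :: "nat \<Rightarrow> real"
  assumes N: "sets N = sets (borel \<Otimes>\<^sub>M borel)"
    and no_atoms: "\<And>r. r \<in> {0<..T} \<Longrightarrow> emeasure N ({r} \<times> UNIV) = 0"
    and g: "set_integrable N ({0<..T} \<times> UNIV) g"
    and J: "finite J" "\<tau> ` J \<subseteq> {0<..T}" and "0 \<le> T"
    and eq: "\<And>t. t \<in> {0..T} \<Longrightarrow> y t + (\<Sum>j\<in>{j\<in>J. t < \<tau> j}. z j) =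
      c + set_lebesgue_integral N ({t<..T} \<times> UNIV) g"
  shows "\<And>t. t \<in> {0..T} \<Longrightarrow>
      y t = y 0 - set_lebesgue_integral N ({0<..t} \<times> UNIV) g + (\<Sum>j\<in>{j\<in>J. \<tau> j \<le> t}. z j)"
    and "c = y 0 - set_lebesgue_integral N ({0<..T} \<times> UNIV) g + (\<Sum>j\<in>J. z j)"
    and "\<And>t. t \<in> {0<..T} \<Longrightarrow>
      (y \<longlongrightarrow> y 0 - set_lebesgue_integral N ({0<..t} \<times> UNIV) g + (\<Sum>j\<in>{j\<in>J. \<tau> j < t}. z j)) (at_left t)"
proof -
  have all: "{j\<in>J. 0 < \<tau> j} = J" using J(2) by auto
  have c: "y 0 + (\<Sum>j\<in>J. z j) = c + set_lebesgue_integral N ({0<..T} \<times> UNIV) g"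
    using eq[of 0] \<open>0 \<le> T\<close> by (simp add: all)
  then show "c = y 0 - set_lebesgue_integral N ({0<..T} \<times> UNIV) g + (\<Sum>j\<in>J. z j)" by simp
  show y: "y t = y 0 - set_lebesgue_integral N ({0<..t} \<times> UNIV) g + (\<Sum>j\<in>{j\<in>J. \<tau> j \<le> t}. z j)"
    if t: "t \<in> {0..T}" for t
  proof -
    have "set_lebesgue_integral N ({0<..T} \<times> UNIV) g =
      set_lebesgue_integral N ({0<..t} \<times> UNIV) g + set_lebesgue_integral N ({t<..T} \<times> UNIV) g"
      by (rule set_integral_Ioc_split(3)[OF N _ _ g]) (use t in auto)
    moreover have "(\<Sum>j\<in>J. z j) = (\<Sum>j\<in>{j\<in>J. \<tau> j \<le> t}. z j) + (\<Sum>j\<in>{j\<in>J. t < \<tau> j}. z j)"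
      using J(1) by (subst sum.union_disjoint[symmetric]) (auto intro!: sum.cong)
    ultimately show ?thesis using c eq[OF t] by simp
  qed
  fix t assume t: "t \<in> {0<..T}"
  let ?u = "\<lambda>r. y 0 - set_lebesgue_integral N ({0<..r} \<times> UNIV) g + (\<Sum>j\<in>{j\<in>J. \<tau> j < t}. z j)"
  have "((\<lambda>r. set_lebesgue_integral N ({0<..r} \<times> UNIV) g) \<longlongrightarrow>
      set_lebesgue_integral N ({0<..t} \<times> UNIV) g) (at t within {0..T})"
    using continuous_set_integral_Ioc[OF N no_atoms g] t unfolding continuous_on_def by simp
  then have "((\<lambda>r. set_lebesgue_integral N ({0<..r} \<times> UNIV) g) \<longlongrightarrow>
      set_lebesgue_integral N ({0<..t} \<times> UNIV) g) (at t within {0..t})"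
    by (rule tendsto_within_subset) (use t in auto)
  then have "((\<lambda>r. set_lebesgue_integral N ({0<..r} \<times> UNIV) g) \<longlongrightarrow>
      set_lebesgue_integral N ({0<..t} \<times> UNIV) g) (at_left t)"
    using t by (simp add: at_within_Icc_at_left)
  then have "(?u \<longlongrightarrow> ?u t) (at_left t)" by (intro tendsto_intros)
  moreover have "\<forall>\<^sub>F r in at_left t. ?u r = y r"
  proof -
    have "\<forall>\<^sub>F r in at_left t. \<forall>j\<in>{j\<in>J. \<tau> j < t}. \<tau> j < r"
      using J(1) by (intro eventually_ball_finite) (auto simp: eventually_at_left_field intro: exI[of _ "\<tau> _"])
    moreover have "\<forall>\<^sub>F r in at_left t. r \<in> {0<..<t}"
      using t eventually_at_left_real[of 0 t] by (simp add: greaterThanLessThan_iff)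
    ultimately show ?thesis
    proof eventually_elim
      case (elim r)
      have "{j\<in>J. \<tau> j \<le> r} = {j\<in>J. \<tau> j < t}" using elim by (auto intro: less_imp_le)
      then show ?case using y[of r] elim t by simp
    qed
  qed
  ultimately show "(y \<longlongrightarrow> ?u t) (at_left t)" by (rule Lim_transform_eventually)
qed

section \<open>Predictable integrands and the random measures\<close>

context marked_point_process
begin

abbreviation Pr :: "('w \<times> real) measure" where "Pr \<equiv> predictable_algebra (space M) T F"

abbreviation nu_int :: "(('w \<times> real) \<times> 'k \<Rightarrow> ennreal) \<Rightarrow> 'w \<Rightarrow> ennreal" where
  "nu_int H \<omega> \<equiv> (\<integral>\<^sup>+z\<in>{0<..T} \<times> UNIV. H ((\<omega>, fst z), snd z) \<partial>\<nu> \<omega>)"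

abbreviation mu_int :: "(('w \<times> real) \<times> 'k \<Rightarrow> ennreal) \<Rightarrow> 'w \<Rightarrow> ennreal" where
  "mu_int H \<omega> \<equiv> (\<integral>\<^sup>+z\<in>{0<..T} \<times> UNIV. H ((\<omega>, fst z), snd z) \<partial>jump_measure T S X \<omega>)"

definition jumps :: "'w \<Rightarrow> nat set" where "jumps \<omega> = {n. 1 \<le> n \<and> S n \<omega> \<le> ennreal T}"

definition \<tau> :: "nat \<Rightarrow> 'w \<Rightarrow> real" where "\<tau> n \<omega> = enn2real (S n \<omega>)"

abbreviation clip :: "real \<Rightarrow> real" where "clip t \<equiv> max 0 (min T t)"

lemma filtration_F: "filtration (space M) F"
  using F_generated by (auto simp: generated_filtration_def carries_mpp_def)

lemma space_F: "space (F t) = space M"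
  using filtration.space_F[OF filtration_F] .

lemma stopping_time_S: "n \<ge> 1 \<Longrightarrow> stopping_time F (S n)"
  using F_generated by (auto simp: generated_filtration_def carries_mpp_def)

text \<open>The constant filtration \<open>M\<close> carries the marked point process, and \<open>F\<close> is the smallest one that does.\<close>

lemma sets_F_subset: "sets (F t) \<subseteq> sets M"
proof -
  have fil: "filtration (space M) (\<lambda>_::ennreal. M)" by unfold_locales auto
  have st: "stopping_time (\<lambda>_. M) (S n)" if "n \<ge> 1" for n
    unfolding stopping_time_def pred_def using S_measurable[OF that] by auto
  have "carries_mpp (space M) S X (\<lambda>_. M)"
    unfolding carries_mpp_def
  proof (intro conjI allI impI fil st)
    fix n :: nat assume n: "1 \<le> n"
    show "X n \<in> filtration.pre_sigma (space M) (\<lambda>_::ennreal. M) (S n) \<rightarrow>\<^sub>M borel"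
    proof (rule measurableI)
      fix U :: "'k set" assume U: "U \<in> sets borel"
      show "X n -` U \<inter> space (filtration.pre_sigma (space M) (\<lambda>_::ennreal. M) (S n)) \<in> sets (filtration.pre_sigma (space M) (\<lambda>_::ennreal. M) (S n))"
      proof (rule filtration.sets_pre_sigmaI[OF fil st[OF n]])
        fix t
        have "X n -` U \<inter> space M \<in> sets M" "{\<omega>\<in>space M. S n \<omega> \<le> t} \<in> sets M"
          using measurable_sets[OF X_measurable[OF n] U] S_measurable[OF n] by auto
        then have "(X n -` U \<inter> space M) \<inter> {\<omega>\<in>space M. S n \<omega> \<le> t} \<in> sets M" by (rule sets.Int)
        also have "(X n -` U \<inter> space M) \<inter> {\<omega>\<in>space M. S n \<omega> \<le> t} =
          {\<omega> \<in> X n -` U \<inter> space (filtration.pre_sigma (space M) (\<lambda>_::ennreal. M) (S n)). S n \<omega> \<le> t}"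
          by (auto simp: filtration.space_pre_sigma[OF fil])
        finally show "{\<omega> \<in> X n -` U \<inter> space (filtration.pre_sigma (space M) (\<lambda>_::ennreal. M) (S n)). S n \<omega> \<le> t} \<in> sets M" .
      qed
    qed auto
  qed
  then show ?thesis using F_generated by (auto simp: generated_filtration_def)
qed

lemma space_Pr: "space Pr = space M \<times> {0..T}"
  by (simp add: predictable_algebra_def space_measure_of_conv)

lemma Pr_generator_subset:
  "{B \<times> {0} | B. B \<in> sets (F 0)} \<union> {B \<times> {s<..t} | B s t. 0 \<le> s \<and> s \<le> t \<and> t \<le> T \<and> B \<in> sets (F (ennreal s))}
    \<subseteq> Pow (space M \<times> {0..T})"
  using sets.sets_into_space[of _ "F _"] T_pos by (fastforce simp: space_F)

lemma Pr_Ioc: "0 \<le> s \<Longrightarrow> s \<le> t \<Longrightarrow> t \<le> T \<Longrightarrow> B \<in> sets (F (ennreal s)) \<Longrightarrow> B \<times> {s<..t} \<in> sets Pr"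
  unfolding predictable_algebra_def sets_measure_of[OF Pr_generator_subset]
  by (rule sigma_sets.Basic) blast

lemma Pr_zero: "B \<in> sets (F 0) \<Longrightarrow> B \<times> {0} \<in> sets Pr"
  unfolding predictable_algebra_def sets_measure_of[OF Pr_generator_subset]
  by (rule sigma_sets.Basic) blast

lemma space_M_F: "space M \<in> sets (F t)"
  using sets.top[of "F t"] by (simp add: space_F)

text \<open>Predictable integrands are only controlled on \<open>{0..T}\<close>. Clipping the time to this interval gives maps on
the whole line, so that measurability on product spaces can be used without restricting spaces.\<close>

lemma Pr_section:
  assumes "\<omega> \<in> space M" shows "(\<lambda>t. (\<omega>, clip t)) \<in> borel \<rightarrow>\<^sub>M Pr"
  unfolding predictable_algebra_def
proof (rule measurable_measure_of[OF Pr_generator_subset])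
  show "(\<lambda>t. (\<omega>, clip t)) \<in> space borel \<rightarrow> space M \<times> {0..T}" using assms T_pos by auto
next
  fix C assume "C \<in> {B \<times> {0} | B. B \<in> sets (F 0)} \<union> {B \<times> {s<..t} | B s t. 0 \<le> s \<and> s \<le> t \<and> t \<le> T \<and> B \<in> sets (F (ennreal s))}"
  then obtain B R where "C = B \<times> R" "R \<in> sets borel" by auto
  then have "(\<lambda>t. (\<omega>, clip t)) -` C \<inter> space borel = (if \<omega> \<in> B then clip -` R \<inter> space borel else {})"
    "clip -` R \<inter> space borel \<in> sets borel"
    using measurable_sets[of clip borel borel R] by auto
  then show "(\<lambda>t. (\<omega>, clip t)) -` C \<inter> space borel \<in> sets borel" by simp
qed

lemma Pr_time:
  assumes "\<sigma> \<in> borel_measurable M" shows "(\<lambda>\<omega>. (\<omega>, clip (\<sigma> \<omega>))) \<in> M \<rightarrow>\<^sub>M Pr"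
  unfolding predictable_algebra_def
proof (rule measurable_measure_of[OF Pr_generator_subset])
  show "(\<lambda>\<omega>. (\<omega>, clip (\<sigma> \<omega>))) \<in> space M \<rightarrow> space M \<times> {0..T}" using T_pos by auto
next
  fix C assume "C \<in> {B \<times> {0} | B. B \<in> sets (F 0)} \<union> {B \<times> {s<..t} | B s t. 0 \<le> s \<and> s \<le> t \<and> t \<le> T \<and> B \<in> sets (F (ennreal s))}"
  then obtain B R t where "C = B \<times> R" "R \<in> sets borel" "B \<in> sets (F t)" by auto
  then have C: "C = B \<times> R" "R \<in> sets borel" "B \<in> sets M" using sets_F_subset by auto
  then have "(\<lambda>\<omega>. (\<omega>, clip (\<sigma> \<omega>))) -` C \<inter> space M = B \<inter> ((\<lambda>\<omega>. clip (\<sigma> \<omega>)) -` R \<inter> space M)"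
    using sets.sets_into_space by fastforce
  moreover have "(\<lambda>\<omega>. clip (\<sigma> \<omega>)) -` R \<inter> space M \<in> sets M"
    using assms C(2) by (intro measurable_sets[of _ M borel]) auto
  ultimately show "(\<lambda>\<omega>. (\<omega>, clip (\<sigma> \<omega>))) -` C \<inter> space M \<in> sets M" using C by auto
qed

lemma section_measurable:
  fixes H :: "('w \<times> real) \<times> 'k \<Rightarrow> 'c"
  assumes "H \<in> Pr \<Otimes>\<^sub>M borel \<rightarrow>\<^sub>M L" "\<omega> \<in> space M"
  shows "(\<lambda>z. H ((\<omega>, clip (fst z)), snd z)) \<in> borel \<Otimes>\<^sub>M borel \<rightarrow>\<^sub>M L"
proof -
  have "(\<lambda>z. (\<omega>, clip (fst z))) \<in> borel \<Otimes>\<^sub>M (borel :: 'k measure) \<rightarrow>\<^sub>M Pr"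
    using measurable_compose[OF measurable_fst Pr_section[OF assms(2)]] .
  from measurable_compose[OF measurable_Pair[OF this measurable_snd] assms(1)] show ?thesis by simp
qed

lemma indicator_section_measurable:
  fixes H :: "('w \<times> real) \<times> 'k \<Rightarrow> ennreal"
  assumes "H \<in> borel_measurable (Pr \<Otimes>\<^sub>M borel)" "\<omega> \<in> space M"
  shows "(\<lambda>z. H ((\<omega>, fst z), snd z) * indicator ({0<..T} \<times> UNIV) z) \<in> borel_measurable (borel \<Otimes>\<^sub>M borel)"
proof -
  have [measurable]: "{0<..T} \<times> (UNIV :: 'k set) \<in> sets (borel \<Otimes>\<^sub>M borel)"
    by (intro pair_measureI) auto
  have "(\<lambda>z. H ((\<omega>, clip (fst z)), snd z) * indicator ({0<..T} \<times> UNIV) z) \<in> borel_measurable (borel \<Otimes>\<^sub>M borel)"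
    using section_measurable[OF assms] by measurable
  also have "(\<lambda>z. H ((\<omega>, clip (fst z)), snd z) * indicator ({0<..T} \<times> UNIV) z) =
    (\<lambda>z. H ((\<omega>, fst z), snd z) * indicator ({0<..T} \<times> UNIV) z)"
    by (auto simp: indicator_def fun_eq_iff max_def min_def)
  finally show ?thesis .
qed

lemma sets_nu: "\<omega> \<in> space M \<Longrightarrow> sets (\<nu> \<omega>) = sets (borel \<Otimes>\<^sub>M borel)"
  using \<nu>_compensator by (auto simp: predictable_compensator_def predictable_random_measure_def)

lemma nu_int_measurable:
  assumes H: "H \<in> borel_measurable (Pr \<Otimes>\<^sub>M borel)"
  shows "nu_int H \<in> borel_measurable M"
proof -
  have "(\<lambda>(\<omega>, t). \<integral>\<^sup>+z\<in>{0<..t} \<times> UNIV. H ((\<omega>, fst z), snd z) \<partial>\<nu> \<omega>) \<in> borel_measurable Pr"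
    using \<nu>_compensator H by (auto simp: predictable_compensator_def predictable_random_measure_def)
  from measurable_compose[OF Pr_time[of "\<lambda>_. T"] this] show ?thesis using T_pos by simp
qed

lemma compensation:
  assumes H: "H \<in> borel_measurable (Pr \<Otimes>\<^sub>M borel)"
  shows "(\<integral>\<^sup>+\<omega>. mu_int H \<omega> \<partial>M) = (\<integral>\<^sup>+\<omega>. nu_int H \<omega> \<partial>M)"
  using \<nu>_compensator H by (auto simp: predictable_compensator_def)

lemma S_mono_le: "\<omega> \<in> space M \<Longrightarrow> m \<le> n \<Longrightarrow> S m \<omega> \<le> S n \<omega>"
  by (rule lift_Suc_mono_le[of "\<lambda>n. S n \<omega>"]) (auto intro: S_mono)

lemma finite_jumps: assumes "\<omega> \<in> space M" shows "finite (jumps \<omega>)"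
proof -
  obtain N where N: "ennreal T < S N \<omega>" using assms non_explosive by auto
  have "n < N" if "n \<in> jumps \<omega>" for n
    using S_mono_le[OF assms, of N n] N that by (auto simp: jumps_def not_less[symmetric] intro: less_le_trans)
  then show ?thesis by (meson finite_nat_iff_bounded lessThan_iff subsetI)
qed

lemma jump_time:
  assumes "\<omega> \<in> space M" "n \<in> jumps \<omega>"
  shows "S n \<omega> = ennreal (\<tau> n \<omega>)" "\<tau> n \<omega> \<in> {0<..T}"
proof -
  have n: "1 \<le> n" "S n \<omega> \<le> ennreal T" using assms by (auto simp: jumps_def)
  then obtain t where t: "S n \<omega> = ennreal t" "t \<in> {0<..T}"
    using S_range[OF n(1) assms(1)] by (auto simp: top_unique)
  then show "S n \<omega> = ennreal (\<tau> n \<omega>)" "\<tau> n \<omega> \<in> {0<..T}" by (auto simp: \<tau>_def)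
qed

lemma strict_mono_jump_times:
  assumes "\<omega> \<in> space M" shows "strict_mono_on (jumps \<omega>) (\<lambda>n. \<tau> n \<omega>)"
proof (rule strict_mono_onI)
  fix m n assume mn: "m \<in> jumps \<omega>" "n \<in> jumps \<omega>" "m < n"
  have "S m \<omega> < S (Suc m) \<omega>" using S_strict assms mn(1) by (auto simp: jumps_def)
  also have "\<dots> \<le> S n \<omega>" using S_mono_le assms mn(3) by auto
  finally show "\<tau> m \<omega> < \<tau> n \<omega>" using jump_time[OF assms mn(1)] jump_time[OF assms mn(2)]
    by (simp add: ennreal_less_iff)
qed

lemma nn_integral_jump_measure:
  assumes "\<omega> \<in> space M" "h \<in> borel_measurable (borel \<Otimes>\<^sub>M borel)"
  shows "(\<integral>\<^sup>+z. h z \<partial>jump_measure T S X \<omega>) = (\<Sum>n\<in>jumps \<omega>. h (\<tau> n \<omega>, X n \<omega>))"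
  unfolding jump_measure_def jumps_def[symmetric] \<tau>_def using assms finite_jumps[OF assms(1)]
  by (subst nn_integral_distr) (auto simp: nn_integral_count_space_finite space_pair_measure)

lemma mu_int_eq:
  assumes "\<omega> \<in> space M" "H \<in> borel_measurable (Pr \<Otimes>\<^sub>M borel)"
  shows "mu_int H \<omega> = (\<Sum>n\<in>jumps \<omega>. H ((\<omega>, \<tau> n \<omega>), X n \<omega>))"
  unfolding nn_integral_jump_measure[OF assms(1) indicator_section_measurable[OF assms(2,1)]]
  using jump_time[OF assms(1)] by (intro sum.cong) auto

lemma mu_int_measurable:
  assumes H: "H \<in> borel_measurable (Pr \<Otimes>\<^sub>M borel)"
  shows "mu_int H \<in> borel_measurable M"
proof -
  define s where "s \<omega> n = (if n \<in> jumps \<omega> then H ((\<omega>, clip (\<tau> n \<omega>)), X n \<omega>) else 0)" for \<omega> n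
  have "(\<lambda>\<omega>. s \<omega> n) \<in> borel_measurable M" for n
  proof (cases "1 \<le> n")
    case True
    note [measurable] = S_measurable[OF True] X_measurable[OF True]
    have [measurable]: "\<tau> n \<in> borel_measurable M" unfolding \<tau>_def[abs_def] by measurable
    note [measurable] = Pr_time[OF this]
    have "(\<lambda>\<omega>. if S n \<omega> \<le> ennreal T then H ((\<omega>, clip (\<tau> n \<omega>)), X n \<omega>) else 0) \<in> borel_measurable M"
      using H by measurable
    then show ?thesis using True by (simp add: s_def jumps_def)
  next
    case False
    then show ?thesis by (simp add: s_def jumps_def)
  qed
  then have "(\<lambda>\<omega>. \<Sum>n. s \<omega> n) \<in> borel_measurable M" by measurable
  moreover have "(\<Sum>n. s \<omega> n) = mu_int H \<omega>" if w: "\<omega> \<in> space M" for \<omega>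
  proof -
    have "(\<Sum>n. s \<omega> n) = (\<Sum>n\<in>jumps \<omega>. s \<omega> n)"
      by (rule suminf_finite[OF finite_jumps[OF w]]) (simp add: s_def)
    also have "\<dots> = (\<Sum>n\<in>jumps \<omega>. H ((\<omega>, \<tau> n \<omega>), X n \<omega>))"
    proof (intro sum.cong refl)
      fix n assume n: "n \<in> jumps \<omega>"
      then have "clip (\<tau> n \<omega>) = \<tau> n \<omega>" using jump_time(2)[OF w n] by simp
      then show "s \<omega> n = H ((\<omega>, \<tau> n \<omega>), X n \<omega>)" using n by (simp add: s_def)
    qed
    finally show ?thesis by (simp add: mu_int_eq[OF w H])
  qed
  ultimately show ?thesis by (subst measurable_cong) auto
qed

section \<open>Disintegration of the compensator\<close>

definition regular :: "'w \<Rightarrow> bool" where "regular \<omega> \<longleftrightarrow> \<omega> \<in> space M \<and> mono_on {0..T} (A \<omega>) \<and> continuous_on {0..T} (A \<omega>) \<and>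
  (\<forall>B\<in>sets (borel \<Otimes>\<^sub>M borel). emeasure (\<nu> \<omega>) B =
          (\<integral>\<^sup>+t\<in>{0<..T}. emeasure (\<phi> \<omega> t) {x. (t, x) \<in> B} \<partial>stieltjes T (A \<omega>)))"

lemma AE_regular: "AE \<omega> in M. regular \<omega>"
  using A_increasing A_continuous \<nu>_disintegration AE_space
  by eventually_elim (simp add: regular_def)

lemma \<phi>_space: "\<omega> \<in> space M \<Longrightarrow> t \<in> {0..T} \<Longrightarrow> \<phi> \<omega> t \<in> space (prob_algebra borel)"
  using measurable_space[OF \<phi>_transition, of "(\<omega>, t)"] by (auto simp: space_Pr)

lemma \<phi>_prob: "\<omega> \<in> space M \<Longrightarrow> t \<in> {0..T} \<Longrightarrow> prob_space (\<phi> \<omega> t)"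
  and \<phi>_sets: "\<omega> \<in> space M \<Longrightarrow> t \<in> {0..T} \<Longrightarrow> sets (\<phi> \<omega> t) = sets borel"
  using \<phi>_space by (auto simp: space_prob_algebra)

lemma sets_stieltjes [simp, measurable_cong]: "sets (stieltjes T a) = sets borel"
  by (simp add: stieltjes_def)

lemma stieltjes_path:
  assumes "regular \<omega>"
  defines "a \<equiv> \<lambda>t. A \<omega> (clip t)"
  shows "x \<le> y \<Longrightarrow> a x \<le> a y" "continuous_on UNIV a"
proof -
  have A: "mono_on {0..T} (A \<omega>)" "continuous_on {0..T} (A \<omega>)"
    using assms(1) by (simp_all only: regular_def)
  show "x \<le> y \<Longrightarrow> a x \<le> a y"
    unfolding a_def using T_pos by (intro mono_onD[OF A(1)]) auto
  show "continuous_on UNIV a" unfolding a_def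
    using T_pos by (intro continuous_on_compose2[OF A(2)] continuous_intros) auto
qed

lemma emeasure_nu_strip:
  assumes r: "regular \<omega>" and R: "R \<in> sets borel" "R \<subseteq> {0<..T}"
  shows "emeasure (\<nu> \<omega>) (R \<times> UNIV) = emeasure (stieltjes T (A \<omega>)) R"
proof -
  have w: "\<omega> \<in> space M" using r by (simp add: regular_def)
  have B: "R \<times> (UNIV::'k set) \<in> sets (borel \<Otimes>\<^sub>M borel)" using R by (intro pair_measureI) auto
  have "emeasure (\<nu> \<omega>) (R \<times> UNIV) = (\<integral>\<^sup>+t\<in>{0<..T}. emeasure (\<phi> \<omega> t) {x. (t, x) \<in> R \<times> (UNIV::'k set)} \<partial>stieltjes T (A \<omega>))"
    using r B by (simp add: regular_def)
  also have "\<dots> = (\<integral>\<^sup>+t. indicator R t \<partial>stieltjes T (A \<omega>))"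
  proof (intro nn_integral_cong)
    fix t
    show "emeasure (\<phi> \<omega> t) {x. (t, x) \<in> R \<times> (UNIV::'k set)} * indicator {0<..T} t = indicator R t"
    proof (cases "t \<in> R")
      case True
      then have t: "t \<in> {0..T}" using R(2) by auto
      have "space (\<phi> \<omega> t) = UNIV" using sets_eq_imp_space_eq[OF \<phi>_sets[OF w t]] by simp
      then show ?thesis using True R(2) prob_space.emeasure_space_1[OF \<phi>_prob[OF w t]] by auto
    qed simp
  qed
  also have "\<dots> = emeasure (stieltjes T (A \<omega>)) R" using R(1) by (intro nn_integral_indicator) simp
  finally show ?thesis .
qed

lemma emeasure_nu_Ioc:
  assumes r: "regular \<omega>" and "0 \<le> s" "s \<le> t" "t \<le> T"
  shows "emeasure (\<nu> \<omega>) ({s<..t} \<times> UNIV) = ennreal (A \<omega> t - A \<omega> s)"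
proof -
  have "emeasure (\<nu> \<omega>) ({s<..t} \<times> UNIV) = emeasure (stieltjes T (A \<omega>)) {s<..t}"
    using assms by (intro emeasure_nu_strip[OF r]) auto
  also have "\<dots> = ennreal (A \<omega> (clip t) - A \<omega> (clip s))" unfolding stieltjes_def
  proof (rule emeasure_interval_measure_Ioc[OF assms(3) stieltjes_path(1)[OF r]])
    fix x
    show "continuous (at_right x) (\<lambda>t. A \<omega> (clip t))"
      using stieltjes_path(2)[OF r] by (simp add: continuous_on_eq_continuous_within continuous_within_subset[of x UNIV])
  qed
  finally show ?thesis using assms by (simp add: max_def min_def)
qed

lemma emeasure_nu_singleton:
  assumes r: "regular \<omega>" and "t \<in> {0<..T}"
  shows "emeasure (\<nu> \<omega>) ({t} \<times> UNIV) = 0"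
proof -
  have "emeasure (\<nu> \<omega>) ({t} \<times> UNIV) = emeasure (stieltjes T (A \<omega>)) {t..t}"
    using assms by (subst emeasure_nu_strip[OF r]) auto
  also have "\<dots> = 0" unfolding stieltjes_def
    using stieltjes_path[OF r] by (subst emeasure_interval_measure_Icc) auto
  finally show ?thesis .
qed

text \<open>The disintegration is given on sets; it says that \<open>\<nu> \<omega>\<close> is the composition of the restricted Stieltjes
measure with the kernel that sends \<open>t\<close> to the image of \<open>\<phi> \<omega> t\<close> under \<open>Pair t\<close>.\<close>

lemma nn_integral_nu:
  assumes r: "regular \<omega>" and h: "h \<in> borel_measurable (borel \<Otimes>\<^sub>M borel)"
  shows "(\<integral>\<^sup>+z. h z \<partial>\<nu> \<omega>) = (\<integral>\<^sup>+t\<in>{0<..T}. (\<integral>\<^sup>+x. h (t, x) \<partial>\<phi> \<omega> t) \<partial>stieltjes T (A \<omega>))"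
proof -
  have w: "\<omega> \<in> space M" using r by (simp add: regular_def)
  define K where "K t = distr (\<phi> \<omega> (clip t)) (borel \<Otimes>\<^sub>M borel) (\<lambda>x. (t, x))" for t
  have [measurable]: "(\<lambda>t. \<phi> \<omega> (clip t)) \<in> borel \<rightarrow>\<^sub>M subprob_algebra borel"
    using measurable_compose[OF Pr_section[OF w] measurable_prob_algebraD[OF \<phi>_transition]] by simp
  have K: "K \<in> borel \<rightarrow>\<^sub>M subprob_algebra (borel \<Otimes>\<^sub>M borel)"
    unfolding K_def[abs_def] by (rule measurable_distr2[where M = borel]) auto
  define D where "D = density (stieltjes T (A \<omega>)) (indicator {0<..T})"
  have KD: "K \<in> D \<rightarrow>\<^sub>M subprob_algebra (borel \<Otimes>\<^sub>M borel)"
    using K by (simp add: D_def cong: measurable_cong_sets)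
  have c: "clip t = t" if "t \<in> {0<..T}" for t using that by auto
  have Pm: "Pair t \<in> \<phi> \<omega> t \<rightarrow>\<^sub>M borel \<Otimes>\<^sub>M borel" if "t \<in> {0<..T}" for t
    by (subst measurable_cong_sets[OF \<phi>_sets[OF w] refl]) (use that in auto)
  have "\<nu> \<omega> = D \<bind> K"
  proof (rule measure_eqI)
    show "sets (\<nu> \<omega>) = sets (D \<bind> K)"
      using sets_bind[of D K] by (subst sets_bind[where N = "borel \<Otimes>\<^sub>M borel"]) (auto simp: sets_nu[OF w] K_def D_def stieltjes_def)
    fix B assume "B \<in> sets (\<nu> \<omega>)"
    then have B[measurable]: "B \<in> sets (borel \<Otimes>\<^sub>M borel)" using sets_nu[OF w] by simp
    have "emeasure (D \<bind> K) B = (\<integral>\<^sup>+t. emeasure (K t) B \<partial>D)"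
      by (rule emeasure_bind[OF _ KD B]) (simp add: D_def stieltjes_def)
    also have "\<dots> = (\<integral>\<^sup>+t. indicator {0<..T} t * emeasure (K t) B \<partial>stieltjes T (A \<omega>))"
      unfolding D_def using measurable_emeasure_kernel[OF K B] by (subst nn_integral_density) auto
    also have "\<dots> = (\<integral>\<^sup>+t\<in>{0<..T}. emeasure (\<phi> \<omega> t) {x. (t, x) \<in> B} \<partial>stieltjes T (A \<omega>))"
    proof (intro nn_integral_cong)
      fix t
      show "indicator {0<..T} t * emeasure (K t) B = emeasure (\<phi> \<omega> t) {x. (t, x) \<in> B} * indicator {0<..T} t"
      proof (cases "t \<in> {0<..T}")
        case True
        have "space (\<phi> \<omega> t) = UNIV" using sets_eq_imp_space_eq[OF \<phi>_sets[OF w, of t]] True by simp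
        then show ?thesis using True emeasure_distr[OF Pm[OF True] B] by (simp add: K_def c vimage_def)
      qed simp
    qed
    also have "\<dots> = emeasure (\<nu> \<omega>) B" using r B by (simp add: regular_def)
    finally show "emeasure (\<nu> \<omega>) B = emeasure (D \<bind> K) B" by simp
  qed
  then have "(\<integral>\<^sup>+z. h z \<partial>\<nu> \<omega>) = (\<integral>\<^sup>+t. (\<integral>\<^sup>+z. h z \<partial>K t) \<partial>D)"
    using nn_integral_bind[OF h KD] by simp
  also have "\<dots> = (\<integral>\<^sup>+t. indicator {0<..T} t * (\<integral>\<^sup>+z. h z \<partial>K t) \<partial>stieltjes T (A \<omega>))"
    unfolding D_def using measurable_compose[OF K nn_integral_measurable_subprob_algebra[OF h]]
    by (subst nn_integral_density) auto
  also have "\<dots> = (\<integral>\<^sup>+t\<in>{0<..T}. (\<integral>\<^sup>+x. h (t, x) \<partial>\<phi> \<omega> t) \<partial>stieltjes T (A \<omega>))"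
  proof (intro nn_integral_cong)
    fix t
    show "indicator {0<..T} t * (\<integral>\<^sup>+z. h z \<partial>K t) = (\<integral>\<^sup>+x. h (t, x) \<partial>\<phi> \<omega> t) * indicator {0<..T} t"
    proof (cases "t \<in> {0<..T}")
      case True
      then show ?thesis using nn_integral_distr[OF Pm[OF True], of h] h by (simp add: K_def c)
    qed simp
  qed
  finally show ?thesis .
qed

section \<open>Predictable processes and their integrals\<close>

lemma time_Pr: "snd \<in> borel_measurable Pr"
  unfolding borel_measurable_iff_le
proof
  fix a :: real
  show "{w \<in> space Pr. snd w \<le> a} \<in> sets Pr"
  proof (cases "0 \<le> a")
    case True
    have "{w \<in> space Pr. snd w \<le> a} = space M \<times> {0} \<union> space M \<times> {0<..min a T}"
      using True T_pos by (auto simp: space_Pr)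
    also have "\<dots> \<in> sets Pr"
      using True T_pos by (intro sets.Un Pr_zero Pr_Ioc space_M_F) auto
    finally show ?thesis .
  next
    case False
    then have "{w \<in> space Pr. snd w \<le> a} = {}" by (auto simp: space_Pr)
    then show ?thesis by (metis sets.empty_sets)
  qed
qed

text \<open>Compensation of the predictable indicator of \<open>{T}\<close>: the expected number of jumps at time \<open>T\<close> is the
expected \<open>\<nu>\<close>-mass of \<open>{T} \<times> UNIV\<close>, which is 0 since \<open>A\<close> is continuous.\<close>

lemma S_ne_T: "AE \<omega> in M. \<forall>m\<ge>1. S m \<omega> \<noteq> ennreal T"
proof -
  define H :: "('w \<times> real) \<times> 'k \<Rightarrow> ennreal" where "H u = indicator {T} (snd (fst u))" for u
  have H: "H \<in> borel_measurable (Pr \<Otimes>\<^sub>M borel)"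
    unfolding H_def[abs_def] using measurable_compose[OF measurable_fst time_Pr] by measurable
  have "(\<integral>\<^sup>+\<omega>. nu_int H \<omega> \<partial>M) = (\<integral>\<^sup>+\<omega>. 0 \<partial>M)"
  proof (intro nn_integral_cong_AE, use AE_regular in eventually_elim)
    fix \<omega> assume r: "regular \<omega>"
    then have w: "\<omega> \<in> space M" by (simp add: regular_def)
    have "nu_int H \<omega> = (\<integral>\<^sup>+z. indicator ({T} \<times> UNIV) z \<partial>\<nu> \<omega>)"
      unfolding H_def using T_pos by (intro nn_integral_cong) (auto simp: indicator_def)
    also have "\<dots> = emeasure (\<nu> \<omega>) ({T} \<times> UNIV)"
      by (rule nn_integral_indicator) (auto simp: sets_nu[OF w] intro!: pair_measureI)
    also have "\<dots> = 0" using emeasure_nu_singleton[OF r] T_pos by simp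
    finally show "nu_int H \<omega> = 0" .
  qed
  then have "(\<integral>\<^sup>+\<omega>. mu_int H \<omega> \<partial>M) = 0" using compensation[OF H] by simp
  then have "AE \<omega> in M. mu_int H \<omega> = 0"
    using nn_integral_0_iff_AE[OF mu_int_measurable[OF H]] by simp
  then show ?thesis
    using AE_space
  proof eventually_elim
    fix \<omega> assume 0: "mu_int H \<omega> = 0" and w: "\<omega> \<in> space M"
    show "\<forall>m\<ge>1. S m \<omega> \<noteq> ennreal T"
    proof (intro allI impI notI)
      fix m :: nat assume m: "m \<ge> 1" "S m \<omega> = ennreal T"
      then have J: "m \<in> jumps \<omega>" and t: "\<tau> m \<omega> = T" using T_pos by (auto simp: jumps_def \<tau>_def)
      have "(\<Sum>n\<in>jumps \<omega>. H ((\<omega>, \<tau> n \<omega>), X n \<omega>)) = 0" using 0 mu_int_eq[OF w H] by simp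
      then have "H ((\<omega>, \<tau> m \<omega>), X m \<omega>) = 0" using finite_jumps[OF w] J by simp
      then show False by (simp add: H_def t)
    qed
  qed
qed

text \<open>The stochastic interval after a stopping time is the union over rational \<open>q\<close> of the elementary
predictable sets \<open>{S m \<le> q} \<times> {q<..T}\<close>.\<close>

lemma after_S_Pr:
  assumes "m \<ge> 1"
  shows "{w \<in> space Pr. S m (fst w) < ennreal (snd w)} \<in> sets Pr"
proof -
  have "{w \<in> space Pr. S m (fst w) < ennreal (snd w)} =
    (\<Union>q\<in>\<rat> \<inter> {0..T}. {\<omega> \<in> space M. S m \<omega> \<le> ennreal q} \<times> {q<..T})" (is "?L = ?R")
  proof (intro set_eqI iffI)
    fix w assume "w \<in> ?L"
    then have w: "fst w \<in> space M" "snd w \<in> {0..T}" "S m (fst w) < ennreal (snd w)" by (auto simp: space_Pr)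
    then obtain s where s: "S m (fst w) = ennreal s" "0 \<le> s" by (cases "S m (fst w)") auto
    then have "s < snd w" using w by (simp add: ennreal_less_iff)
    then obtain q where "q \<in> \<rat>" "s < q" "q < snd w" using Rats_dense_in_real by blast
    then show "w \<in> ?R" using w s by (cases w) (auto intro!: bexI[of _ q] ennreal_leI)
  next
    fix w assume "w \<in> ?R"
    then obtain q where "0 \<le> q" "q \<le> T" "fst w \<in> space M" "S m (fst w) \<le> ennreal q" "q < snd w" "snd w \<le> T" by auto
    then show "w \<in> ?L" by (auto simp: space_Pr mem_Times_iff intro: le_less_trans simp: ennreal_lessI)
  qed
  also have "\<dots> \<in> sets Pr"
  proof (rule sets.countable_UN')
    show "countable (\<rat> \<inter> {0..T})" by (auto intro: countable_subset[OF _ countable_rat])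
    show "(\<lambda>q. {\<omega> \<in> space M. S m \<omega> \<le> ennreal q} \<times> {q<..T}) ` (\<rat> \<inter> {0..T}) \<subseteq> sets Pr"
    proof (rule image_subsetI)
      fix q assume q: "q \<in> \<rat> \<inter> {0..T}"
      have "{\<omega> \<in> space M. S m \<omega> \<le> ennreal q} \<in> sets (F (ennreal q))"
        using stopping_timeD[OF stopping_time_S[OF assms], of "ennreal q"] by (simp add: pred_def space_F)
      then show "{\<omega> \<in> space M. S m \<omega> \<le> ennreal q} \<times> {q<..T} \<in> sets Pr"
        using q by (intro Pr_Ioc) auto
    qed
  qed
  finally show ?thesis .
qed

lemma left_version_predictable:
  assumes "adapted_process T F Y"
  shows "(\<lambda>(\<omega>, t). left_version T (Y \<omega>) t) \<in> borel_measurable Pr"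
proof -
  have step: "(\<lambda>w. h (fst w) * indicator {s<..t} (snd w)) \<in> borel_measurable Pr"
    if h: "h \<in> borel_measurable (F (ennreal s))" and st: "0 \<le> s" "s \<le> t" "t \<le> T" for h :: "'w \<Rightarrow> real" and s t
  proof (rule measurableI)
    fix U :: "real set" assume U: "U \<in> sets borel"
    let ?k = "\<lambda>w. h (fst w) * indicator {s<..t} (snd w)"
    let ?B = "\<lambda>V. (h -` V \<inter> space M) \<times> {s<..t}"
    have B: "?B V \<in> sets Pr" if "V \<in> sets borel" for V
      using measurable_sets[OF h that] st by (intro Pr_Ioc) (auto simp: space_F)
    show "?k -` U \<inter> space Pr \<in> sets Pr"
    proof (cases "0 \<in> U")
      case True
      then have "?k -` U \<inter> space Pr = space Pr - ?B (- U)"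
        using st by (auto simp: space_Pr indicator_def split: if_splits)
      then show ?thesis using B[of "- U"] U by auto
    next
      case False
      then have "?k -` U \<inter> space Pr = ?B U"
        using st by (auto simp: space_Pr indicator_def of_bool_def split: if_splits)
      then show ?thesis using B[OF U] by simp
    qed
  qed simp
  have "(\<lambda>w. left_step T n (Y (fst w)) (snd w)) \<in> borel_measurable Pr" for n
    unfolding left_step_def
  proof (intro borel_measurable_sum step)
    fix k assume k: "k \<in> {..<Suc n}"
    show 1: "0 \<le> T * real k / real (Suc n)" using T_pos by simp
    show "T * real k / real (Suc n) \<le> T * real (Suc k) / real (Suc n)"
      using T_pos by (intro divide_right_mono) auto
    show 2: "T * real (Suc k) / real (Suc n) \<le> T"
      using T_pos k by (simp add: divide_le_eq)
    have "T * real k / real (Suc n) \<le> T * real (Suc k) / real (Suc n)"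
      using T_pos by (intro divide_right_mono) auto
    then show "(\<lambda>\<omega>. Y \<omega> (T * real k / real (Suc n))) \<in> borel_measurable (F (ennreal (T * real k / real (Suc n))))"
      using assms 1 2 unfolding adapted_process_def by auto
  qed
  then have "(\<lambda>w. lim (\<lambda>n. left_step T n (Y (fst w)) (snd w))) \<in> borel_measurable Pr"
    by (rule borel_measurable_lim_metric)
  then show ?thesis by (simp add: left_version_def case_prod_beta')
qed

lemma predictable_A: "(\<lambda>u. A (fst (fst u)) (snd (fst u))) \<in> borel_measurable (Pr \<Otimes>\<^sub>M (borel :: 'k measure))"
  using measurable_compose[OF measurable_fst A_predictable] by (simp add: case_prod_beta')

lemma predictable_left_version: "adapted_process T F Y \<Longrightarrow>
  (\<lambda>u. left_version T (Y (fst (fst u))) (snd (fst u))) \<in> borel_measurable (Pr \<Otimes>\<^sub>M (borel :: 'k measure))"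
  using measurable_compose[OF measurable_fst left_version_predictable] by (simp add: case_prod_beta')

lemma predictable_after_S:
  assumes "m \<ge> 1"
  shows "Measurable.pred (Pr \<Otimes>\<^sub>M (borel :: 'k measure)) (\<lambda>u. S m (fst (fst u)) < ennreal (snd (fst u)))"
proof -
  have "Measurable.pred Pr (\<lambda>w. S m (fst w) < ennreal (snd w))"
    unfolding pred_def by (rule after_S_Pr[OF assms])
  from measurable_compose[OF measurable_fst this] show ?thesis .
qed

lemma predictable_driver:
  assumes H: "hypothesis_H M T F \<nu> A \<phi> p \<beta> L L' \<xi> f"
    and Z: "predictable (space M) T F Z" and V: "V \<in> borel_measurable (Pr \<Otimes>\<^sub>M borel)"
  shows "(\<lambda>u. f (fst (fst u)) (snd (fst u)) (snd u) (V u) (Z (fst (fst u)) (snd (fst u))))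
    \<in> borel_measurable (Pr \<Otimes>\<^sub>M borel)"
proof -
  have f: "(\<lambda>((\<omega>, t), (x, y)). f \<omega> t x y (Z \<omega> t)) \<in> borel_measurable (Pr \<Otimes>\<^sub>M (borel \<Otimes>\<^sub>M borel))"
    using H Z unfolding hypothesis_H_def by blast
  have "(\<lambda>u. (fst u, (snd u, V u))) \<in> Pr \<Otimes>\<^sub>M borel \<rightarrow>\<^sub>M Pr \<Otimes>\<^sub>M (borel \<Otimes>\<^sub>M borel)"
    using V by measurable
  from measurable_compose[OF this f] show ?thesis by (simp add: case_prod_beta')
qed

lemma nu_int_disintegrate:
  assumes "regular \<omega>" "H \<in> borel_measurable (Pr \<Otimes>\<^sub>M borel)"
  shows "nu_int H \<omega> = (\<integral>\<^sup>+t\<in>{0<..T}. (\<integral>\<^sup>+x. H ((\<omega>, t), x) \<partial>\<phi> \<omega> t) \<partial>stieltjes T (A \<omega>))"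
proof -
  have "\<omega> \<in> space M" using assms by (simp add: regular_def)
  from nn_integral_nu[OF assms(1) indicator_section_measurable[OF assms(2) this]]
  show ?thesis by (auto intro!: nn_integral_cong simp: indicator_def)
qed

lemma nu_int_kernel_mono:
  assumes "regular \<omega>" "H \<in> borel_measurable (Pr \<Otimes>\<^sub>M borel)" "H' \<in> borel_measurable (Pr \<Otimes>\<^sub>M borel)"
    and le: "\<And>t. t \<in> {0<..T} \<Longrightarrow> (\<integral>\<^sup>+x. H ((\<omega>, t), x) \<partial>\<phi> \<omega> t) \<le> (\<integral>\<^sup>+x. H' ((\<omega>, t), x) \<partial>\<phi> \<omega> t)"
  shows "nu_int H \<omega> \<le> nu_int H' \<omega>"
  unfolding nu_int_disintegrate[OF assms(1,2)] nu_int_disintegrate[OF assms(1,3)]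
  using le by (intro nn_integral_mono) (auto simp: indicator_def)

lemma mark_section_measurable:
  fixes H :: "('w \<times> real) \<times> 'k \<Rightarrow> 'c"
  assumes "H \<in> Pr \<Otimes>\<^sub>M borel \<rightarrow>\<^sub>M R" "\<omega> \<in> space M" "t \<in> {0..T}"
  shows "(\<lambda>x. H ((\<omega>, t), x)) \<in> borel \<rightarrow>\<^sub>M R"
proof -
  have "(\<lambda>x. ((\<omega>, t), x)) \<in> borel \<rightarrow>\<^sub>M Pr \<Otimes>\<^sub>M (borel :: 'k measure)"
    using assms by (intro measurable_Pair1') (simp add: space_Pr)
  from measurable_compose[OF this assms(1)] show ?thesis .
qed

lemma nu_int_add:
  assumes "\<omega> \<in> space M" "H \<in> borel_measurable (Pr \<Otimes>\<^sub>M borel)" "H' \<in> borel_measurable (Pr \<Otimes>\<^sub>M borel)"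
  shows "nu_int (\<lambda>u. H u + H' u) \<omega> = nu_int H \<omega> + nu_int H' \<omega>"
proof -
  note i = indicator_section_measurable[OF assms(2,1)] indicator_section_measurable[OF assms(3,1)]
  show ?thesis unfolding distrib_right
    using i by (intro nn_integral_add) (simp_all add: measurable_cong_sets[OF sets_nu[OF assms(1)] refl])
qed

lemma nu_int_cmult:
  assumes "\<omega> \<in> space M" "H \<in> borel_measurable (Pr \<Otimes>\<^sub>M borel)"
  shows "nu_int (\<lambda>u. k * H u) \<omega> = k * nu_int H \<omega>"
proof -
  note i = indicator_section_measurable[OF assms(2,1)]
  show ?thesis unfolding mult.assoc
    using i by (intro nn_integral_cmult) (simp_all add: measurable_cong_sets[OF sets_nu[OF assms(1)] refl])
qed

section \<open>Solutions along paths\<close>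

lemma set_integral_jump_measure:
  assumes Z: "predictable (space M) T F Z" and w: "\<omega> \<in> space M" and t: "0 \<le> t"
  shows "set_lebesgue_integral (jump_measure T S X \<omega>) ({t<..T} \<times> UNIV) (\<lambda>(s, x). Z \<omega> s x) =
    (\<Sum>n\<in>{n\<in>jumps \<omega>. t < \<tau> n \<omega>}. Z \<omega> (\<tau> n \<omega>) (X n \<omega>))"
proof -
  let ?h = "\<lambda>z. indicator ({t<..T} \<times> UNIV) z *\<^sub>R (case z of (s, x) \<Rightarrow> Z \<omega> s x)"
  have h: "?h \<in> borel_measurable (borel \<Otimes>\<^sub>M borel)"
  proof -
    have [measurable]: "{t<..T} \<times> (UNIV :: 'k set) \<in> sets (borel \<Otimes>\<^sub>M borel)"
      by (intro pair_measureI) auto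
    have "(\<lambda>z. indicator ({t<..T} \<times> UNIV) z *\<^sub>R Z \<omega> (clip (fst z)) (snd z)) \<in> borel_measurable (borel \<Otimes>\<^sub>M borel)"
      using section_measurable[OF Z[unfolded predictable_def] w] by simp
    also have "(\<lambda>z. indicator ({t<..T} \<times> UNIV) z *\<^sub>R Z \<omega> (clip (fst z)) (snd z)) = ?h"
      using t by (auto simp: fun_eq_iff indicator_def)
    finally show ?thesis .
  qed
  have "set_lebesgue_integral (jump_measure T S X \<omega>) ({t<..T} \<times> UNIV) (\<lambda>(s, x). Z \<omega> s x) =
    (LINT n|count_space (jumps \<omega>). ?h (\<tau> n \<omega>, X n \<omega>))"
    unfolding set_lebesgue_integral_def jump_measure_def jumps_def[symmetric] \<tau>_def[symmetric]
    using h by (intro integral_distr) (auto simp: space_pair_measure)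
  also have "\<dots> = (\<Sum>n\<in>jumps \<omega>. ?h (\<tau> n \<omega>, X n \<omega>))"
    by (rule lebesgue_integral_count_space_finite[OF finite_jumps[OF w]])
  also have "\<dots> = (\<Sum>n\<in>{n\<in>jumps \<omega>. t < \<tau> n \<omega>}. Z \<omega> (\<tau> n \<omega>) (X n \<omega>))"
    unfolding sum.inter_filter[OF finite_jumps[OF w]]
    using jump_time(2)[OF w] by (intro sum.cong) (auto simp: indicator_def)
  finally show ?thesis .
qed

definition solution_path :: "('w \<Rightarrow> real) \<Rightarrow> ('w \<Rightarrow> real \<Rightarrow> 'k \<Rightarrow> real) \<Rightarrow>
   ('w \<Rightarrow> real \<Rightarrow> real) \<Rightarrow> ('w \<Rightarrow> real \<Rightarrow> 'k \<Rightarrow> real) \<Rightarrow> 'w \<Rightarrow> bool" where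
  "solution_path \<xi> g Y Z \<omega> \<longleftrightarrow> regular \<omega> \<and>
    set_integrable (\<nu> \<omega>) ({0<..T} \<times> UNIV) (\<lambda>(s, x). g \<omega> s x) \<and>
    (\<forall>t\<in>{0..T}. Y \<omega> t + (\<Sum>n\<in>{n\<in>jumps \<omega>. t < \<tau> n \<omega>}. Z \<omega> (\<tau> n \<omega>) (X n \<omega>)) =
       \<xi> \<omega> + set_lebesgue_integral (\<nu> \<omega>) ({t<..T} \<times> UNIV) (\<lambda>(s, x). g \<omega> s x))"

lemma AE_solution_path:
  assumes "bsde_solution M T F (jump_measure T S X) \<nu> \<xi> g Y Z"
  shows "AE \<omega> in M. solution_path \<xi> g Y Z \<omega>"
proof -
  have Z: "predictable (space M) T F Z"
    and 1: "AE \<omega> in M. set_integrable (\<nu> \<omega>) ({0<..T} \<times> UNIV) (\<lambda>(s, x). g \<omega> s x)"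
    and 2: "AE \<omega> in M. \<forall>t\<in>{0..T}.
       Y \<omega> t + set_lebesgue_integral (jump_measure T S X \<omega>) ({t<..T} \<times> UNIV) (\<lambda>(s, x). Z \<omega> s x) =
       \<xi> \<omega> + set_lebesgue_integral (\<nu> \<omega>) ({t<..T} \<times> UNIV) (\<lambda>(s, x). g \<omega> s x)"
    using assms unfolding bsde_solution_def by blast+
  show ?thesis using AE_regular AE_space 1 2
    by eventually_elim (auto simp: solution_path_def set_integral_jump_measure[OF Z])
qed

lemma solution_path_left_limit:
  assumes s: "solution_path \<xi> g Y Z \<omega>" and t: "t \<in> {0<..T}"
  defines "v \<equiv> Y \<omega> 0 - set_lebesgue_integral (\<nu> \<omega>) ({0<..t} \<times> UNIV) (\<lambda>(s, x). g \<omega> s x) +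
     (\<Sum>n\<in>{n\<in>jumps \<omega>. \<tau> n \<omega> < t}. Z \<omega> (\<tau> n \<omega>) (X n \<omega>))"
  shows "left_version T (Y \<omega>) t = v" "left_limit (Y \<omega>) t = v"
    and "t \<notin> (\<lambda>n. \<tau> n \<omega>) ` jumps \<omega> \<Longrightarrow> Y \<omega> t = v"
proof -
  have r: "regular \<omega>" and w: "\<omega> \<in> space M" using s by (auto simp: solution_path_def regular_def)
  note p = bsde_path[OF sets_nu[OF w] emeasure_nu_singleton[OF r] _ finite_jumps[OF w],
      of T "\<lambda>(s, x). g \<omega> s x" "\<lambda>n. \<tau> n \<omega>" "Y \<omega>" "\<lambda>n. Z \<omega> (\<tau> n \<omega>) (X n \<omega>)" "\<xi> \<omega>"]
  have sub: "(\<lambda>n. \<tau> n \<omega>) ` jumps \<omega> \<subseteq> {0<..T}" using jump_time(2)[OF w] by auto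
  have lim: "(Y \<omega> \<longlongrightarrow> v) (at_left t)" unfolding v_def
    using s t sub T_pos unfolding solution_path_def by (intro p(3)) auto
  show "left_version T (Y \<omega>) t = v" using left_version_eq[OF T_pos t lim] .
  show "left_limit (Y \<omega>) t = v" unfolding left_limit_def
    using lim by (intro tendsto_Lim) (auto simp: trivial_limit_at_left_real)
  assume "t \<notin> (\<lambda>n. \<tau> n \<omega>) ` jumps \<omega>"
  then have "{n\<in>jumps \<omega>. \<tau> n \<omega> \<le> t} = {n\<in>jumps \<omega>. \<tau> n \<omega> < t}" by (force simp: order_le_less)
  then show "Y \<omega> t = v" unfolding v_def
    using s t sub T_pos p(1)[of t] unfolding solution_path_def by auto
qed

lemma AE_nu_off_jumps:
  assumes r: "regular \<omega>"
  shows "AE z in \<nu> \<omega>. fst z \<in> {0<..T} \<longrightarrow> fst z \<notin> (\<lambda>n. \<tau> n \<omega>) ` jumps \<omega>"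
proof -
  have w: "\<omega> \<in> space M" using r by (simp add: regular_def)
  have "AE z in \<nu> \<omega>. \<forall>n\<in>jumps \<omega>. z \<notin> {\<tau> n \<omega>} \<times> UNIV"
  proof (intro AE_finite_allI finite_jumps[OF w] AE_not_in)
    fix n assume n: "n \<in> jumps \<omega>"
    have "{\<tau> n \<omega>} \<times> (UNIV :: 'k set) \<in> sets (\<nu> \<omega>)" unfolding sets_nu[OF w] by (intro pair_measureI) auto
    then show "{\<tau> n \<omega>} \<times> UNIV \<in> null_sets (\<nu> \<omega>)"
      using emeasure_nu_singleton[OF r jump_time(2)[OF w n]] by auto
  qed
  then show ?thesis by eventually_elim auto
qed

text \<open>A path jumps at finitely many times and \<open>\<nu> \<omega>\<close> has no atoms in time, so under \<open>\<nu> \<omega>\<close> the solution, its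
left limit and the predictable version may be exchanged for one another.\<close>

lemma AE_nu_left_version:
  assumes s: "solution_path \<xi> g Y Z \<omega>"
  shows "AE z in \<nu> \<omega>. fst z \<in> {0<..T} \<longrightarrow>
    Y \<omega> (fst z) = left_version T (Y \<omega>) (fst z) \<and> left_limit (Y \<omega>) (fst z) = left_version T (Y \<omega>) (fst z)"
proof -
  have "regular \<omega>" using s by (simp add: solution_path_def)
  from AE_nu_off_jumps[OF this] show ?thesis
    by eventually_elim (use solution_path_left_limit[OF s] in auto)
qed

text \<open>Both solutions jump at the same times, so their difference is driven by the differences of the controls
and of the drivers, and the deterministic energy inequality applies to it.\<close>

lemma difference_energy:
  assumes s1: "solution_path \<xi>1 g1 Y1 Z1 \<omega>" and s2: "solution_path \<xi>2 g2 Y2 Z2 \<omega>"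
    and p: "p > 1" and \<beta>: "\<beta> \<ge> 0"
  defines "v \<equiv> \<lambda>t. left_version T (Y1 \<omega>) t - left_version T (Y2 \<omega>) t"
  shows "ennreal \<beta> * (\<integral>\<^sup>+z\<in>{0<..T} \<times> UNIV. ennreal (\<bar>v (fst z)\<bar> powr p * exp (\<beta> * A \<omega> (fst z))) \<partial>\<nu> \<omega>) +
      (\<Sum>n\<in>jumps \<omega>. ennreal (\<bar>v (\<tau> n \<omega>) + (Z1 \<omega> (\<tau> n \<omega>) (X n \<omega>) - Z2 \<omega> (\<tau> n \<omega>) (X n \<omega>))\<bar> powr p * exp (\<beta> * A \<omega> (\<tau> n \<omega>))))
    \<le> ennreal (\<bar>\<xi>1 \<omega> - \<xi>2 \<omega>\<bar> powr p * exp (\<beta> * A \<omega> T)) +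
      (\<Sum>n\<in>jumps \<omega>. ennreal (\<bar>v (\<tau> n \<omega>)\<bar> powr p * exp (\<beta> * A \<omega> (\<tau> n \<omega>)))) +
      (\<integral>\<^sup>+z\<in>{0<..T} \<times> UNIV. ennreal (p * \<bar>v (fst z)\<bar> powr (p - 1) *
         \<bar>g1 \<omega> (fst z) (snd z) - g2 \<omega> (fst z) (snd z)\<bar> * exp (\<beta> * A \<omega> (fst z))) \<partial>\<nu> \<omega>)"
proof -
  have r: "regular \<omega>" and w: "\<omega> \<in> space M" using s1 by (auto simp: solution_path_def regular_def)
  have mono: "mono_on {0..T} (A \<omega>)" using r unfolding regular_def by blast
  have g1: "set_integrable (\<nu> \<omega>) ({0<..T} \<times> UNIV) (\<lambda>(s, x). g1 \<omega> s x)"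
    and g2: "set_integrable (\<nu> \<omega>) ({0<..T} \<times> UNIV) (\<lambda>(s, x). g2 \<omega> s x)"
    using s1 s2 by (auto simp: solution_path_def)
  have m: "{a<..b::real} \<times> (UNIV :: 'k set) \<in> sets (\<nu> \<omega>)" for a b
    unfolding sets_nu[OF w] by (intro pair_measureI) auto
  let ?g = "\<lambda>z. (case z of (s, x) \<Rightarrow> g1 \<omega> s x) - (case z of (s, x) \<Rightarrow> g2 \<omega> s x)"
  have g: "set_integrable (\<nu> \<omega>) ({0<..T} \<times> UNIV) ?g" using g1 g2 by (rule set_integral_diff)
  have gI: "set_lebesgue_integral (\<nu> \<omega>) ({0<..t} \<times> UNIV) ?g =
      set_lebesgue_integral (\<nu> \<omega>) ({0<..t} \<times> UNIV) (\<lambda>(s, x). g1 \<omega> s x) -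
      set_lebesgue_integral (\<nu> \<omega>) ({0<..t} \<times> UNIV) (\<lambda>(s, x). g2 \<omega> s x)" if "t \<le> T" for t
    by (intro set_integral_diff set_integrable_subset[OF g1 m] set_integrable_subset[OF g2 m]) (use that in auto)
  have sub: "(\<lambda>n. \<tau> n \<omega>) ` jumps \<omega> \<subseteq> {0<..T}" using jump_time(2)[OF w] by auto
  have fin: "\<xi>' \<omega> = Y \<omega> 0 - set_lebesgue_integral (\<nu> \<omega>) ({0<..T} \<times> UNIV) (\<lambda>(s, x). g' \<omega> s x) +
      (\<Sum>n\<in>jumps \<omega>. Z \<omega> (\<tau> n \<omega>) (X n \<omega>))" if s: "solution_path \<xi>' g' Y Z \<omega>" for \<xi>' g' Y Z
    using s sub T_pos unfolding solution_path_def
    by (intro bsde_path(2)[OF sets_nu[OF w] emeasure_nu_singleton[OF r] _ finite_jumps[OF w],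
      of T "\<lambda>(s, x). g' \<omega> s x" "\<lambda>n. \<tau> n \<omega>" "Y \<omega>" "\<lambda>n. Z \<omega> (\<tau> n \<omega>) (X n \<omega>)" "\<xi>' \<omega>"]) auto
  have "ennreal \<beta> * (\<integral>\<^sup>+z\<in>{0<..T} \<times> UNIV. ennreal (\<bar>v (fst z)\<bar> powr p * exp (\<beta> * A \<omega> (fst z))) \<partial>\<nu> \<omega>) +
      (\<Sum>n\<in>jumps \<omega>. ennreal (\<bar>v (\<tau> n \<omega>) + (Z1 \<omega> (\<tau> n \<omega>) (X n \<omega>) - Z2 \<omega> (\<tau> n \<omega>) (X n \<omega>))\<bar> powr p * exp (\<beta> * A \<omega> (\<tau> n \<omega>))))
    \<le> ennreal (\<bar>\<xi>1 \<omega> - \<xi>2 \<omega>\<bar> powr p * exp (\<beta> * A \<omega> T)) +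
      (\<Sum>n\<in>jumps \<omega>. ennreal (\<bar>v (\<tau> n \<omega>)\<bar> powr p * exp (\<beta> * A \<omega> (\<tau> n \<omega>)))) +
      (\<integral>\<^sup>+z\<in>{0<..T} \<times> UNIV. ennreal (p * \<bar>v (fst z)\<bar> powr (p - 1) * \<bar>?g z\<bar> * exp (\<beta> * A \<omega> (fst z))) \<partial>\<nu> \<omega>)"
  proof (rule lp_energy_inequality[OF sets_nu[OF w] emeasure_nu_singleton[OF r] _ _ g finite_jumps[OF w]
        strict_mono_jump_times[OF w] sub _ p \<beta>, where ?y0.0 = "Y1 \<omega> 0 - Y2 \<omega> 0"])
    show "emeasure (\<nu> \<omega>) ({0<..t} \<times> UNIV) = ennreal (A \<omega> t - A \<omega> 0)" if "t \<in> {0..T}" for t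
      using that by (intro emeasure_nu_Ioc[OF r]) auto
    show "A \<omega> 0 \<le> A \<omega> t" if "t \<in> {0..T}" for t
      using that T_pos by (intro mono_onD[OF mono]) auto
    show "v t = Y1 \<omega> 0 - Y2 \<omega> 0 - set_lebesgue_integral (\<nu> \<omega>) ({0<..t} \<times> UNIV) ?g +
      (\<Sum>n\<in>{n\<in>jumps \<omega>. \<tau> n \<omega> < t}. Z1 \<omega> (\<tau> n \<omega>) (X n \<omega>) - Z2 \<omega> (\<tau> n \<omega>) (X n \<omega>))" if t: "t \<in> {0<..T}" for t
    proof -
      have "set_lebesgue_integral (\<nu> \<omega>) ({0<..t} \<times> UNIV) ?g =
        set_lebesgue_integral (\<nu> \<omega>) ({0<..t} \<times> UNIV) (\<lambda>(s, x). g1 \<omega> s x) -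
        set_lebesgue_integral (\<nu> \<omega>) ({0<..t} \<times> UNIV) (\<lambda>(s, x). g2 \<omega> s x)" using gI t by simp
      then show ?thesis
        unfolding v_def sum_subtractf solution_path_left_limit(1)[OF s1 t] solution_path_left_limit(1)[OF s2 t] by simp
    qed
    show "\<xi>1 \<omega> - \<xi>2 \<omega> = Y1 \<omega> 0 - Y2 \<omega> 0 - set_lebesgue_integral (\<nu> \<omega>) ({0<..T} \<times> UNIV) ?g +
      (\<Sum>n\<in>jumps \<omega>. Z1 \<omega> (\<tau> n \<omega>) (X n \<omega>) - Z2 \<omega> (\<tau> n \<omega>) (X n \<omega>))"
      unfolding gI[OF order_refl] fin[OF s1] fin[OF s2] by (simp add: sum_subtractf)
  qed (use T_pos in auto)
  then show ?thesis by (simp add: case_prod_beta')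
qed

section \<open>The driver\<close>

text \<open>Young's inequality applied to the second Lipschitz condition. A constant \<open>K > 0\<close> is used in place of \<open>L\<close>:
when \<open>\<zeta> - \<zeta>'\<close> is not in \<open>L\<^sup>p\<close> the Lipschitz condition is void, and the right-hand side is infinite only
if the coefficient of its last term is positive.\<close>

lemma driver_lipschitz_Young:
  assumes H: "hypothesis_H M T F \<nu> A \<phi> p \<beta> L L' \<xi> f"
    and w: "\<omega> \<in> space M" and t: "t \<in> {0..T}"
    and \<zeta>: "\<zeta> \<in> borel_measurable borel" "\<zeta>' \<in> borel_measurable borel"
    and meas: "(\<lambda>x. f \<omega> t x y \<zeta> - f \<omega> t x y \<zeta>') \<in> borel_measurable borel"
    and u: "u \<ge> 0" and \<delta>: "\<delta> > 0" and K: "L \<le> K" "0 < K"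
  shows "(\<integral>\<^sup>+x. ennreal (p * u powr (p - 1) * \<bar>f \<omega> t x y \<zeta> - f \<omega> t x y \<zeta>'\<bar>) \<partial>\<phi> \<omega> t)
    \<le> (\<integral>\<^sup>+x. ennreal ((p - 1) * \<delta> * u powr p + \<delta> powr (1 - p) * K powr p * \<bar>\<zeta> x - \<zeta>' x\<bar> powr p) \<partial>\<phi> \<omega> t)"
proof -
  interpret \<phi>: prob_space "\<phi> \<omega> t" by (rule \<phi>_prob[OF w t])
  have [measurable_cong]: "sets (\<phi> \<omega> t) = sets borel" by (rule \<phi>_sets[OF w t])
  note [measurable] = \<zeta> meas
  have p: "p > 1" and L: "L \<ge> 0" using H by (auto simp: hypothesis_H_def)
  define k where "k = \<delta> powr (1 - p) * K powr p"
  have k: "k > 0" using \<delta> K by (simp add: k_def)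
  have rhs: "(\<integral>\<^sup>+x. ennreal ((p - 1) * \<delta> * u powr p + k * \<bar>\<zeta> x - \<zeta>' x\<bar> powr p) \<partial>\<phi> \<omega> t) =
    ennreal ((p - 1) * \<delta> * u powr p) + ennreal k * (\<integral>\<^sup>+x. ennreal (\<bar>\<zeta> x - \<zeta>' x\<bar> powr p) \<partial>\<phi> \<omega> t)"
  proof -
    have "(\<integral>\<^sup>+x. ennreal ((p - 1) * \<delta> * u powr p + k * \<bar>\<zeta> x - \<zeta>' x\<bar> powr p) \<partial>\<phi> \<omega> t) =
      (\<integral>\<^sup>+x. ennreal ((p - 1) * \<delta> * u powr p) + ennreal k * ennreal (\<bar>\<zeta> x - \<zeta>' x\<bar> powr p) \<partial>\<phi> \<omega> t)"
      using p \<delta> k by (intro nn_integral_cong) (simp add: ennreal_mult)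
    also have "\<dots> = ennreal ((p - 1) * \<delta> * u powr p) + ennreal k * (\<integral>\<^sup>+x. ennreal (\<bar>\<zeta> x - \<zeta>' x\<bar> powr p) \<partial>\<phi> \<omega> t)"
      by (subst nn_integral_add) (auto simp: nn_integral_cmult \<phi>.emeasure_space_1)
    finally show ?thesis .
  qed
  show ?thesis
  proof (cases "(\<integral>\<^sup>+x. ennreal (\<bar>\<zeta> x - \<zeta>' x\<bar> powr p) \<partial>\<phi> \<omega> t) = \<infinity>")
    case True
    then show ?thesis unfolding k_def[symmetric] rhs using k by (simp add: ennreal_mult_top)
  next
    case False
    have int: "integrable (\<phi> \<omega> t) (\<lambda>x. \<bar>\<zeta>' x - \<zeta> x\<bar> powr p)"
      using False by (intro integrableI_bounded) (auto simp: less_top abs_minus_commute)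
    define I where "I = (\<integral>x. \<bar>\<zeta>' x - \<zeta> x\<bar> powr p \<partial>\<phi> \<omega> t)"
    have I0: "I \<ge> 0" unfolding I_def by (intro integral_nonneg_AE) auto
    have I: "(\<integral>\<^sup>+x. ennreal (\<bar>\<zeta> x - \<zeta>' x\<bar> powr p) \<partial>\<phi> \<omega> t) = ennreal I"
      unfolding I_def using int by (subst nn_integral_eq_integral[symmetric]) (auto simp: abs_minus_commute)
    have lip: "(\<integral>\<^sup>+x. ennreal \<bar>f \<omega> t x y \<zeta> - f \<omega> t x y \<zeta>'\<bar> \<partial>\<phi> \<omega> t) \<le> ennreal (L * I powr (1 / p))"
      unfolding I_def using H w t \<zeta> int unfolding hypothesis_H_def by blast
    have "(\<integral>\<^sup>+x. ennreal (p * u powr (p - 1) * \<bar>f \<omega> t x y \<zeta> - f \<omega> t x y \<zeta>'\<bar>) \<partial>\<phi> \<omega> t) =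
      ennreal (p * u powr (p - 1)) * (\<integral>\<^sup>+x. ennreal \<bar>f \<omega> t x y \<zeta> - f \<omega> t x y \<zeta>'\<bar> \<partial>\<phi> \<omega> t)"
      using p by (subst nn_integral_cmult[symmetric]) (auto simp: ennreal_mult[symmetric])
    also have "\<dots> \<le> ennreal (p * u powr (p - 1)) * ennreal (L * I powr (1 / p))"
      by (intro mult_left_mono lip) simp
    also have "\<dots> = ennreal (p * u powr (p - 1) * (L * I powr (1 / p)))"
      using p L by (subst ennreal_mult) auto
    also have "\<dots> \<le> ennreal (p * u powr (p - 1) * (K * I powr (1 / p)))"
      using p K by (intro ennreal_leI mult_left_mono mult_right_mono) auto
    also have "\<dots> \<le> ennreal ((p - 1) * \<delta> * u powr p + \<delta> powr (1 - p) * (K * I powr (1 / p)) powr p)"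
      using Young_powr[OF p \<delta> u, of "K * I powr (1 / p)"] K by (intro ennreal_leI) auto
    also have "(K * I powr (1 / p)) powr p = K powr p * I"
      using K p I0 by (simp add: powr_mult powr_powr)
    also have "ennreal ((p - 1) * \<delta> * u powr p + \<delta> powr (1 - p) * (K powr p * I)) =
      ennreal ((p - 1) * \<delta> * u powr p) + ennreal k * ennreal I"
      using p \<delta> k I0 by (simp add: ennreal_mult[symmetric] k_def mult.assoc)
    finally show ?thesis unfolding k_def[symmetric] rhs I .
  qed
qed

text \<open>The form in which the driver enters the energy estimate, for one fixed time: \<open>c\<close> is the indicator that the
time lies after \<open>S\<^sub>m\<close> and \<open>e\<close> the exponential weight.\<close>

lemma driver_bound:
  assumes H: "hypothesis_H M T F \<nu> A \<phi> p \<beta> L L' \<xi> f"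
    and w: "\<omega> \<in> space M" and t: "t \<in> {0..T}"
    and \<zeta>: "\<zeta> \<in> borel_measurable borel" "\<zeta>' \<in> borel_measurable borel"
    and meas: "(\<lambda>x. f \<omega> t x y' \<zeta> - f \<omega> t x y' \<zeta>') \<in> borel_measurable borel"
      "(\<lambda>x. f \<omega> t x 0 (\<lambda>_. 0)) \<in> borel_measurable borel"
    and \<delta>: "\<delta> > 0" "\<delta>' > 0" and K: "L \<le> K" "0 < K" and c: "c = 0 \<or> c = 1" and e: "e \<ge> 0"
  shows "(\<integral>\<^sup>+x. ennreal (p * \<bar>y - y'\<bar> powr (p - 1) * (\<bar>f \<omega> t x y \<zeta> - f \<omega> t x y' \<zeta>'\<bar> + c * \<bar>f \<omega> t x 0 (\<lambda>_. 0)\<bar>) * e) \<partial>\<phi> \<omega> t)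
    \<le> (\<integral>\<^sup>+x. ennreal (((p * L' + (p - 1) * \<delta> + (p - 1) * \<delta>') * \<bar>y - y'\<bar> powr p +
        \<delta> powr (1 - p) * K powr p * \<bar>\<zeta> x - \<zeta>' x\<bar> powr p + \<delta>' powr (1 - p) * (c * \<bar>f \<omega> t x 0 (\<lambda>_. 0)\<bar> powr p)) * e) \<partial>\<phi> \<omega> t)"
proof -
  have [measurable_cong]: "sets (\<phi> \<omega> t) = sets borel" by (rule \<phi>_sets[OF w t])
  note [measurable] = \<zeta> meas
  have p: "p > 1" and L: "L' \<ge> 0" using H by (auto simp: hypothesis_H_def)
  define u where "u = \<bar>y - y'\<bar>"
  have u: "u \<ge> 0" by (simp add: u_def)
  let ?f0 = "\<lambda>x. f \<omega> t x 0 (\<lambda>_. 0)"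
  let ?d = "\<lambda>x. f \<omega> t x y' \<zeta> - f \<omega> t x y' \<zeta>'"
  define q where "q x = ((p * L' + (p - 1) * \<delta>') * u powr p + \<delta>' powr (1 - p) * (c * \<bar>?f0 x\<bar> powr p)) * e" for x
  have q0: "q x \<ge> 0" for x unfolding q_def using p L \<delta> c e by auto
  have qm[measurable]: "q \<in> borel_measurable borel" unfolding q_def[abs_def] by measurable
  have ptw: "p * u powr (p - 1) * (\<bar>f \<omega> t x y \<zeta> - f \<omega> t x y' \<zeta>'\<bar> + c * \<bar>?f0 x\<bar>) * e
      \<le> q x + (p * u powr (p - 1) * \<bar>?d x\<bar>) * e" for x
  proof -
    have "\<bar>f \<omega> t x y \<zeta> - f \<omega> t x y' \<zeta>\<bar> \<le> L' * u"
      using H w t \<zeta> unfolding hypothesis_H_def u_def by blast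
    then have "\<bar>f \<omega> t x y \<zeta> - f \<omega> t x y' \<zeta>'\<bar> \<le> L' * u + \<bar>?d x\<bar>" by linarith
    then have "p * u powr (p - 1) * (\<bar>f \<omega> t x y \<zeta> - f \<omega> t x y' \<zeta>'\<bar> + c * \<bar>?f0 x\<bar>)
      \<le> p * u powr (p - 1) * (L' * u + \<bar>?d x\<bar> + c * \<bar>?f0 x\<bar>)"
      using p by (intro mult_left_mono) auto
    also have "\<dots> = p * L' * (u powr (p - 1) * u) + p * u powr (p - 1) * \<bar>?d x\<bar> + p * u powr (p - 1) * (c * \<bar>?f0 x\<bar>)"
      by (simp add: algebra_simps)
    also have "u powr (p - 1) * u = u powr p"
      using u p by (cases "u = 0") (auto simp: powr_diff)
    also have "p * u powr (p - 1) * (c * \<bar>?f0 x\<bar>) \<le> (p - 1) * \<delta>' * u powr p + \<delta>' powr (1 - p) * (c * \<bar>?f0 x\<bar>) powr p"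
      using c by (intro Young_powr p \<delta> u) auto
    also have "(c * \<bar>?f0 x\<bar>) powr p = c * \<bar>?f0 x\<bar> powr p" using c p by auto
    finally have "p * u powr (p - 1) * (\<bar>f \<omega> t x y \<zeta> - f \<omega> t x y' \<zeta>'\<bar> + c * \<bar>?f0 x\<bar>) \<le>
      p * L' * u powr p + p * u powr (p - 1) * \<bar>?d x\<bar> + ((p - 1) * \<delta>' * u powr p + \<delta>' powr (1 - p) * (c * \<bar>?f0 x\<bar> powr p))"
      by simp
    from mult_right_mono[OF this e] show ?thesis by (simp add: q_def algebra_simps)
  qed
  have "(\<integral>\<^sup>+x. ennreal (p * u powr (p - 1) * (\<bar>f \<omega> t x y \<zeta> - f \<omega> t x y' \<zeta>'\<bar> + c * \<bar>?f0 x\<bar>) * e) \<partial>\<phi> \<omega> t)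
    \<le> (\<integral>\<^sup>+x. ennreal (q x) + ennreal e * ennreal (p * u powr (p - 1) * \<bar>?d x\<bar>) \<partial>\<phi> \<omega> t)"
  proof (intro nn_integral_mono)
    fix x
    have "ennreal (p * u powr (p - 1) * (\<bar>f \<omega> t x y \<zeta> - f \<omega> t x y' \<zeta>'\<bar> + c * \<bar>?f0 x\<bar>) * e) \<le> ennreal (q x + e * (p * u powr (p - 1) * \<bar>?d x\<bar>))"
      using ptw[of x] by (intro ennreal_leI) (simp add: mult.commute)
    also have "\<dots> = ennreal (q x) + ennreal e * ennreal (p * u powr (p - 1) * \<bar>?d x\<bar>)"
      using q0[of x] e p by (simp add: ennreal_mult[symmetric])
    finally show "ennreal (p * u powr (p - 1) * (\<bar>f \<omega> t x y \<zeta> - f \<omega> t x y' \<zeta>'\<bar> + c * \<bar>?f0 x\<bar>) * e) \<le> \<dots>" .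
  qed
  also have "\<dots> = (\<integral>\<^sup>+x. ennreal (q x) \<partial>\<phi> \<omega> t) + ennreal e * (\<integral>\<^sup>+x. ennreal (p * u powr (p - 1) * \<bar>?d x\<bar>) \<partial>\<phi> \<omega> t)"
    by (subst nn_integral_add) (auto simp: nn_integral_cmult)
  also have "\<dots> \<le> (\<integral>\<^sup>+x. ennreal (q x) \<partial>\<phi> \<omega> t) + ennreal e *
     (\<integral>\<^sup>+x. ennreal ((p - 1) * \<delta> * u powr p + \<delta> powr (1 - p) * K powr p * \<bar>\<zeta> x - \<zeta>' x\<bar> powr p) \<partial>\<phi> \<omega> t)"
    by (intro add_left_mono mult_left_mono driver_lipschitz_Young[OF H w t \<zeta> meas(1) u \<delta>(1) K]) simp
  also have "\<dots> = (\<integral>\<^sup>+x. ennreal (q x) + ennreal e * ennreal ((p - 1) * \<delta> * u powr p + \<delta> powr (1 - p) * K powr p * \<bar>\<zeta> x - \<zeta>' x\<bar> powr p) \<partial>\<phi> \<omega> t)"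
    by (subst nn_integral_add) (auto simp: nn_integral_cmult)
  also have "\<dots> = (\<integral>\<^sup>+x. ennreal (((p * L' + (p - 1) * \<delta> + (p - 1) * \<delta>') * u powr p +
        \<delta> powr (1 - p) * K powr p * \<bar>\<zeta> x - \<zeta>' x\<bar> powr p + \<delta>' powr (1 - p) * (c * \<bar>?f0 x\<bar> powr p)) * e) \<partial>\<phi> \<omega> t)"
  proof (intro nn_integral_cong)
    fix x
    have "ennreal (q x) + ennreal e * ennreal ((p - 1) * \<delta> * u powr p + \<delta> powr (1 - p) * K powr p * \<bar>\<zeta> x - \<zeta>' x\<bar> powr p) =
      ennreal (q x + e * ((p - 1) * \<delta> * u powr p + \<delta> powr (1 - p) * K powr p * \<bar>\<zeta> x - \<zeta>' x\<bar> powr p))"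
    proof -
      have r0: "0 \<le> (p - 1) * \<delta> * u powr p + \<delta> powr (1 - p) * K powr p * \<bar>\<zeta> x - \<zeta>' x\<bar> powr p"
        using p \<delta> by simp
      show ?thesis unfolding ennreal_mult[OF e r0, symmetric]
        by (rule ennreal_plus[symmetric, OF q0 mult_nonneg_nonneg[OF e r0]])
    qed
    also have "q x + e * ((p - 1) * \<delta> * u powr p + \<delta> powr (1 - p) * K powr p * \<bar>\<zeta> x - \<zeta>' x\<bar> powr p) =
      ((p * L' + (p - 1) * \<delta> + (p - 1) * \<delta>') * u powr p +
        \<delta> powr (1 - p) * K powr p * \<bar>\<zeta> x - \<zeta>' x\<bar> powr p + \<delta>' powr (1 - p) * (c * \<bar>?f0 x\<bar> powr p)) * e"
      by (simp add: q_def algebra_simps)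
    finally show "ennreal (q x) + ennreal e * ennreal ((p - 1) * \<delta> * u powr p + \<delta> powr (1 - p) * K powr p * \<bar>\<zeta> x - \<zeta>' x\<bar> powr p) =
      ennreal (((p * L' + (p - 1) * \<delta> + (p - 1) * \<delta>') * u powr p +
        \<delta> powr (1 - p) * K powr p * \<bar>\<zeta> x - \<zeta>' x\<bar> powr p + \<delta>' powr (1 - p) * (c * \<bar>?f0 x\<bar> powr p)) * e)" .
  qed
  finally show ?thesis unfolding u_def .
qed

section \<open>The energy estimate for the truncated equation\<close>

text \<open>Processes evaluated at \<open>u = ((\<omega>, t), x)\<close>, the argument of predictable integrands.\<close>

abbreviation lv :: "('w \<Rightarrow> real \<Rightarrow> real) \<Rightarrow> ('w \<times> real) \<times> 'k \<Rightarrow> real" where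
  "lv Y u \<equiv> left_version T (Y (fst (fst u))) (snd (fst u))"

abbreviation at_mark :: "('w \<Rightarrow> real \<Rightarrow> 'k \<Rightarrow> real) \<Rightarrow> ('w \<times> real) \<times> 'k \<Rightarrow> real" where
  "at_mark Z u \<equiv> Z (fst (fst u)) (snd (fst u)) (snd u)"

abbreviation weight :: "real \<Rightarrow> ('w \<times> real) \<times> 'k \<Rightarrow> real" where
  "weight \<beta> u \<equiv> exp (\<beta> * A (fst (fst u)) (snd (fst u)))"

lemma predictable_at_mark: "predictable (space M) T F Z \<Longrightarrow> at_mark Z \<in> borel_measurable (Pr \<Otimes>\<^sub>M borel)"
  unfolding predictable_def by (simp add: case_prod_beta')

lemma Lp_beta_finite:
  assumes Lp: "(Y, Z) \<in> Lp_beta M T F \<nu> A p \<beta>"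
    and sol: "bsde_solution M T F (jump_measure T S X) \<nu> \<xi> g Y Z"
  shows "(\<integral>\<^sup>+\<omega>. nu_int (\<lambda>u. ennreal (\<bar>lv Y u\<bar> powr p * weight \<beta> u)) \<omega> \<partial>M) < \<infinity>"
    and "(\<integral>\<^sup>+\<omega>. nu_int (\<lambda>u. ennreal (\<bar>at_mark Z u\<bar> powr p * weight \<beta> u)) \<omega> \<partial>M) < \<infinity>"
proof -
  let ?n = "\<integral>\<^sup>+\<omega>. (\<integral>\<^sup>+z\<in>{0<..T} \<times> UNIV.
        ennreal ((\<bar>Y \<omega> (fst z)\<bar> powr p + \<bar>Z \<omega> (fst z) (snd z)\<bar> powr p) * exp (\<beta> * A \<omega> (fst z)))
      \<partial>\<nu> \<omega>) \<partial>M"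
  have fin: "?n < \<infinity>" using Lp unfolding Lp_beta_def by blast
  have "(\<integral>\<^sup>+\<omega>. nu_int (\<lambda>u. ennreal (\<bar>lv Y u\<bar> powr p * weight \<beta> u)) \<omega> \<partial>M) \<le> ?n"
  proof (intro nn_integral_mono_AE, use AE_solution_path[OF sol] in eventually_elim)
    fix \<omega> assume s: "solution_path \<xi> g Y Z \<omega>"
    show "nu_int (\<lambda>u. ennreal (\<bar>lv Y u\<bar> powr p * weight \<beta> u)) \<omega> \<le> (\<integral>\<^sup>+z\<in>{0<..T} \<times> UNIV.
        ennreal ((\<bar>Y \<omega> (fst z)\<bar> powr p + \<bar>Z \<omega> (fst z) (snd z)\<bar> powr p) * exp (\<beta> * A \<omega> (fst z))) \<partial>\<nu> \<omega>)"
      by (intro nn_integral_mono_AE, use AE_nu_left_version[OF s] in eventually_elim)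
        (auto simp: indicator_def intro!: ennreal_leI)
  qed
  then show "(\<integral>\<^sup>+\<omega>. nu_int (\<lambda>u. ennreal (\<bar>lv Y u\<bar> powr p * weight \<beta> u)) \<omega> \<partial>M) < \<infinity>"
    using fin by (rule le_less_trans)
  have "(\<integral>\<^sup>+\<omega>. nu_int (\<lambda>u. ennreal (\<bar>at_mark Z u\<bar> powr p * weight \<beta> u)) \<omega> \<partial>M) \<le> ?n"
    by (intro nn_integral_mono) (auto simp: indicator_def intro!: ennreal_leI)
  then show "(\<integral>\<^sup>+\<omega>. nu_int (\<lambda>u. ennreal (\<bar>at_mark Z u\<bar> powr p * weight \<beta> u)) \<omega> \<partial>M) < \<infinity>"
    using fin by (rule le_less_trans)
qed

lemma nu_expectation_diff_finite:
  fixes U V :: "('w \<times> real) \<times> 'k \<Rightarrow> real"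
  assumes m[measurable]: "U \<in> borel_measurable (Pr \<Otimes>\<^sub>M borel)" "V \<in> borel_measurable (Pr \<Otimes>\<^sub>M borel)"
    and fin: "(\<integral>\<^sup>+\<omega>. nu_int (\<lambda>u. ennreal (\<bar>U u\<bar> powr p * weight \<beta> u)) \<omega> \<partial>M) < \<infinity>"
      "(\<integral>\<^sup>+\<omega>. nu_int (\<lambda>u. ennreal (\<bar>V u\<bar> powr p * weight \<beta> u)) \<omega> \<partial>M) < \<infinity>"
    and p: "p > 0"
  shows "(\<integral>\<^sup>+\<omega>. nu_int (\<lambda>u. ennreal (\<bar>U u - V u\<bar> powr p * weight \<beta> u)) \<omega> \<partial>M) < \<infinity>"
proof -
  note [measurable] = predictable_A
  define HU where "HU u = ennreal (\<bar>U u\<bar> powr p * weight \<beta> u)" for u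
  define HV where "HV u = ennreal (\<bar>V u\<bar> powr p * weight \<beta> u)" for u
  have HU: "HU \<in> borel_measurable (Pr \<Otimes>\<^sub>M borel)" and HV: "HV \<in> borel_measurable (Pr \<Otimes>\<^sub>M borel)"
    unfolding HU_def[abs_def] HV_def[abs_def] by measurable
  have "(\<integral>\<^sup>+\<omega>. nu_int (\<lambda>u. ennreal (\<bar>U u - V u\<bar> powr p * weight \<beta> u)) \<omega> \<partial>M) \<le>
    (\<integral>\<^sup>+\<omega>. ennreal (2 powr p) * (nu_int HU \<omega> + nu_int HV \<omega>) \<partial>M)"
  proof (intro nn_integral_mono)
    fix \<omega> assume w: "\<omega> \<in> space M"
    have "nu_int (\<lambda>u. ennreal (\<bar>U u - V u\<bar> powr p * weight \<beta> u)) \<omega> \<le>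
      nu_int (\<lambda>u. ennreal (2 powr p) * (HU u + HV u)) \<omega>"
    proof (intro nn_integral_mono mult_right_mono)
      fix z :: "real \<times> 'k"
      let ?u = "((\<omega>, fst z), snd z)"
      have "\<bar>U ?u - V ?u\<bar> powr p * weight \<beta> ?u \<le> 2 powr p * (\<bar>U ?u\<bar> powr p + \<bar>V ?u\<bar> powr p) * weight \<beta> ?u"
        using p by (intro mult_right_mono abs_diff_powr_le) auto
      then have "ennreal (\<bar>U ?u - V ?u\<bar> powr p * weight \<beta> ?u) \<le>
          ennreal (2 powr p * (\<bar>U ?u\<bar> powr p * weight \<beta> ?u + \<bar>V ?u\<bar> powr p * weight \<beta> ?u))"
        by (intro ennreal_leI) (simp add: algebra_simps)
      also have "\<dots> = ennreal (2 powr p) * (HU ?u + HV ?u)"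
        by (simp add: HU_def HV_def ennreal_mult)
      finally show "ennreal (\<bar>U ?u - V ?u\<bar> powr p * weight \<beta> ?u) \<le> ennreal (2 powr p) * (HU ?u + HV ?u)" .
    qed simp
    also have "\<dots> = ennreal (2 powr p) * (nu_int HU \<omega> + nu_int HV \<omega>)"
      using HU HV by (subst nu_int_cmult[OF w]) (auto simp: nu_int_add[OF w])
    finally show "nu_int (\<lambda>u. ennreal (\<bar>U u - V u\<bar> powr p * weight \<beta> u)) \<omega> \<le> \<dots>" .
  qed
  also have "\<dots> = ennreal (2 powr p) * ((\<integral>\<^sup>+\<omega>. nu_int HU \<omega> \<partial>M) + (\<integral>\<^sup>+\<omega>. nu_int HV \<omega> \<partial>M))"
    using nu_int_measurable[OF HU] nu_int_measurable[OF HV] by (subst nn_integral_cmult) (auto simp: nn_integral_add)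
  also have "\<dots> < \<infinity>" using fin unfolding HU_def HV_def by (simp add: ennreal_mult_less_top)
  finally show ?thesis .
qed

text \<open>Up to \<open>S\<^sub>m\<close> both drivers are the same function, and the Lipschitz conditions apply to their difference.
After \<open>S\<^sub>m\<close> the truncated solution is 0, and the driver of the full equation is compared with \<open>f\<close> at
\<open>(0, 0)\<close>; this comparison is the source of the term with \<open>d\<close>.\<close>

lemma truncation_energy:
  assumes H: "hypothesis_H M T F \<nu> A \<phi> p \<beta> L L' \<xi> f" and m: "m \<ge> 1"
    and sol: "bsde_solution M T F (jump_measure T S X) \<nu> \<xi>
           (\<lambda>\<omega> s x. f \<omega> s x (left_limit (Y \<omega>) s) (Z \<omega> s)) Y Z"
    and sol': "bsde_solution M T F (jump_measure T S X) \<nu> \<xi>'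
           (\<lambda>\<omega> s x. f \<omega> s x (Y' \<omega> s) (Z' \<omega> s) * indicator {s. ennreal s \<le> S m \<omega>} s) Y' Z'"
    and Y0: "AE \<omega> in M. \<forall>s. S m \<omega> < ennreal s \<and> s \<le> T \<longrightarrow> Y' \<omega> s = 0"
    and Z0: "AE \<omega> in M. AE z in \<nu> \<omega>. S m \<omega> < ennreal (fst z) \<and> fst z \<le> T \<longrightarrow> Z' \<omega> (fst z) (snd z) = 0"
    and \<delta>: "\<delta> > 0" "\<delta>' > 0" and K: "L \<le> K" "0 < K"
  defines "a \<equiv> \<lambda>u. \<bar>lv Y u - lv Y' u\<bar> powr p * weight \<beta> u"
    and "b \<equiv> \<lambda>u. \<bar>at_mark Z u - at_mark Z' u\<bar> powr p * weight \<beta> u"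
    and "c \<equiv> \<lambda>u. \<bar>(lv Y u - lv Y' u) + (at_mark Z u - at_mark Z' u)\<bar> powr p * weight \<beta> u"
    and "d \<equiv> \<lambda>u. (if S m (fst (fst u)) < ennreal (snd (fst u))
      then \<bar>f (fst (fst u)) (snd (fst u)) (snd u) 0 (\<lambda>_. 0)\<bar> powr p * weight \<beta> u else 0)"
  shows "AE \<omega> in M. ennreal \<beta> * nu_int (\<lambda>u. ennreal (a u)) \<omega> + mu_int (\<lambda>u. ennreal (c u)) \<omega>
    \<le> ennreal (\<bar>\<xi> \<omega> - \<xi>' \<omega>\<bar> powr p * exp (\<beta> * A \<omega> T)) + mu_int (\<lambda>u. ennreal (a u)) \<omega> +
      nu_int (\<lambda>u. ennreal ((p * L' + (p - 1) * \<delta> + (p - 1) * \<delta>') * a u +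
        \<delta> powr (1 - p) * K powr p * b u + \<delta>' powr (1 - p) * d u)) \<omega>"
proof -
  have p: "p > 1" and \<beta>: "\<beta> > 0" using H by (auto simp: hypothesis_H_def)
  have Y: "adapted_process T F Y" and Z: "predictable (space M) T F Z"
    and Y': "adapted_process T F Y'" and Z': "predictable (space M) T F Z'"
    using sol sol' by (auto simp: bsde_solution_def)
  note [measurable] = predictable_A predictable_left_version[OF Y] predictable_left_version[OF Y']
    predictable_at_mark[OF Z] predictable_at_mark[OF Z'] predictable_after_S[OF m]
  \<comment> \<open>Setting the truncated solution to 0 after its time of truncation for every mark and time makes the
    driver estimate available at each single time; almost everywhere nothing changes.\<close>
  define Zt where "Zt \<omega> t x = (if S m \<omega> < ennreal t then 0 else Z' \<omega> t x)" for \<omega> t x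
  define vt where "vt u = (if S m (fst (fst u)) < ennreal (snd (fst u)) then 0 else lv Y' u)" for u :: "('w \<times> real) \<times> 'k"
  define cc where "cc u = (if S m (fst (fst u)) < ennreal (snd (fst u)) then 1 else 0 :: real)" for u :: "('w \<times> real) \<times> 'k"
  have Zt: "predictable (space M) T F Zt"
  proof -
    have "(\<lambda>u. if S m (fst (fst u)) < ennreal (snd (fst u)) then 0 else at_mark Z' u) \<in> borel_measurable (Pr \<Otimes>\<^sub>M borel)"
      by measurable
    then show ?thesis by (simp add: predictable_def case_prod_beta' Zt_def)
  qed
  have vt[measurable]: "vt \<in> borel_measurable (Pr \<Otimes>\<^sub>M borel)" unfolding vt_def[abs_def] by measurable
  have cc[measurable]: "cc \<in> borel_measurable (Pr \<Otimes>\<^sub>M borel)" unfolding cc_def[abs_def] by measurable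
  note [measurable] = predictable_at_mark[OF Zt]
  have zero: "predictable (space M) T F (\<lambda>_ _ _. 0)" by (simp add: predictable_def case_prod_beta')
  define f1 where "f1 u = f (fst (fst u)) (snd (fst u)) (snd u) (lv Y u) (Z (fst (fst u)) (snd (fst u)))" for u
  define f2 where "f2 u = f (fst (fst u)) (snd (fst u)) (snd u) (vt u) (Zt (fst (fst u)) (snd (fst u)))" for u
  define f3 where "f3 u = f (fst (fst u)) (snd (fst u)) (snd u) (vt u) (Z (fst (fst u)) (snd (fst u)))" for u
  define f0 where "f0 u = f (fst (fst u)) (snd (fst u)) (snd u) 0 (\<lambda>_. 0)" for u
  have fm[measurable]: "f1 \<in> borel_measurable (Pr \<Otimes>\<^sub>M borel)" "f2 \<in> borel_measurable (Pr \<Otimes>\<^sub>M borel)"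
    "f3 \<in> borel_measurable (Pr \<Otimes>\<^sub>M borel)" "f0 \<in> borel_measurable (Pr \<Otimes>\<^sub>M borel)"
    unfolding f1_def[abs_def] f2_def[abs_def] f3_def[abs_def] f0_def[abs_def]
    using predictable_driver[OF H Z predictable_left_version[OF Y]] predictable_driver[OF H Zt vt]
      predictable_driver[OF H Z vt] predictable_driver[OF H zero, of "\<lambda>_. 0"] by simp_all
  define k1 where "k1 = p * L' + (p - 1) * \<delta> + (p - 1) * \<delta>'"
  define k2 where "k2 = \<delta> powr (1 - p) * K powr p"
  define k3 where "k3 = \<delta>' powr (1 - p)"
  define h1 where "h1 u = ennreal (p * \<bar>lv Y u - vt u\<bar> powr (p - 1) * (\<bar>f1 u - f2 u\<bar> + cc u * \<bar>f0 u\<bar>) * weight \<beta> u)" for u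
  define h2 where "h2 u = ennreal ((k1 * \<bar>lv Y u - vt u\<bar> powr p + k2 * \<bar>at_mark Z u - at_mark Zt u\<bar> powr p +
    k3 * (cc u * \<bar>f0 u\<bar> powr p)) * weight \<beta> u)" for u
  have h1m: "h1 \<in> borel_measurable (Pr \<Otimes>\<^sub>M borel)" unfolding h1_def[abs_def] by measurable
  have h2m: "h2 \<in> borel_measurable (Pr \<Otimes>\<^sub>M borel)" unfolding h2_def[abs_def] by measurable
  have am: "(\<lambda>u. ennreal (a u)) \<in> borel_measurable (Pr \<Otimes>\<^sub>M borel)" unfolding a_def by measurable
  have cm: "(\<lambda>u. ennreal (c u)) \<in> borel_measurable (Pr \<Otimes>\<^sub>M borel)" unfolding c_def by measurable
  show ?thesis
    using AE_solution_path[OF sol] AE_solution_path[OF sol'] Y0 Z0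
  proof eventually_elim
    fix \<omega>
    let ?g = "\<lambda>\<omega> s x. f \<omega> s x (left_limit (Y \<omega>) s) (Z \<omega> s)"
    let ?g' = "\<lambda>\<omega> s x. f \<omega> s x (Y' \<omega> s) (Z' \<omega> s) * indicator {s. ennreal s \<le> S m \<omega>} s"
    assume s: "solution_path \<xi> ?g Y Z \<omega>" and s': "solution_path \<xi>' ?g' Y' Z' \<omega>"
      and y0: "\<forall>s. S m \<omega> < ennreal s \<and> s \<le> T \<longrightarrow> Y' \<omega> s = 0"
      and z0: "AE z in \<nu> \<omega>. S m \<omega> < ennreal (fst z) \<and> fst z \<le> T \<longrightarrow> Z' \<omega> (fst z) (snd z) = 0"
    have r: "regular \<omega>" and w: "\<omega> \<in> space M" using s by (auto simp: solution_path_def regular_def)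
    let ?drive = "\<integral>\<^sup>+z\<in>{0<..T} \<times> UNIV. ennreal (p * \<bar>left_version T (Y \<omega>) (fst z) - left_version T (Y' \<omega>) (fst z)\<bar> powr (p - 1) *
         \<bar>?g \<omega> (fst z) (snd z) - ?g' \<omega> (fst z) (snd z)\<bar> * exp (\<beta> * A \<omega> (fst z))) \<partial>\<nu> \<omega>"
    have energy: "ennreal \<beta> * nu_int (\<lambda>u. ennreal (a u)) \<omega> + mu_int (\<lambda>u. ennreal (c u)) \<omega>
      \<le> ennreal (\<bar>\<xi> \<omega> - \<xi>' \<omega>\<bar> powr p * exp (\<beta> * A \<omega> T)) + mu_int (\<lambda>u. ennreal (a u)) \<omega> + ?drive"
      using difference_energy[OF s s' p less_imp_le[OF \<beta>]]
      unfolding mu_int_eq[OF w am] mu_int_eq[OF w cm] by (simp add: a_def c_def)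
    have "?drive \<le> nu_int h1 \<omega>"
    proof (intro nn_integral_mono_AE, use AE_nu_left_version[OF s] AE_nu_left_version[OF s'] z0 in eventually_elim)
      fix z :: "real \<times> 'k"
      obtain t x where z: "z = (t, x)" by (cases z)
      assume 1: "fst z \<in> {0<..T} \<longrightarrow> Y \<omega> (fst z) = left_version T (Y \<omega>) (fst z) \<and> left_limit (Y \<omega>) (fst z) = left_version T (Y \<omega>) (fst z)"
        "fst z \<in> {0<..T} \<longrightarrow> Y' \<omega> (fst z) = left_version T (Y' \<omega>) (fst z) \<and> left_limit (Y' \<omega>) (fst z) = left_version T (Y' \<omega>) (fst z)"
        "S m \<omega> < ennreal (fst z) \<and> fst z \<le> T \<longrightarrow> Z' \<omega> (fst z) (snd z) = 0"
      show "ennreal (p * \<bar>left_version T (Y \<omega>) (fst z) - left_version T (Y' \<omega>) (fst z)\<bar> powr (p - 1) *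
         \<bar>?g \<omega> (fst z) (snd z) - ?g' \<omega> (fst z) (snd z)\<bar> * exp (\<beta> * A \<omega> (fst z))) * indicator ({0<..T} \<times> UNIV) z
        \<le> h1 ((\<omega>, fst z), snd z) * indicator ({0<..T} \<times> UNIV) z"
      proof (cases "t \<in> {0<..T}")
        case t: True
        show ?thesis
        proof (cases "S m \<omega> < ennreal t")
          case True
          then have v': "left_version T (Y' \<omega>) t = 0" using y0 1(2) t z by auto
          let ?f1 = "f \<omega> t x (left_version T (Y \<omega>) t) (Z \<omega> t)" and ?f0 = "f \<omega> t x 0 (\<lambda>_. 0)"
          have Zt0: "Zt \<omega> t = (\<lambda>_. 0)" using True by (simp add: Zt_def fun_eq_iff)
          have "p * \<bar>left_version T (Y \<omega>) t\<bar> powr (p - 1) * \<bar>?f1\<bar> * exp (\<beta> * A \<omega> t) \<le>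
            p * \<bar>left_version T (Y \<omega>) t\<bar> powr (p - 1) * (\<bar>?f1 - ?f0\<bar> + \<bar>?f0\<bar>) * exp (\<beta> * A \<omega> t)"
            using p by (intro mult_right_mono mult_left_mono) auto
          then show ?thesis using True t 1(1) z v'
            by (auto simp: h1_def vt_def cc_def f1_def f2_def f0_def Zt0 indicator_def intro!: ennreal_leI)
        next
          case False
          then have Zt0: "Zt \<omega> t = Z' \<omega> t" by (simp add: Zt_def fun_eq_iff)
          show ?thesis using False t 1(1,2) z
            by (auto simp: h1_def vt_def cc_def f1_def f2_def f0_def Zt0 indicator_def)
        qed
      qed (simp add: z)
    qed
    also have "nu_int h1 \<omega> \<le> nu_int h2 \<omega>"
    proof (rule nu_int_kernel_mono[OF r h1m h2m])
      fix t assume "t \<in> {0<..T}"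
      then have t: "t \<in> {0..T}" by auto
      define v' where "v' = (if S m \<omega> < ennreal t then 0 else left_version T (Y' \<omega>) t)"
      define c' where "c' = (if S m \<omega> < ennreal t then 1 else 0 :: real)"
      have "(\<integral>\<^sup>+x. ennreal (p * \<bar>left_version T (Y \<omega>) t - v'\<bar> powr (p - 1) *
          (\<bar>f \<omega> t x (left_version T (Y \<omega>) t) (Z \<omega> t) - f \<omega> t x v' (Zt \<omega> t)\<bar> + c' * \<bar>f \<omega> t x 0 (\<lambda>_. 0)\<bar>) * exp (\<beta> * A \<omega> t)) \<partial>\<phi> \<omega> t)
        \<le> (\<integral>\<^sup>+x. ennreal (((p * L' + (p - 1) * \<delta> + (p - 1) * \<delta>') * \<bar>left_version T (Y \<omega>) t - v'\<bar> powr p +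
          \<delta> powr (1 - p) * K powr p * \<bar>Z \<omega> t x - Zt \<omega> t x\<bar> powr p + \<delta>' powr (1 - p) * (c' * \<bar>f \<omega> t x 0 (\<lambda>_. 0)\<bar> powr p)) * exp (\<beta> * A \<omega> t)) \<partial>\<phi> \<omega> t)"
      proof (rule driver_bound[OF H w t _ _ _ _ \<delta> K])
        show "Z \<omega> t \<in> borel_measurable borel" "Zt \<omega> t \<in> borel_measurable borel"
          using mark_section_measurable[OF predictable_at_mark[OF Z] w t] mark_section_measurable[OF predictable_at_mark[OF Zt] w t]
          by simp_all
        show "(\<lambda>x. f \<omega> t x v' (Z \<omega> t) - f \<omega> t x v' (Zt \<omega> t)) \<in> borel_measurable borel"
          using mark_section_measurable[OF fm(3) w t] mark_section_measurable[OF fm(2) w t]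
          unfolding f3_def f2_def vt_def v'_def fst_conv snd_conv by (rule borel_measurable_diff)
        show "(\<lambda>x. f \<omega> t x 0 (\<lambda>_. 0)) \<in> borel_measurable borel"
          using mark_section_measurable[OF fm(4) w t] unfolding f0_def by simp
        show "c' = 0 \<or> c' = 1" by (simp add: c'_def)
      qed simp
      then show "(\<integral>\<^sup>+x. h1 ((\<omega>, t), x) \<partial>\<phi> \<omega> t) \<le> (\<integral>\<^sup>+x. h2 ((\<omega>, t), x) \<partial>\<phi> \<omega> t)"
        unfolding h1_def h2_def k1_def k2_def k3_def f1_def f2_def f0_def vt_def v'_def cc_def c'_def fst_conv snd_conv .
    qed
    also have "nu_int h2 \<omega> = nu_int (\<lambda>u. ennreal (k1 * a u + k2 * b u + k3 * d u)) \<omega>"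
    proof (intro nn_integral_cong_AE, use AE_nu_left_version[OF s'] z0 in eventually_elim)
      fix z :: "real \<times> 'k"
      obtain t x where z: "z = (t, x)" by (cases z)
      assume 1: "fst z \<in> {0<..T} \<longrightarrow> Y' \<omega> (fst z) = left_version T (Y' \<omega>) (fst z) \<and> left_limit (Y' \<omega>) (fst z) = left_version T (Y' \<omega>) (fst z)"
        "S m \<omega> < ennreal (fst z) \<and> fst z \<le> T \<longrightarrow> Z' \<omega> (fst z) (snd z) = 0"
      show "h2 ((\<omega>, fst z), snd z) * indicator ({0<..T} \<times> UNIV) z =
        ennreal (k1 * a ((\<omega>, fst z), snd z) + k2 * b ((\<omega>, fst z), snd z) + k3 * d ((\<omega>, fst z), snd z)) * indicator ({0<..T} \<times> UNIV) z"
      proof (cases "t \<in> {0<..T}")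
        case t: True
        show ?thesis
        proof (cases "S m \<omega> < ennreal t")
          case True
          then have "left_version T (Y' \<omega>) t = 0" using y0 1(1) t z by auto
          then show ?thesis using True t 1(2) z
            by (simp add: h2_def vt_def cc_def Zt_def a_def b_def d_def f0_def algebra_simps)
        next
          case False
          then show ?thesis using t z
            by (simp add: h2_def vt_def cc_def Zt_def a_def b_def d_def f0_def algebra_simps)
        qed
      qed (simp add: z)
    qed
    finally have "?drive \<le> nu_int (\<lambda>u. ennreal (k1 * a u + k2 * b u + k3 * d u)) \<omega>" .
    then show "ennreal \<beta> * nu_int (\<lambda>u. ennreal (a u)) \<omega> + mu_int (\<lambda>u. ennreal (c u)) \<omega>
      \<le> ennreal (\<bar>\<xi> \<omega> - \<xi>' \<omega>\<bar> powr p * exp (\<beta> * A \<omega> T)) + mu_int (\<lambda>u. ennreal (a u)) \<omega> +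
        nu_int (\<lambda>u. ennreal ((p * L' + (p - 1) * \<delta> + (p - 1) * \<delta>') * a u +
          \<delta> powr (1 - p) * K powr p * b u + \<delta>' powr (1 - p) * d u)) \<omega>"
      unfolding k1_def[symmetric] k2_def[symmetric] k3_def[symmetric]
      using energy by (meson add_left_mono order_trans)
  qed
qed

text \<open>The weighted powers \<open>a\<close>, \<open>b\<close>, \<open>c\<close> of \<open>y\<close>, \<open>z\<close> and \<open>y + z\<close> are predictable, so in expectation the integrals
against the jump measure in the energy inequality become integrals against \<open>\<nu>\<close>. The constant depends
neither on \<open>m\<close> nor on the solutions.\<close>

lemma truncation_stability:
  assumes H: "hypothesis_H M T F \<nu> A \<phi> p \<beta> L L' \<xi> f" and m: "m \<ge> 1"
    and Lp: "(Y, Z) \<in> Lp_beta M T F \<nu> A p \<beta>"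
    and sol: "bsde_solution M T F (jump_measure T S X) \<nu> \<xi>
           (\<lambda>\<omega> s x. f \<omega> s x (left_limit (Y \<omega>) s) (Z \<omega> s)) Y Z"
    and Lp': "(Y', Z') \<in> Lp_beta M T F \<nu> A p \<beta>"
    and sol': "bsde_solution M T F (jump_measure T S X) \<nu>
           (\<lambda>\<omega>. \<xi> \<omega> * indicator {\<omega>. ennreal T < S m \<omega>} \<omega>)
           (\<lambda>\<omega> s x. f \<omega> s x (Y' \<omega> s) (Z' \<omega> s) * indicator {s. ennreal s \<le> S m \<omega>} s) Y' Z'"
    and Y0: "AE \<omega> in M. \<forall>s. S m \<omega> < ennreal s \<and> s \<le> T \<longrightarrow> Y' \<omega> s = 0"
    and Z0: "AE \<omega> in M. AE z in \<nu> \<omega>. S m \<omega> < ennreal (fst z) \<and> fst z \<le> T \<longrightarrow> Z' \<omega> (fst z) (snd z) = 0"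
    and \<delta>: "\<delta> > 0" "\<delta>' > 0" and K: "L \<le> K" "0 < K" and \<epsilon>: "\<epsilon> > 0"
    and k: "k1 = p * L' + (p - 1) * \<delta> + (p - 1) * \<delta>'" "k2 = \<delta> powr (1 - p) * K powr p" "k3 = \<delta>' powr (1 - p)"
    and gap: "\<beta> - 1 - k1 - C_eps p \<epsilon> / (1 + \<epsilon>) > 0" "1 / (1 + \<epsilon>) - k2 > 0"
  shows "(\<integral>\<^sup>+\<omega>. (\<integral>\<^sup>+z\<in>{0<..T} \<times> UNIV.
        ennreal ((\<bar>Y \<omega> (fst z) - Y' \<omega> (fst z)\<bar> powr p
                  + \<bar>Z \<omega> (fst z) (snd z) - Z' \<omega> (fst z) (snd z)\<bar> powr p)
                 * exp (\<beta> * A \<omega> (fst z))) \<partial>\<nu> \<omega>) \<partial>M)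
    \<le> ennreal (max 1 k3 / min (\<beta> - 1 - k1 - C_eps p \<epsilon> / (1 + \<epsilon>)) (1 / (1 + \<epsilon>) - k2)) *
      (\<integral>\<^sup>+\<omega>. (ennreal (\<bar>\<xi> \<omega>\<bar> powr p * exp (\<beta> * A \<omega> T)) * indicator {\<omega>. S m \<omega> < ennreal T} \<omega>
        + (\<integral>\<^sup>+z\<in>{s. min (S m \<omega>) (ennreal T) < ennreal s \<and> s \<le> T} \<times> UNIV.
             ennreal (\<bar>f \<omega> (fst z) (snd z) 0 (\<lambda>_. 0)\<bar> powr p * exp (\<beta> * A \<omega> (fst z)))
           \<partial>\<nu> \<omega>)) \<partial>M)"
proof -
  have p: "p > 1" and \<beta>: "\<beta> > 0" and L': "L' \<ge> 0" using H by (auto simp: hypothesis_H_def)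
  have Y: "adapted_process T F Y" and Z: "predictable (space M) T F Z"
    and Y': "adapted_process T F Y'" and Z': "predictable (space M) T F Z'"
    using sol sol' by (auto simp: bsde_solution_def)
  note [measurable] = predictable_A predictable_left_version[OF Y] predictable_left_version[OF Y']
    predictable_at_mark[OF Z] predictable_at_mark[OF Z'] predictable_after_S[OF m] S_measurable[OF m]
  have zero: "predictable (space M) T F (\<lambda>_ _ _. 0)" by (simp add: predictable_def case_prod_beta')
  have f0[measurable]: "(\<lambda>u. f (fst (fst u)) (snd (fst u)) (snd u) 0 (\<lambda>_. 0)) \<in> borel_measurable (Pr \<Otimes>\<^sub>M borel)"
    using predictable_driver[OF H zero, of "\<lambda>_. 0"] by simp
  define a where "a u = \<bar>lv Y u - lv Y' u\<bar> powr p * weight \<beta> u" for u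
  define b where "b u = \<bar>at_mark Z u - at_mark Z' u\<bar> powr p * weight \<beta> u" for u
  define c where "c u = \<bar>(lv Y u - lv Y' u) + (at_mark Z u - at_mark Z' u)\<bar> powr p * weight \<beta> u" for u
  define d where "d u = (if S m (fst (fst u)) < ennreal (snd (fst u))
      then \<bar>f (fst (fst u)) (snd (fst u)) (snd u) 0 (\<lambda>_. 0)\<bar> powr p * weight \<beta> u else 0)" for u
  define x where "x \<omega> = ennreal (\<bar>\<xi> \<omega> - \<xi> \<omega> * indicator {\<omega>. ennreal T < S m \<omega>} \<omega>\<bar> powr p * exp (\<beta> * A \<omega> T))" for \<omega>
  have [measurable]: "a \<in> borel_measurable (Pr \<Otimes>\<^sub>M borel)" "b \<in> borel_measurable (Pr \<Otimes>\<^sub>M borel)"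
    "c \<in> borel_measurable (Pr \<Otimes>\<^sub>M borel)" "d \<in> borel_measurable (Pr \<Otimes>\<^sub>M borel)"
    unfolding a_def[abs_def] b_def[abs_def] c_def[abs_def] d_def[abs_def] by measurable
  have nonneg: "a u \<ge> 0" "b u \<ge> 0" "c u \<ge> 0" "d u \<ge> 0" for u
    by (simp_all add: a_def b_def c_def d_def)
  let ?a = "\<lambda>u. ennreal (a u)" and ?b = "\<lambda>u. ennreal (b u)" and ?c = "\<lambda>u. ennreal (c u)" and ?d = "\<lambda>u. ennreal (d u)"
  have am: "?a \<in> borel_measurable (Pr \<Otimes>\<^sub>M borel)" and bm: "?b \<in> borel_measurable (Pr \<Otimes>\<^sub>M borel)"
    and cm: "?c \<in> borel_measurable (Pr \<Otimes>\<^sub>M borel)" and dm: "?d \<in> borel_measurable (Pr \<Otimes>\<^sub>M borel)"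
    by measurable
  note [measurable] = nu_int_measurable[OF am] nu_int_measurable[OF bm] nu_int_measurable[OF cm] nu_int_measurable[OF dm]
    mu_int_measurable[OF am] mu_int_measurable[OF cm]
  let ?E = "\<lambda>H. \<integral>\<^sup>+\<omega>. nu_int H \<omega> \<partial>M"
  have xm[measurable]: "x \<in> borel_measurable M" and \<xi>m[measurable]: "\<xi> \<in> borel_measurable M"
    and AT[measurable]: "(\<lambda>\<omega>. A \<omega> T) \<in> borel_measurable M"
  proof -
    have "\<xi> \<in> borel_measurable (F (ennreal T))" using H by (simp add: hypothesis_H_def)
    then show 1[measurable]: "\<xi> \<in> borel_measurable M"
      by (rule measurable_from_subalg[rotated]) (simp add: subalgebra_def space_F sets_F_subset)
    show 2[measurable]: "(\<lambda>\<omega>. A \<omega> T) \<in> borel_measurable M"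
      using measurable_compose[OF Pr_time[of "\<lambda>_. T"] A_predictable] T_pos by simp
    show "x \<in> borel_measurable M" unfolding x_def[abs_def] by measurable
  qed
  have k0: "k1 \<ge> 0" "k2 \<ge> 0" "k3 \<ge> 0" using p L' \<delta> by (auto simp: k)
  have comb: "nu_int (\<lambda>u. ennreal (k1 * a u + k2 * b u + k3 * d u)) \<omega> =
    ennreal k1 * nu_int ?a \<omega> + ennreal k2 * nu_int ?b \<omega> + ennreal k3 * nu_int ?d \<omega>" if w: "\<omega> \<in> space M" for \<omega>
  proof -
    have "nu_int (\<lambda>u. ennreal (k1 * a u + k2 * b u + k3 * d u)) \<omega> =
      nu_int (\<lambda>u. (ennreal k1 * ?a u + ennreal k2 * ?b u) + ennreal k3 * ?d u) \<omega>"
      using k0 nonneg by (intro nn_integral_cong) (simp add: ennreal_mult)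
    also have "\<dots> = nu_int (\<lambda>u. ennreal k1 * ?a u) \<omega> + nu_int (\<lambda>u. ennreal k2 * ?b u) \<omega> + nu_int (\<lambda>u. ennreal k3 * ?d u) \<omega>"
      by (subst nu_int_add[OF w], measurable, subst nu_int_add[OF w], measurable)
    finally show ?thesis unfolding nu_int_cmult[OF w am] nu_int_cmult[OF w bm] nu_int_cmult[OF w dm] .
  qed
  have "(\<integral>\<^sup>+\<omega>. ennreal \<beta> * nu_int ?a \<omega> + mu_int ?c \<omega> \<partial>M) \<le> (\<integral>\<^sup>+\<omega>. x \<omega> + mu_int ?a \<omega> +
      (ennreal k1 * nu_int ?a \<omega> + ennreal k2 * nu_int ?b \<omega> + ennreal k3 * nu_int ?d \<omega>) \<partial>M)"
  proof (intro nn_integral_mono_AE)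
    show "AE \<omega> in M. ennreal \<beta> * nu_int ?a \<omega> + mu_int ?c \<omega> \<le> x \<omega> + mu_int ?a \<omega> +
      (ennreal k1 * nu_int ?a \<omega> + ennreal k2 * nu_int ?b \<omega> + ennreal k3 * nu_int ?d \<omega>)"
      using truncation_energy[OF H m sol sol' Y0 Z0 \<delta> K] AE_space
    proof eventually_elim
      fix \<omega> assume w: "\<omega> \<in> space M"
      assume *: "ennreal \<beta> * nu_int (\<lambda>u. ennreal (\<bar>lv Y u - lv Y' u\<bar> powr p * weight \<beta> u)) \<omega> +
        mu_int (\<lambda>u. ennreal (\<bar>(lv Y u - lv Y' u) + (at_mark Z u - at_mark Z' u)\<bar> powr p * weight \<beta> u)) \<omega>
        \<le> ennreal (\<bar>\<xi> \<omega> - \<xi> \<omega> * indicator {\<omega>. ennreal T < S m \<omega>} \<omega>\<bar> powr p * exp (\<beta> * A \<omega> T)) +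
          mu_int (\<lambda>u. ennreal (\<bar>lv Y u - lv Y' u\<bar> powr p * weight \<beta> u)) \<omega> +
          nu_int (\<lambda>u. ennreal ((p * L' + (p - 1) * \<delta> + (p - 1) * \<delta>') * (\<bar>lv Y u - lv Y' u\<bar> powr p * weight \<beta> u) +
          \<delta> powr (1 - p) * K powr p * (\<bar>at_mark Z u - at_mark Z' u\<bar> powr p * weight \<beta> u) + \<delta>' powr (1 - p) *
          (if S m (fst (fst u)) < ennreal (snd (fst u))
            then \<bar>f (fst (fst u)) (snd (fst u)) (snd u) 0 (\<lambda>_. 0)\<bar> powr p * weight \<beta> u else 0))) \<omega>"
      show "ennreal \<beta> * nu_int ?a \<omega> + mu_int ?c \<omega> \<le> x \<omega> + mu_int ?a \<omega> +
        (ennreal k1 * nu_int ?a \<omega> + ennreal k2 * nu_int ?b \<omega> + ennreal k3 * nu_int ?d \<omega>)"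
        using * unfolding comb[OF w, symmetric] unfolding a_def b_def c_def d_def x_def k .
    qed
  qed
  moreover have "(\<integral>\<^sup>+\<omega>. ennreal \<beta> * nu_int ?a \<omega> + mu_int ?c \<omega> \<partial>M) = ennreal \<beta> * ?E ?a + ?E ?c"
    unfolding compensation[OF cm, symmetric] by (subst nn_integral_add) (auto simp: nn_integral_cmult)
  moreover have "(\<integral>\<^sup>+\<omega>. x \<omega> + mu_int ?a \<omega> +
      (ennreal k1 * nu_int ?a \<omega> + ennreal k2 * nu_int ?b \<omega> + ennreal k3 * nu_int ?d \<omega>) \<partial>M) =
    (\<integral>\<^sup>+\<omega>. x \<omega> \<partial>M) + ?E ?a + (ennreal k1 * ?E ?a + ennreal k2 * ?E ?b + ennreal k3 * ?E ?d)"
  proof -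
    have "(\<integral>\<^sup>+\<omega>. x \<omega> + mu_int ?a \<omega> +
      (ennreal k1 * nu_int ?a \<omega> + ennreal k2 * nu_int ?b \<omega> + ennreal k3 * nu_int ?d \<omega>) \<partial>M) =
      (\<integral>\<^sup>+\<omega>. x \<omega> + mu_int ?a \<omega> \<partial>M) + (\<integral>\<^sup>+\<omega>. ennreal k1 * nu_int ?a \<omega> + ennreal k2 * nu_int ?b \<omega> + ennreal k3 * nu_int ?d \<omega> \<partial>M)"
      by (rule nn_integral_add) measurable
    also have "(\<integral>\<^sup>+\<omega>. x \<omega> + mu_int ?a \<omega> \<partial>M) = (\<integral>\<^sup>+\<omega>. x \<omega> \<partial>M) + (\<integral>\<^sup>+\<omega>. mu_int ?a \<omega> \<partial>M)"
      by (rule nn_integral_add) measurable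
    also have "(\<integral>\<^sup>+\<omega>. ennreal k1 * nu_int ?a \<omega> + ennreal k2 * nu_int ?b \<omega> + ennreal k3 * nu_int ?d \<omega> \<partial>M) =
      (\<integral>\<^sup>+\<omega>. ennreal k1 * nu_int ?a \<omega> + ennreal k2 * nu_int ?b \<omega> \<partial>M) + (\<integral>\<^sup>+\<omega>. ennreal k3 * nu_int ?d \<omega> \<partial>M)"
      by (rule nn_integral_add) measurable
    also have "(\<integral>\<^sup>+\<omega>. ennreal k1 * nu_int ?a \<omega> + ennreal k2 * nu_int ?b \<omega> \<partial>M) =
      (\<integral>\<^sup>+\<omega>. ennreal k1 * nu_int ?a \<omega> \<partial>M) + (\<integral>\<^sup>+\<omega>. ennreal k2 * nu_int ?b \<omega> \<partial>M)"
      by (rule nn_integral_add) measurable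
    finally show ?thesis unfolding compensation[OF am] by (simp add: nn_integral_cmult)
  qed
  ultimately have energy: "ennreal \<beta> * ?E ?a + ?E ?c \<le>
    (\<integral>\<^sup>+\<omega>. x \<omega> \<partial>M) + ?E ?a + (ennreal k1 * ?E ?a + ennreal k2 * ?E ?b + ennreal k3 * ?E ?d)" by simp
  have C0: "C_eps p \<epsilon> \<ge> 0" by (simp add: C_eps_def)
  have split: "?E ?b \<le> ennreal (1 + \<epsilon>) * ?E ?c + ennreal (C_eps p \<epsilon>) * ?E ?a"
  proof -
    have "?E ?b \<le> (\<integral>\<^sup>+\<omega>. ennreal (1 + \<epsilon>) * nu_int ?c \<omega> + ennreal (C_eps p \<epsilon>) * nu_int ?a \<omega> \<partial>M)"
    proof (intro nn_integral_mono)
      fix \<omega> assume w: "\<omega> \<in> space M"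
      have "nu_int ?b \<omega> \<le> nu_int (\<lambda>u. ennreal (1 + \<epsilon>) * ?c u + ennreal (C_eps p \<epsilon>) * ?a u) \<omega>"
      proof (intro nn_integral_mono mult_right_mono)
        fix z :: "real \<times> 'k"
        let ?u = "((\<omega>, fst z), snd z)"
        have "b ?u \<le> ((1 + \<epsilon>) * \<bar>(lv Y ?u - lv Y' ?u) + (at_mark Z ?u - at_mark Z' ?u)\<bar> powr p +
            C_eps p \<epsilon> * \<bar>lv Y ?u - lv Y' ?u\<bar> powr p) * weight \<beta> ?u"
          unfolding b_def by (intro mult_right_mono abs_powr_le_C_eps p \<epsilon>) simp
        also have "\<dots> = (1 + \<epsilon>) * c ?u + C_eps p \<epsilon> * a ?u"
          unfolding a_def c_def by (simp only: distrib_right mult.assoc)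
        finally have "ennreal (b ?u) \<le> ennreal ((1 + \<epsilon>) * c ?u + C_eps p \<epsilon> * a ?u)" by (rule ennreal_leI)
        also have "\<dots> = ennreal (1 + \<epsilon>) * ?c ?u + ennreal (C_eps p \<epsilon>) * ?a ?u"
          using \<epsilon> C0 nonneg[of ?u] by (simp add: ennreal_mult del: ennreal_plus add: ennreal_plus[of "(1 + \<epsilon>) * c ?u" "C_eps p \<epsilon> * a ?u"])
        finally show "?b ?u \<le> ennreal (1 + \<epsilon>) * ?c ?u + ennreal (C_eps p \<epsilon>) * ?a ?u" .
      qed simp
      also have "\<dots> = nu_int (\<lambda>u. ennreal (1 + \<epsilon>) * ?c u) \<omega> + nu_int (\<lambda>u. ennreal (C_eps p \<epsilon>) * ?a u) \<omega>"
        by (rule nu_int_add[OF w]) measurable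
      finally show "nu_int ?b \<omega> \<le> ennreal (1 + \<epsilon>) * nu_int ?c \<omega> + ennreal (C_eps p \<epsilon>) * nu_int ?a \<omega>"
        unfolding nu_int_cmult[OF w cm] nu_int_cmult[OF w am] .
    qed
    also have "\<dots> = (\<integral>\<^sup>+\<omega>. ennreal (1 + \<epsilon>) * nu_int ?c \<omega> \<partial>M) + (\<integral>\<^sup>+\<omega>. ennreal (C_eps p \<epsilon>) * nu_int ?a \<omega> \<partial>M)"
      by (rule nn_integral_add) measurable
    finally show ?thesis by (simp add: nn_integral_cmult)
  qed
  have fin: "?E ?a < \<infinity>" "?E ?b < \<infinity>"
    unfolding a_def b_def using p
    by (intro nu_expectation_diff_finite Lp_beta_finite[OF Lp sol] Lp_beta_finite[OF Lp' sol']; measurable)+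
  note main = absorb_estimate[OF fin energy split less_imp_le[OF \<beta>] \<epsilon> k0 C0 gap]
  have lhs: "(\<integral>\<^sup>+\<omega>. (\<integral>\<^sup>+z\<in>{0<..T} \<times> UNIV.
        ennreal ((\<bar>Y \<omega> (fst z) - Y' \<omega> (fst z)\<bar> powr p
                  + \<bar>Z \<omega> (fst z) (snd z) - Z' \<omega> (fst z) (snd z)\<bar> powr p)
                 * exp (\<beta> * A \<omega> (fst z))) \<partial>\<nu> \<omega>) \<partial>M) = ?E ?a + ?E ?b"
  proof -
    have "(\<integral>\<^sup>+\<omega>. (\<integral>\<^sup>+z\<in>{0<..T} \<times> UNIV.
        ennreal ((\<bar>Y \<omega> (fst z) - Y' \<omega> (fst z)\<bar> powr p
                  + \<bar>Z \<omega> (fst z) (snd z) - Z' \<omega> (fst z) (snd z)\<bar> powr p)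
                 * exp (\<beta> * A \<omega> (fst z))) \<partial>\<nu> \<omega>) \<partial>M) = (\<integral>\<^sup>+\<omega>. nu_int ?a \<omega> + nu_int ?b \<omega> \<partial>M)"
    proof (intro nn_integral_cong_AE, use AE_solution_path[OF sol] AE_solution_path[OF sol'] in eventually_elim)
      fix \<omega>
      assume s: "solution_path \<xi> (\<lambda>\<omega> s x. f \<omega> s x (left_limit (Y \<omega>) s) (Z \<omega> s)) Y Z \<omega>"
        and s': "solution_path (\<lambda>\<omega>. \<xi> \<omega> * indicator {\<omega>. ennreal T < S m \<omega>} \<omega>)
          (\<lambda>\<omega> s x. f \<omega> s x (Y' \<omega> s) (Z' \<omega> s) * indicator {s. ennreal s \<le> S m \<omega>} s) Y' Z' \<omega>"
      have w: "\<omega> \<in> space M" using s by (auto simp: solution_path_def regular_def)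
      have "(\<integral>\<^sup>+z\<in>{0<..T} \<times> UNIV.
        ennreal ((\<bar>Y \<omega> (fst z) - Y' \<omega> (fst z)\<bar> powr p
                  + \<bar>Z \<omega> (fst z) (snd z) - Z' \<omega> (fst z) (snd z)\<bar> powr p)
                 * exp (\<beta> * A \<omega> (fst z))) \<partial>\<nu> \<omega>) = nu_int (\<lambda>u. ?a u + ?b u) \<omega>"
        by (intro nn_integral_cong_AE, use AE_nu_left_version[OF s] AE_nu_left_version[OF s'] in eventually_elim)
          (auto simp: indicator_def a_def b_def distrib_right)
      also have "\<dots> = nu_int ?a \<omega> + nu_int ?b \<omega>" by (rule nu_int_add[OF w am bm])
      finally show "(\<integral>\<^sup>+z\<in>{0<..T} \<times> UNIV.
        ennreal ((\<bar>Y \<omega> (fst z) - Y' \<omega> (fst z)\<bar> powr p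
                  + \<bar>Z \<omega> (fst z) (snd z) - Z' \<omega> (fst z) (snd z)\<bar> powr p)
                 * exp (\<beta> * A \<omega> (fst z))) \<partial>\<nu> \<omega>) = nu_int ?a \<omega> + nu_int ?b \<omega>" .
    qed
    also have "\<dots> = ?E ?a + ?E ?b" by (rule nn_integral_add) measurable
    finally show ?thesis .
  qed
  have rhs: "(\<integral>\<^sup>+\<omega>. (ennreal (\<bar>\<xi> \<omega>\<bar> powr p * exp (\<beta> * A \<omega> T)) * indicator {\<omega>. S m \<omega> < ennreal T} \<omega>
        + (\<integral>\<^sup>+z\<in>{s. min (S m \<omega>) (ennreal T) < ennreal s \<and> s \<le> T} \<times> UNIV.
             ennreal (\<bar>f \<omega> (fst z) (snd z) 0 (\<lambda>_. 0)\<bar> powr p * exp (\<beta> * A \<omega> (fst z)))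
           \<partial>\<nu> \<omega>)) \<partial>M) = (\<integral>\<^sup>+\<omega>. x \<omega> \<partial>M) + ?E ?d"
  proof -
    have "(\<integral>\<^sup>+\<omega>. x \<omega> \<partial>M) + ?E ?d = (\<integral>\<^sup>+\<omega>. x \<omega> + nu_int ?d \<omega> \<partial>M)"
      by (rule nn_integral_add[symmetric]) measurable
    also have "\<dots> = (\<integral>\<^sup>+\<omega>. (ennreal (\<bar>\<xi> \<omega>\<bar> powr p * exp (\<beta> * A \<omega> T)) * indicator {\<omega>. S m \<omega> < ennreal T} \<omega>
        + (\<integral>\<^sup>+z\<in>{s. min (S m \<omega>) (ennreal T) < ennreal s \<and> s \<le> T} \<times> UNIV.
             ennreal (\<bar>f \<omega> (fst z) (snd z) 0 (\<lambda>_. 0)\<bar> powr p * exp (\<beta> * A \<omega> (fst z)))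
           \<partial>\<nu> \<omega>)) \<partial>M)"
    proof (intro nn_integral_cong_AE, use S_ne_T in eventually_elim)
      fix \<omega> assume ne: "\<forall>m\<ge>1. S m \<omega> \<noteq> ennreal T"
      have "x \<omega> = ennreal (\<bar>\<xi> \<omega>\<bar> powr p * exp (\<beta> * A \<omega> T)) * indicator {\<omega>. S m \<omega> < ennreal T} \<omega>"
        using ne m p by (auto simp: x_def indicator_def not_less)
      moreover have "nu_int ?d \<omega> = (\<integral>\<^sup>+z\<in>{s. min (S m \<omega>) (ennreal T) < ennreal s \<and> s \<le> T} \<times> UNIV.
             ennreal (\<bar>f \<omega> (fst z) (snd z) 0 (\<lambda>_. 0)\<bar> powr p * exp (\<beta> * A \<omega> (fst z))) \<partial>\<nu> \<omega>)"
      proof (intro nn_integral_cong)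
        fix z :: "real \<times> 'k"
        have "z \<in> {s. min (S m \<omega>) (ennreal T) < ennreal s \<and> s \<le> T} \<times> UNIV \<longleftrightarrow>
          fst z \<in> {0<..T} \<and> S m \<omega> < ennreal (fst z)"
        proof -
          have "\<not> ennreal T < ennreal s" if "s \<le> T" for s using that by (simp add: not_less ennreal_leI)
          moreover have "0 < s" if "S m \<omega> < ennreal s" for s
            using that by (metis ennreal_neg less_le_trans linorder_not_less not_less_zero zero_le)
          ultimately show ?thesis by (cases z) (auto simp: min_less_iff_disj)
        qed
        then show "?d ((\<omega>, fst z), snd z) * indicator ({0<..T} \<times> UNIV) z =
          ennreal (\<bar>f \<omega> (fst z) (snd z) 0 (\<lambda>_. 0)\<bar> powr p * exp (\<beta> * A \<omega> (fst z))) *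
          indicator ({s. min (S m \<omega>) (ennreal T) < ennreal s \<and> s \<le> T} \<times> UNIV) z"
          by (cases z) (auto simp: d_def indicator_def)
      qed
      ultimately show "x \<omega> + nu_int ?d \<omega> = ennreal (\<bar>\<xi> \<omega>\<bar> powr p * exp (\<beta> * A \<omega> T)) * indicator {\<omega>. S m \<omega> < ennreal T} \<omega>
        + (\<integral>\<^sup>+z\<in>{s. min (S m \<omega>) (ennreal T) < ennreal s \<and> s \<le> T} \<times> UNIV.
             ennreal (\<bar>f \<omega> (fst z) (snd z) 0 (\<lambda>_. 0)\<bar> powr p * exp (\<beta> * A \<omega> (fst z)))
           \<partial>\<nu> \<omega>)" by simp
    qed
    finally show ?thesis by simp
  qed
  show ?thesis unfolding lhs rhs by (rule main)
qed

end

theorem proposition4p1: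
  fixes M :: "'w measure" and T :: real
    and S :: "nat \<Rightarrow> 'w \<Rightarrow> ennreal" and X :: "nat \<Rightarrow> 'w \<Rightarrow> 'k::lusin_space" and \<Delta> :: 'k
    and F :: "ennreal \<Rightarrow> 'w measure" and \<nu> :: "'w \<Rightarrow> (real \<times> 'k) measure"
    and A :: "'w \<Rightarrow> real \<Rightarrow> real" and \<phi> :: "'w \<Rightarrow> real \<Rightarrow> 'k measure"
    and p \<epsilon> \<beta> L L' :: real
    and \<xi> :: "'w \<Rightarrow> real" and f :: "'w \<Rightarrow> real \<Rightarrow> 'k \<Rightarrow> real \<Rightarrow> ('k \<Rightarrow> real) \<Rightarrow> real"
    and Y :: "'w \<Rightarrow> real \<Rightarrow> real" and Z :: "'w \<Rightarrow> real \<Rightarrow> 'k \<Rightarrow> real"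
    and Ym :: "nat \<Rightarrow> 'w \<Rightarrow> real \<Rightarrow> real" and Zm :: "nat \<Rightarrow> 'w \<Rightarrow> real \<Rightarrow> 'k \<Rightarrow> real"
  assumes "marked_point_process M T S X \<Delta> F \<nu> A \<phi>"
    and "p > 1" and "\<epsilon> > 0"
    and "hypothesis_H M T F \<nu> A \<phi> p \<beta> L L' \<xi> f"
    and "\<beta> > 1 + C_eps p \<epsilon> / (1 + \<epsilon>) + p * L'
           + (p - 1) * ((L + 1) powr p * (1 + \<epsilon>)) powr (1 / (p - 1))"
    and "(Y, Z) \<in> Lp_beta M T F \<nu> A p \<beta>"
    and "bsde_solution M T F (jump_measure T S X) \<nu> \<xi>
           (\<lambda>\<omega> s x. f \<omega> s x (left_limit (Y \<omega>) s) (Z \<omega> s)) Y Z"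
    and "\<And>m. m \<ge> 1 \<Longrightarrow> (Ym m, Zm m) \<in> Lp_beta M T F \<nu> A p \<beta>"
    and "\<And>m. m \<ge> 1 \<Longrightarrow> bsde_solution M T F (jump_measure T S X) \<nu>
           (\<lambda>\<omega>. \<xi> \<omega> * indicator {\<omega>. ennreal T < S m \<omega>} \<omega>)
           (\<lambda>\<omega> s x. f \<omega> s x (Ym m \<omega> s) (Zm m \<omega> s) * indicator {s. ennreal s \<le> S m \<omega>} s)
           (Ym m) (Zm m)"
    and "\<And>m. m \<ge> 1 \<Longrightarrow> AE \<omega> in M. \<forall>s. S m \<omega> < ennreal s \<and> s \<le> T \<longrightarrow> Ym m \<omega> s = 0"
    and "\<And>m. m \<ge> 1 \<Longrightarrow> AE \<omega> in M. AE z in \<nu> \<omega>.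
           S m \<omega> < ennreal (fst z) \<and> fst z \<le> T \<longrightarrow> Zm m \<omega> (fst z) (snd z) = 0"
  shows "\<exists>C::real. \<forall>m\<ge>1.
    (\<integral>\<^sup>+\<omega>. (\<integral>\<^sup>+z\<in>{0<..T} \<times> UNIV.
        ennreal ((\<bar>Y \<omega> (fst z) - Ym m \<omega> (fst z)\<bar> powr p
                  + \<bar>Z \<omega> (fst z) (snd z) - Zm m \<omega> (fst z) (snd z)\<bar> powr p)
                 * exp (\<beta> * A \<omega> (fst z))) \<partial>\<nu> \<omega>) \<partial>M)
    \<le> ennreal C *
      (\<integral>\<^sup>+\<omega>. (ennreal (\<bar>\<xi> \<omega>\<bar> powr p * exp (\<beta> * A \<omega> T)) * indicator {\<omega>. S m \<omega> < ennreal T} \<omega>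
        + (\<integral>\<^sup>+z\<in>{s. min (S m \<omega>) (ennreal T) < ennreal s \<and> s \<le> T} \<times> UNIV.
             ennreal (\<bar>f \<omega> (fst z) (snd z) 0 (\<lambda>_. 0)\<bar> powr p * exp (\<beta> * A \<omega> (fst z)))
           \<partial>\<nu> \<omega>)) \<partial>M)"
proof -
  interpret marked_point_process M T S X \<Delta> F \<nu> A \<phi> by fact
  have p: "p > 1" and \<epsilon>: "\<epsilon> > 0" by fact+
  have L: "L \<ge> 0" using \<open>hypothesis_H M T F \<nu> A \<phi> p \<beta> L L' \<xi> f\<close> by (simp add: hypothesis_H_def)
  \<comment> \<open>With this parameter Young's inequality produces exactly the last term in the lower bound on \<open>\<beta>\<close>.\<close>
  define \<delta> where "\<delta> = ((L + 1) powr p * (1 + \<epsilon>)) powr (1 / (p - 1))"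
  define s where "s = \<beta> - (1 + C_eps p \<epsilon> / (1 + \<epsilon>) + p * L' + (p - 1) * \<delta>)"
  \<comment> \<open>The driver at \<open>(0, 0)\<close> may use up half of the remaining room \<open>s\<close> in the condition on \<open>\<beta>\<close>.\<close>
  define \<delta>' where "\<delta>' = s / 2 / (p - 1)"
  \<comment> \<open>Any constant strictly between \<open>L\<close> and \<open>L + 1\<close> is positive and keeps \<open>k2\<close> below \<open>1 / (1 + \<epsilon>)\<close>.\<close>
  define K where "K = L + 1 / 2"
  define k1 where "k1 = p * L' + (p - 1) * \<delta> + (p - 1) * \<delta>'"
  define k2 where "k2 = \<delta> powr (1 - p) * K powr p"
  define k3 where "k3 = \<delta>' powr (1 - p)"
  have \<delta>: "\<delta> > 0" using L \<epsilon> by (simp add: \<delta>_def)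
  have s: "s > 0" using assms(5) by (simp add: s_def \<delta>_def)
  have \<delta>': "\<delta>' > 0" using s p by (simp add: \<delta>'_def)
  have K: "L \<le> K" "0 < K" using L by (auto simp: K_def)
  have "p - 1 \<noteq> 0" using p by simp
  then have "(p - 1) * \<delta>' = s / 2"
    unfolding \<delta>'_def by (metis nonzero_mult_div_cancel_left times_divide_eq_right)
  then have gap1: "\<beta> - 1 - k1 - C_eps p \<epsilon> / (1 + \<epsilon>) > 0" using s by (simp add: k1_def s_def)
  have "\<delta> powr (1 - p) = ((L + 1) powr p * (1 + \<epsilon>)) powr (1 / (p - 1) * (1 - p))"
    unfolding \<delta>_def by (rule powr_powr)
  also have "1 / (p - 1) * (1 - p) = - 1" using p by (simp add: field_simps)
  finally have "\<delta> powr (1 - p) = 1 / ((L + 1) powr p * (1 + \<epsilon>))"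
    using L \<epsilon> by (simp add: powr_minus_divide)
  moreover have "K powr p < (L + 1) powr p" using p L by (intro powr_less_mono2) (auto simp: K_def)
  then have "K powr p / (L + 1) powr p < 1" using L by simp
  from mult_strict_right_mono[OF this, of "1 / (1 + \<epsilon>)"]
  have "K powr p / (L + 1) powr p * (1 / (1 + \<epsilon>)) < 1 / (1 + \<epsilon>)" using \<epsilon> by simp
  ultimately have "k2 < 1 / (1 + \<epsilon>)" by (simp add: k2_def)
  then have gap2: "1 / (1 + \<epsilon>) - k2 > 0" by simp
  show ?thesis
  proof (intro exI allI impI)
    fix m :: nat assume m: "1 \<le> m"
    show "(\<integral>\<^sup>+\<omega>. (\<integral>\<^sup>+z\<in>{0<..T} \<times> UNIV.
        ennreal ((\<bar>Y \<omega> (fst z) - Ym m \<omega> (fst z)\<bar> powr p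
                  + \<bar>Z \<omega> (fst z) (snd z) - Zm m \<omega> (fst z) (snd z)\<bar> powr p)
                 * exp (\<beta> * A \<omega> (fst z))) \<partial>\<nu> \<omega>) \<partial>M)
    \<le> ennreal (max 1 k3 / min (\<beta> - 1 - k1 - C_eps p \<epsilon> / (1 + \<epsilon>)) (1 / (1 + \<epsilon>) - k2)) *
      (\<integral>\<^sup>+\<omega>. (ennreal (\<bar>\<xi> \<omega>\<bar> powr p * exp (\<beta> * A \<omega> T)) * indicator {\<omega>. S m \<omega> < ennreal T} \<omega>
        + (\<integral>\<^sup>+z\<in>{s. min (S m \<omega>) (ennreal T) < ennreal s \<and> s \<le> T} \<times> UNIV.
             ennreal (\<bar>f \<omega> (fst z) (snd z) 0 (\<lambda>_. 0)\<bar> powr p * exp (\<beta> * A \<omega> (fst z)))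
           \<partial>\<nu> \<omega>)) \<partial>M)"
      by (rule truncation_stability[OF assms(4) m assms(6,7) assms(8)[OF m] assms(9)[OF m] assms(10)[OF m]
          assms(11)[OF m] \<delta> \<delta>' K \<epsilon> k1_def k2_def k3_def gap1 gap2])
  qed
qed

end
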